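(* Let $$V_1(x)=\sum_{i=1}^{k_1}\frac{\lambda_i^1\chi_{B'(a_i^1,r_i^1)}(x)}{|x-a_i^1|^{2s}}+\frac{\lambda_\infty^1\chi_{\mathbb{R}^N\setminus B'_{R_1}}(x)}{|x|^{2s}}+W_1(x)\in\Theta,$$ $$V_2(x)=\sum_{i=1}^{k_2}\frac{\lambda_i^2\chi_{B'(a_i^2,r_i^2)}(x)}{|x-a_i^2|^{2s}}+\frac{\lambda_\infty^2\chi_{\mathbb{R}^N\setminus B'_{R_2}}(x)}{|x|^{2s}}+W_2(x)\in\Theta,$$ and assume that $\mu(V_1),\mu(V_2)>0$ and $\lambda_\infty^1+\lambda_\infty^2<\gamma_H$. Then there exists $R>0$ such that, for every $y\in\mathbb{R}^N\setminus\overline{B'_R}$, $$\mu\big(V_1(\cdot)+V_2(\cdot-y)\big)>0.$$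
   Context: Let $s\in(0,1)$ and let $N\ge1$ be an integer with $N>2s$. Functions are real-valued. $\mathcal{D}^{s,2}(\mathbb{R}^N)$ is the completion of $C_c^\infty(\mathbb{R}^N)$ with respect to the norm $\|u\|_{\mathcal{D}^{s,2}(\mathbb{R}^N)}^2=\frac12 C(N,s)\int_{\mathbb{R}^{2N}}\frac{|u(x)-u(y)|^2}{|x-y|^{N+2s}}\,dx\,dy$, where $C(N,s)=\pi^{-N/2}2^{2s}\frac{\Gamma(\frac{N+2s}{2})}{\Gamma(2-s)}s(1-s)$. Let $\gamma_H=2^{2s}\frac{\Gamma^2(\frac{N+2s}{4})}{\Gamma^2(\frac{N-2s}{4})}$ be the optimal constant in the fractional Hardy inequality $\gamma_H\int_{\mathbb{R}^N}\frac{|u|^2}{|x|^{2s}}dx\le\|u\|^2_{\mathcal{D}^{s,2}(\mathbb{R}^N)}$. $B'(x,r)=\{y\in\mathbb{R}^N:|y-x|<r\}$, $B'_r=B'(0,r)$, and $\chi_A$ is the characteristic function of $A$. The class $\Theta$ is the set of all potentials $V(x)=\sum_{i=1}^{k}\frac{\lambda_i\chi_{B'(a_i,r_i)}(x)}{|x-a_i|^{2s}}+\frac{\lambda_\infty\chi_{\mathbb{R}^N\setminus B'_R}(x)}{|x|^{2s}}+W(x)$ with $k\in\mathbb{N}$, $r_i,R>0$, $a_i\in\mathbb{R}^N$, $a_i\ne a_j$ for $i\ne j$, $\lambda_i,\lambda_\infty<\gamma_H$ (real), and $W\in L^{N/2s}(\mathbb{R}^N)\cap L^\infty(\mathbb{R}^N)$.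 For $V\in L^1_{\mathrm{loc}}(\mathbb{R}^N)$ such that $\sup_{u\in\mathcal{D}^{s,2}(\mathbb{R}^N),u\not\equiv0}\frac{\int_{\mathbb{R}^N}|V|u^2dx}{\|u\|^2_{\mathcal{D}^{s,2}(\mathbb{R}^N)}}<+\infty$ (this includes sums of translates of potentials in $\Theta$), $\mu(V)=\inf_{u\in\mathcal{D}^{s,2}(\mathbb{R}^N)\setminus\{0\}}\frac{\|u\|^2_{\mathcal{D}^{s,2}(\mathbb{R}^N)}-\int_{\mathbb{R}^N}Vu^2\,dx}{\|u\|^2_{\mathcal{D}^{s,2}(\mathbb{R}^N)}}$. *)

theory Defs
  imports "HOL-Analysis.Analysis"
begin

text \<open>
  The space $R^N$ is an arbitrary Euclidean space \<open>'a\<close> with \<open>N = DIM('a)\<close>, carrying Lebesgue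
  measure; \<open>'a \<times> 'a\<close> carries the product Euclidean structure, so that \<open>lebesgue\<close> on
  it is Lebesgue measure on $R^{2N}$.
\<close>

definition C_const :: "nat \<Rightarrow> real \<Rightarrow> real" where
  "C_const N s =
     pi powr (- (real N / 2)) * 2 powr (2 * s) * (Gamma ((real N + 2 * s) / 2) / Gamma (2 - s))
       * s * (1 - s)"

definition gamma_H :: "nat \<Rightarrow> real \<Rightarrow> real" where
  "gamma_H N s =
     2 powr (2 * s) * ((Gamma ((real N + 2 * s) / 4))\<^sup>2 / (Gamma ((real N - 2 * s) / 4))\<^sup>2)"

text \<open>
  A function is $C^{k+1}$ iff it is Frechet differentiable everywhere and each of its directional
  derivatives is $C^k$.
\<close>

primrec C_k :: "nat \<Rightarrow> ('a::euclidean_space \<Rightarrow> real) \<Rightarrow> bool" where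
  "C_k 0 f \<longleftrightarrow> continuous_on UNIV f"
| "C_k (Suc k) f \<longleftrightarrow>
     (\<exists>f'. (\<forall>x. (f has_derivative f' x) (at x)) \<and> (\<forall>v. C_k k (\<lambda>x. f' x v)))"

definition Cc_infty :: "('a::euclidean_space \<Rightarrow> real) set" where
  "Cc_infty = {f. (\<forall>k. C_k k f) \<and> compact (closure {x. f x \<noteq> 0})}"

definition Ds2_norm :: "real \<Rightarrow> ('a::euclidean_space \<Rightarrow> real) \<Rightarrow> real" where
  "Ds2_norm s u =
     sqrt (1 / 2 * C_const DIM('a) s *
       (LINT p|(lebesgue :: ('a \<times> 'a) measure).
          \<bar>u (fst p) - u (snd p)\<bar>\<^sup>2 / norm (fst p - snd p) powr (real DIM('a) + 2 * s)))"

text \<open>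
  The completion of \<open>Cc_infty\<close> under \<open>Ds2_norm\<close>, realised as a space of functions:
  an element of the completion is identified with the almost everywhere limit of a Cauchy sequence
  of test functions representing it.  For \<open>2 s < N\<close> the Sobolev inequality shows that every Cauchy
  sequence has an almost everywhere convergent subsequence and that the limit determines the
  element of the completion (up to null sets on the function side); by Fatou's lemma the norm of
  the completion is again given by the double integral in \<open>Ds2_norm\<close>, which is then finite.
\<close>

definition Ds2 :: "real \<Rightarrow> ('a::euclidean_space \<Rightarrow> real) set" where
  "Ds2 s = {u \<in> borel_measurable lebesgue.
     \<exists>\<phi> :: nat \<Rightarrow> 'a \<Rightarrow> real.
       (\<forall>n. \<phi> n \<in> Cc_infty) \<and>
       (\<forall>e>0. \<exists>M. \<forall>m\<ge>M. \<forall>n\<ge>M. Ds2_norm s (\<lambda>x. \<phi> m x - \<phi> n x) < e) \<and>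
       (AE x in lebesgue. (\<lambda>n. \<phi> n x) \<longlonglongrightarrow> u x)}"

definition Lp_fun :: "real \<Rightarrow> ('a::euclidean_space \<Rightarrow> real) set" where
  "Lp_fun p = {f \<in> borel_measurable lebesgue. integrable lebesgue (\<lambda>x. \<bar>f x\<bar> powr p)}"

definition Linf_fun :: "('a::euclidean_space \<Rightarrow> real) set" where
  "Linf_fun = {f \<in> borel_measurable lebesgue. \<exists>C. AE x in lebesgue. \<bar>f x\<bar> \<le> C}"

text \<open>
  The poles are indexed by \<open>{..<k}\<close>; the empty sum \<open>k = 0\<close> is allowed.  Each singular
  term takes the irrelevant value \<open>0\<close> at its own pole, as division by zero yields zero.
\<close>

definition Theta_params ::
  "real \<Rightarrow> nat \<Rightarrow> (nat \<Rightarrow> real) \<Rightarrow> (nat \<Rightarrow> 'a::euclidean_space) \<Rightarrow> (nat \<Rightarrow> real) \<Rightarrow>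
   real \<Rightarrow> real \<Rightarrow> ('a \<Rightarrow> real) \<Rightarrow> bool" where
  "Theta_params s k lam a r lam_inf R W \<longleftrightarrow>
     (\<forall>i<k. 0 < r i) \<and> 0 < R \<and>
     (\<forall>i<k. \<forall>j<k. i \<noteq> j \<longrightarrow> a i \<noteq> a j) \<and>
     (\<forall>i<k. lam i < gamma_H DIM('a) s) \<and> lam_inf < gamma_H DIM('a) s \<and>
     W \<in> Lp_fun (real DIM('a) / (2 * s)) \<inter> Linf_fun"

definition Theta_potential ::
  "real \<Rightarrow> nat \<Rightarrow> (nat \<Rightarrow> real) \<Rightarrow> (nat \<Rightarrow> 'a::euclidean_space) \<Rightarrow> (nat \<Rightarrow> real) \<Rightarrow>
   real \<Rightarrow> real \<Rightarrow> ('a \<Rightarrow> real) \<Rightarrow> 'a \<Rightarrow> real" where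
  "Theta_potential s k lam a r lam_inf R W x =
     (\<Sum>i<k. lam i * indicator (ball (a i) (r i)) x / norm (x - a i) powr (2 * s))
     + lam_inf * indicator (- ball 0 R) x / norm x powr (2 * s)
     + W x"

text \<open>
  For a potential \<open>V\<close> whose form is bounded on \<open>Ds2 s\<close>, which by the Hardy and Sobolev
  inequalities covers translates and sums of \<open>Theta_potential\<close>s, the integral of \<open>V u\<^sup>2\<close> exists
  and the infimum below is a real number.  It is taken in the extended reals, so that a family of
  quotients unbounded from below would have infimum \<open>-\<infinity>\<close>.
\<close>

definition mu :: "real \<Rightarrow> ('a::euclidean_space \<Rightarrow> real) \<Rightarrow> ereal" where
  "mu s V =
     (INF u \<in> {u \<in> Ds2 s. \<not> (AE x in lebesgue. u x = 0)}.
        ereal (((Ds2_norm s u)\<^sup>2 - (LINT x|lebesgue. V x * (u x)\<^sup>2)) / (Ds2_norm s u)\<^sup>2))"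

end

theory Submission
  imports Defs
begin

text \<open>
  Positivity of \<open>mu\<close> is coercivity of the quadratic form, and by density it can be tested on
  \<open>Cc_infty\<close>.  Write each potential as its Hardy part at infinity plus a remainder whose form is
  small outside a large ball; the smallness for the \<open>L\<^sup>p\<close> part comes from the fractional Sobolev
  inequality.  For large \<open>y\<close>, split a test function with two smooth quadratic partitions of
  unity, one centred at \<open>0\<close> and one at \<open>y\<close>, which vary logarithmically slowly: the
  localisation error of the nonlocal energy is then a small multiple of the Hardy term.  The piece
  near \<open>0\<close> sees \<open>V1\<close> up to a small form, the piece near \<open>y\<close> sees the translate of \<open>V2\<close>, and
  the remaining piece sees only the two Hardy parts, which are controlled by the sharp fractional
  Hardy inequality because the positive parts of \<open>lam_inf1\<close> and \<open>lam_inf2\<close> add up to less than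
  \<open>gamma_H\<close>.

  The Hardy inequality with the constant \<open>gamma_H\<close> is proved without Fourier transform: the kernel
  \<open>norm z powr - (N + 2 s)\<close> and the ground state \<open>norm x powr - (N - 2 s) / 2\<close> are both
  superpositions of heat kernels, and the semigroup law reduces the computation to a Beta integral.
\<close>

section \<open>Gaussian integrals and the heat kernel\<close>

text \<open>The space is homogeneous: its norm gives no \<open>L\<^sup>2\<close> control, so every
  error must be measured against the energy itself. The Hardy weight is scale invariant, so unlike
  the rest of the potential it does not become small far out. A cut-off whose transition takes place
  at a single scale would cost a fixed multiple of the Hardy term; spreading the transition over all
  scales, with logarithmic speed \<open>e\<close>, costs only \<open>e\<^sup>2\<close>.

  On the far piece both Hardy weights act at once, and \<open>lam_inf1 + lam_inf2\<close> may be as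
  close to \<open>gamma_H\<close> as one likes; hence the inequality is proved with its sharp
  constant. The weights are centred at different points, so a negative coefficient cannot be
  credited against a positive one, only dropped; this is why positive parts appear.

  The parameters are chosen in a fixed order: first the share of the coercivity margin granted to
  each error, then the speed \<open>e\<close> of the cut-offs, and only then the distance of
  \<open>y\<close>, which depends on \<open>e\<close>.\<close>

lemma nn_integral_lborel_affine:
  fixes f :: "'a::euclidean_space \<Rightarrow> ennreal"
  assumes [measurable]: "f \<in> borel_measurable borel" and c: "c \<noteq> 0"
  shows "(\<integral>\<^sup>+x. f x \<partial>lborel) = ennreal (\<bar>c\<bar> ^ DIM('a)) * (\<integral>\<^sup>+x. f (t + c *\<^sub>R x) \<partial>lborel)"
  by (subst lborel_affine[OF c, of t])
     (simp add: nn_integral_density nn_integral_distr nn_integral_cmult)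

lemma nn_integral_lborel_shift:
  fixes f :: "'a::euclidean_space \<Rightarrow> ennreal"
  assumes "f \<in> borel_measurable borel"
  shows "(\<integral>\<^sup>+x. f (t + x) \<partial>lborel) = (\<integral>\<^sup>+x. f x \<partial>lborel)"
  using nn_integral_lborel_affine[OF assms, of 1 t] by simp

lemma nn_integral_lborel_reflect:
  fixes f :: "'a::euclidean_space \<Rightarrow> ennreal"
  assumes "f \<in> borel_measurable borel"
  shows "(\<integral>\<^sup>+x. f (t - x) \<partial>lborel) = (\<integral>\<^sup>+x. f x \<partial>lborel)"
  using nn_integral_lborel_affine[OF assms, of "-1" t] by simp

text \<open>Singular weights take a default value at the origin, where pointwise estimates can fail;
  the origin is a null set.\<close>

lemma nn_integral_mono_nonzero:
  fixes f g :: "'a::euclidean_space \<Rightarrow> ennreal"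
  assumes "\<And>x. x \<noteq> 0 \<Longrightarrow> f x \<le> g x"
  shows "(\<integral>\<^sup>+x. f x \<partial>lborel) \<le> (\<integral>\<^sup>+x. g x \<partial>lborel)"
  by (rule nn_integral_mono_AE, rule AE_mp[OF AE_lborel_singleton[of 0]]) (use assms in auto)

lemma nn_integral_cong_nonzero:
  fixes f g :: "'a::euclidean_space \<Rightarrow> ennreal"
  assumes "\<And>x. x \<noteq> 0 \<Longrightarrow> f x = g x"
  shows "(\<integral>\<^sup>+x. f x \<partial>lborel) = (\<integral>\<^sup>+x. g x \<partial>lborel)"
  using assms by (intro antisym nn_integral_mono_nonzero) auto

lemma has_integral_Ici_imp_Ioi:
  fixes f :: "real \<Rightarrow> real"
  assumes "(f has_integral I) {a..}"
  shows "(f has_integral I) {a<..}"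
proof (subst has_integral_spike_set_eq)
  show "negligible {x \<in> {a<..} - {a..}. f x \<noteq> 0}" "negligible {x \<in> {a..} - {a<..}. f x \<noteq> 0}"
    by (rule negligible_subset[of "{a}"], auto)+
qed fact

lemma has_integral_Gamma_Ioi:
  fixes m :: real
  assumes "0 < m"
  shows "((\<lambda>t. t powr (m - 1) * exp (- t)) has_integral Gamma m) {0<..}"
  using has_integral_Ici_imp_Ioi[OF Gamma_integral_real[OF assms]]
  by (simp add: exp_minus divide_inverse)

lemma nn_integral_Gamma:
  fixes m :: real
  assumes "0 < m"
  shows "(\<integral>\<^sup>+t. ennreal (t powr (m - 1) * exp (- t)) * indicator {0<..} t \<partial>lborel) = ennreal (Gamma m)"
  by (rule nn_integral_has_integral_lebesgue'[OF _ has_integral_Gamma_Ioi[OF assms]]) simp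

text \<open>Layer-cake: \<open>exp (- a)\<close> is the integral of \<open>exp (- v)\<close> over
  \<open>v \<ge> a\<close>, so after exchanging the integrals only volumes of balls of radius
  \<open>sqrt v\<close> occur. The remaining Gamma integral cancels the Gamma value in the
  denominator of \<open>unit_ball_vol\<close>.\<close>

lemma nn_integral_gauss_unit:
  "(\<integral>\<^sup>+(y::'a::euclidean_space). ennreal (exp (- (norm y)\<^sup>2)) \<partial>lborel) = ennreal (pi powr (real DIM('a) / 2))"
proof -
  let ?N = "real DIM('a)"
  have layer: "ennreal (exp (- a)) = (\<integral>\<^sup>+v. ennreal (exp (- v)) * indicator {a..} v \<partial>lborel)" for a :: real
  proof -
    have "((\<lambda>v. exp (- v)) has_integral exp (- a)) {a..}"
      using has_integral_exp_minus_to_infinity[of 1 a] by simp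
    then show ?thesis by (subst nn_integral_has_integral_lebesgue') auto
  qed
  have "(\<integral>\<^sup>+(y::'a). ennreal (exp (- (norm y)\<^sup>2)) \<partial>lborel)
      = (\<integral>\<^sup>+(y::'a). \<integral>\<^sup>+v. ennreal (exp (- v)) * indicator {(norm y)\<^sup>2..} v \<partial>lborel \<partial>lborel)"
    by (rule nn_integral_cong) (rule layer)
  also have "\<dots> = (\<integral>\<^sup>+v. \<integral>\<^sup>+(y::'a). ennreal (exp (- v)) * indicator {(norm y)\<^sup>2..} v \<partial>lborel \<partial>lborel)"
    by (rule lborel_pair.Fubini') (unfold indicator_def of_bool_def atLeast_iff, measurable)
  also have "\<dots> = (\<integral>\<^sup>+v. ennreal (unit_ball_vol ?N * (v powr ((?N / 2 + 1) - 1) * exp (- v))) * indicator {0<..} v \<partial>lborel)"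
  proof (rule nn_integral_cong_nonzero)
    fix v :: real assume "v \<noteq> 0"
    show "(\<integral>\<^sup>+(y::'a). ennreal (exp (- v)) * indicator {(norm y)\<^sup>2..} v \<partial>lborel)
      = ennreal (unit_ball_vol ?N * (v powr ((?N / 2 + 1) - 1) * exp (- v))) * indicator {0<..} v"
    proof (cases "v > 0")
      case True
      have "(\<integral>\<^sup>+(y::'a). ennreal (exp (- v)) * indicator {(norm y)\<^sup>2..} v \<partial>lborel)
        = (\<integral>\<^sup>+(y::'a). ennreal (exp (- v)) * indicator (cball 0 (sqrt v)) y \<partial>lborel)"
      proof (intro nn_integral_cong)
        fix y :: 'a
        have "norm y \<le> sqrt v \<longleftrightarrow> (norm y)\<^sup>2 \<le> v"
          using True by (metis abs_norm_cancel real_sqrt_abs real_sqrt_le_iff)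
        then show "ennreal (exp (- v)) * indicator {(norm y)\<^sup>2..} v = ennreal (exp (- v)) * indicator (cball 0 (sqrt v)) y"
          by (simp add: indicator_def)
      qed
      also have "\<dots> = ennreal (exp (- v)) * ennreal (unit_ball_vol ?N * sqrt v ^ DIM('a))"
        using True by (simp add: nn_integral_cmult_indicator emeasure_cball)
      also have "sqrt v ^ DIM('a) = v powr (?N / 2)"
        using True by (simp add: powr_half_sqrt[symmetric] powr_power)
      finally show ?thesis using True by (simp add: ennreal_mult[symmetric] mult_ac)
    next
      case False
      with \<open>v \<noteq> 0\<close> have "v < 0" by simp
      then have "\<not> (norm (y::'a))\<^sup>2 \<le> v" for y
        by (metis not_le order_less_le_trans zero_le_power2)
      then show ?thesis using \<open>v < 0\<close> by (simp add: indicator_def)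
    qed
  qed
  also have "\<dots> = (\<integral>\<^sup>+v. ennreal (unit_ball_vol ?N) * (ennreal (v powr ((?N / 2 + 1) - 1) * exp (- v)) * indicator {0<..} v) \<partial>lborel)"
    by (intro nn_integral_cong) (simp add: ennreal_mult mult_ac)
  also have "\<dots> = ennreal (unit_ball_vol ?N) * ennreal (Gamma (?N / 2 + 1))"
    by (subst nn_integral_cmult, measurable, subst nn_integral_Gamma) (simp_all add: add_nonneg_pos)
  also have "\<dots> = ennreal (pi powr (?N / 2))"
  proof -
    have "Gamma (?N / 2 + 1) \<noteq> 0" by (rule less_imp_neq[THEN not_sym], rule Gamma_real_pos) auto
    then show ?thesis by (simp add: ennreal_mult[symmetric] unit_ball_vol_def)
  qed
  finally show ?thesis .
qed

lemma nn_integral_gauss: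
  fixes a :: "'a::euclidean_space"
  assumes "0 < c"
  shows "(\<integral>\<^sup>+(y::'a). ennreal (exp (- c * (norm (y - a))\<^sup>2)) \<partial>lborel) = ennreal ((pi / c) powr (real DIM('a) / 2))"
proof -
  let ?d = "1 / sqrt c"
  have d: "?d \<noteq> 0" using assms by simp
  have "(\<integral>\<^sup>+(y::'a). ennreal (exp (- c * (norm (y - a))\<^sup>2)) \<partial>lborel)
     = ennreal (\<bar>?d\<bar> ^ DIM('a)) * (\<integral>\<^sup>+(y::'a). ennreal (exp (- c * (norm ((a + ?d *\<^sub>R y) - a))\<^sup>2)) \<partial>lborel)"
    by (rule nn_integral_lborel_affine[OF _ d]) measurable
  also have "(\<lambda>y::'a. ennreal (exp (- c * (norm ((a + ?d *\<^sub>R y) - a))\<^sup>2))) = (\<lambda>y. ennreal (exp (- (norm y)\<^sup>2)))"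
    using assms by (simp add: power_divide)
  also have "\<bar>?d\<bar> ^ DIM('a) = (1 / c) powr (real DIM('a) / 2)"
  proof -
    have "\<bar>?d\<bar> = (1 / c) powr (1 / 2)" using assms by (simp add: powr_half_sqrt real_sqrt_divide)
    then show ?thesis using assms by (simp add: powr_power del: powr_half_sqrt)
  qed
  finally show ?thesis
    using assms by (simp add: nn_integral_gauss_unit ennreal_mult[symmetric] powr_mult[symmetric] )
qed

section \<open>The heat kernel: mass, semigroup law, Mellin transform in time\<close>

definition heat_kernel :: "real \<Rightarrow> 'a::euclidean_space \<Rightarrow> real" where
  "heat_kernel t x = (4 * pi * t) powr (- (real DIM('a) / 2)) * exp (- (norm x)\<^sup>2 / (4 * t))"

lemma heat_kernel_nonneg [simp]: "0 \<le> heat_kernel t x"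
  by (simp add: heat_kernel_def)

lemma heat_kernel_minus_commute: "heat_kernel t (x - y) = heat_kernel t (y - x)"
  by (simp add: heat_kernel_def norm_minus_commute)

lemma heat_kernel_measurable [measurable]:
  "(\<lambda>p. heat_kernel (f p) (g p :: 'a::euclidean_space)) \<in> borel_measurable M"
  if [measurable]: "f \<in> borel_measurable M" "g \<in> borel_measurable M"
  unfolding heat_kernel_def by measurable

lemma nn_integral_heat_kernel:
  fixes a :: "'a::euclidean_space"
  assumes "0 < t"
  shows "(\<integral>\<^sup>+(y::'a). ennreal (heat_kernel t (a - y)) \<partial>lborel) = 1"
proof -
  have "(\<integral>\<^sup>+(y::'a). ennreal (heat_kernel t (a - y)) \<partial>lborel)
    = (\<integral>\<^sup>+(y::'a). ennreal ((4 * pi * t) powr (- (real DIM('a) / 2))) * ennreal (exp (- (1 / (4 * t)) * (norm (y - a))\<^sup>2)) \<partial>lborel)"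
    by (intro nn_integral_cong) (simp add: heat_kernel_def ennreal_mult norm_minus_commute)
  also have "\<dots> = ennreal ((4 * pi * t) powr (- (real DIM('a) / 2))) * ennreal ((pi / (1 / (4 * t))) powr (real DIM('a) / 2))"
    using assms by (subst nn_integral_cmult) (measurable, subst nn_integral_gauss, auto)
  also have "\<dots> = 1"
    using assms by (simp add: ennreal_mult[symmetric] powr_minus mult_ac)
  finally show ?thesis .
qed

lemma heat_kernel_convolution:
  fixes x :: "'a::euclidean_space"
  assumes t: "0 < t" and u: "0 < u"
  shows "(\<integral>\<^sup>+(y::'a). ennreal (heat_kernel t (x - y) * heat_kernel u y) \<partial>lborel) = ennreal (heat_kernel (t + u) x)"
proof -
  let ?n = "real DIM('a) / 2"
  \<comment> \<open>Completing the square in \<open>y\<close>: the product of the two Gaussians is a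
    Gaussian with rate \<open>c\<close> centred at \<open>a\<close>, times the exponential of the
    heat kernel at time \<open>t + u\<close>.\<close>
  define c where "c = (t + u) / (4 * t * u)"
  define a where "a = (u / (t + u)) *\<^sub>R x"
  have c: "0 < c" using t u by (simp add: c_def)
  have sq: "(norm (x - y))\<^sup>2 / (4 * t) + (norm y)\<^sup>2 / (4 * u) = (norm x)\<^sup>2 / (4 * (t + u)) + c * (norm (y - a))\<^sup>2" for y :: 'a
  proof -
    define X Y Z where "X = x \<bullet> x" and "Y = y \<bullet> y" and "Z = x \<bullet> y"
    have 1: "(norm (x - y))\<^sup>2 = X - 2 * Z + Y"
      by (simp add: power2_norm_eq_inner inner_diff_left inner_diff_right inner_commute X_def Y_def Z_def)
    have "(norm (y - q *\<^sub>R x))\<^sup>2 = Y - 2 * q * Z + q\<^sup>2 * X" for q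
      unfolding power2_norm_eq_inner
      by (simp add: inner_diff_left inner_diff_right inner_commute X_def Y_def Z_def power2_eq_square)
    then have 2: "(norm (y - a))\<^sup>2 = Y - 2 * (u / (t + u)) * Z + (u / (t + u))\<^sup>2 * X"
      by (simp only: a_def)
    have 3: "(norm y)\<^sup>2 = Y" "(norm x)\<^sup>2 = X" by (simp_all add: power2_norm_eq_inner X_def Y_def)
    have "t + u \<noteq> 0" using t u by simp
    have "(X - 2 * Z + Y) / (4 * t) + Y / (4 * u) = X / (4 * (t + u)) + c * (Y - 2 * (u / (t + u)) * Z + (u / (t + u))\<^sup>2 * X)"
    proof -
      define p where "p = u / (t + u)"
      have cY: "1 / (4 * t) + 1 / (4 * u) = c" using t u by (simp add: c_def field_simps)
      have cZ: "c * p = 1 / (4 * t)" using t u \<open>t + u \<noteq> 0\<close> by (simp add: c_def p_def)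
      have cX: "1 / (4 * (t + u)) + 1 / (4 * t) * p = 1 / (4 * t)"
      proof -
        have "1 / (4 * t) = (t + u) / (4 * t * (t + u))" using \<open>t + u \<noteq> 0\<close> by simp
        also have "\<dots> = t / (4 * t * (t + u)) + u / (4 * t * (t + u))" by (rule add_divide_distrib)
        finally have 1: "1 / (4 * t) = t / (4 * t * (t + u)) + u / (4 * t * (t + u))" .
        have 2: "1 / (4 * t) * p = u / (4 * t * (t + u))" by (simp add: p_def)
        have 3: "1 / (4 * (t + u)) = t / (4 * t * (t + u))" using t by simp
        show ?thesis using 1 2 3 by linarith
      qed
      have "(X - 2 * Z + Y) / (4 * t) + Y / (4 * u)
          = X * (1 / (4 * t)) - 2 * Z * (1 / (4 * t)) + Y * (1 / (4 * t) + 1 / (4 * u))"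
        by (simp add: add_divide_distrib diff_divide_distrib distrib_left)
      also have "\<dots> = X * (1 / (4 * (t + u)) + c * p * p) - 2 * Z * (c * p) + Y * c"
        by (simp only: cX cY cZ)
      also have "\<dots> = X / (4 * (t + u)) + c * (Y - 2 * p * Z + p\<^sup>2 * X)"
        by (simp add: algebra_simps power2_eq_square)
      finally show ?thesis by (simp only: p_def)
    qed
    then show ?thesis by (simp only: 1 2 3)
  qed
  have "(\<integral>\<^sup>+(y::'a). ennreal (heat_kernel t (x - y) * heat_kernel u y) \<partial>lborel)
     = (\<integral>\<^sup>+(y::'a). ennreal ((4 * pi * t) powr (- ?n) * (4 * pi * u) powr (- ?n) * exp (- (norm x)\<^sup>2 / (4 * (t + u))))
           * ennreal (exp (- c * (norm (y - a))\<^sup>2)) \<partial>lborel)"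
  proof (intro nn_integral_cong)
    fix y :: 'a
    have "exp (- (norm (x - y))\<^sup>2 / (4 * t)) * exp (- (norm y)\<^sup>2 / (4 * u))
       = exp (- (norm x)\<^sup>2 / (4 * (t + u))) * exp (- c * (norm (y - a))\<^sup>2)"
      using sq[of y] by (simp add: exp_add[symmetric])
    then show "ennreal (heat_kernel t (x - y) * heat_kernel u y) = ennreal ((4 * pi * t) powr (- ?n) * (4 * pi * u) powr (- ?n) * exp (- (norm x)\<^sup>2 / (4 * (t + u))))
           * ennreal (exp (- c * (norm (y - a))\<^sup>2))"
      by (simp add: heat_kernel_def ennreal_mult[symmetric] mult_ac)
  qed
  also have "\<dots> = ennreal ((4 * pi * t) powr (- ?n) * (4 * pi * u) powr (- ?n) * exp (- (norm x)\<^sup>2 / (4 * (t + u)))) * ennreal ((pi / c) powr ?n)"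
    using c by (subst nn_integral_cmult) (measurable, subst nn_integral_gauss, auto)
  also have "\<dots> = ennreal (heat_kernel (t + u) x)"
  proof -
    have "(4 * pi * t) powr (- ?n) * (4 * pi * u) powr (- ?n) * (pi / c) powr ?n
      = ((1 / (4 * pi * t)) * (1 / (4 * pi * u)) * (pi / c)) powr ?n"
      using t u c by (simp only: powr_mult powr_minus_divide powr_divide powr_one_eq_one)
    also have "(1 / (4 * pi * t)) * (1 / (4 * pi * u)) * (pi / c) = 1 / (4 * pi * (t + u))"
      using t u by (simp add: c_def divide_simps)
    also have "\<dots> powr ?n = (4 * pi * (t + u)) powr (- ?n)"
      using t u by (simp only: powr_minus_divide powr_divide powr_one_eq_one)
    finally show ?thesis
      by (simp add: heat_kernel_def ennreal_mult[symmetric] mult_ac)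
  qed
  finally show ?thesis .
qed

text \<open>The substitution of \<open>A / t\<close> for \<open>t\<close> turns the time integral
  into a Gamma integral. One formula yields all powers of the norm that occur:
  \<open>b = - s\<close> the jump kernel, \<open>b\<close> between \<open>s\<close> and
  \<open>N / 2\<close> the ground state, and \<open>b - s\<close> the ground state multiplied by the
  Hardy weight.\<close>

lemma nn_integral_heat_kernel_powr:
  fixes z :: "'a::euclidean_space"
  assumes z: "z \<noteq> 0" and b: "b < real DIM('a) / 2"
  shows "(\<integral>\<^sup>+t. ennreal (t powr (b - 1) * heat_kernel t z) * indicator {0<..} t \<partial>lborel)
     = ennreal ((4 * pi) powr (- (real DIM('a) / 2)) * Gamma (real DIM('a) / 2 - b) * ((norm z)\<^sup>2 / 4) powr (b - real DIM('a) / 2))"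
proof -
  define n where "n = real DIM('a) / 2"
  define m where "m = n - b"
  define A where "A = (norm z)\<^sup>2 / 4"
  have m: "m > 0" using b by (simp add: m_def n_def)
  have A: "A > 0" using z by (simp add: A_def)
  note Gi = has_integral_Gamma_Ioi[OF m]
  have img: "(\<lambda>t. A / t) ` {0<..} = {0<..}"
  proof -
    have "x \<in> (\<lambda>t. A / t) ` {0<..}" if "x > 0" for x
      using that A by (intro image_eqI[of _ _ "A / x"]) auto
    then show ?thesis using A by auto
  qed
  have ai: "(\<lambda>t. t powr (m - 1) * exp (- t)) absolutely_integrable_on (\<lambda>t. A / t) ` {0<..} \<and>
        integral ((\<lambda>t. A / t) ` {0<..}) (\<lambda>t. t powr (m - 1) * exp (- t)) = Gamma m"
    unfolding img using Gi
    by (auto intro!: nonnegative_absolutely_integrable_1 simp: integral_unique has_integral_integrable)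
  have "(\<lambda>t. \<bar>- A / t\<^sup>2\<bar> * ((A / t) powr (m - 1) * exp (- (A / t)))) absolutely_integrable_on {0<..} \<and>
        integral {0<..} (\<lambda>t. \<bar>- A / t\<^sup>2\<bar> * ((A / t) powr (m - 1) * exp (- (A / t)))) = Gamma m"
  proof (rule has_absolute_integral_change_of_variables_1'[THEN iffD2, OF _ _ _ ai])
    show "((\<lambda>t. A / t) has_field_derivative - A / x\<^sup>2) (at x within {0<..})" if "x \<in> {0<..}" for x
      using that by (auto intro!: derivative_eq_intros simp: power2_eq_square)
    show "inj_on (\<lambda>t. A / t) {0<..}" using A by (auto simp: inj_on_def field_simps)
  qed auto
  note q = this
  have "((\<lambda>t. \<bar>- A / t\<^sup>2\<bar> * ((A / t) powr (m - 1) * exp (- (A / t)))) has_integral Gamma m) {0<..}"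
    unfolding has_integral_iff
    by (rule conjI[OF set_lebesgue_integral_eq_integral(1)[OF q[THEN conjunct1]] q[THEN conjunct2]])
  then have "(\<integral>\<^sup>+t. ennreal (\<bar>- A / t\<^sup>2\<bar> * ((A / t) powr (m - 1) * exp (- (A / t)))) * indicator {0<..} t \<partial>lborel) = ennreal (Gamma m)"
    by (intro nn_integral_has_integral_lebesgue') auto
  moreover have "ennreal (t powr (b - 1) * heat_kernel t z) * indicator {0<..} t =
      ennreal ((4 * pi) powr (- n) * A powr (- m)) * (ennreal (\<bar>- A / t\<^sup>2\<bar> * ((A / t) powr (m - 1) * exp (- (A / t)))) * indicator {0<..} t)" for t
  proof (cases "t > 0")
    case True
    have "t powr (b - 1) * (4 * pi * t) powr (- n) = (4 * pi) powr (- n) * A powr (- m) * (\<bar>- A / t\<^sup>2\<bar> * (A / t) powr (m - 1))"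
    proof -
      have "\<bar>- A / t\<^sup>2\<bar> = A * t powr (- 2)" using True A by (simp add: powr_minus_divide)
      moreover have "(A / t) powr (m - 1) = A powr (m - 1) * t powr (1 - m)"
        using True A by (simp add: powr_divide powr_diff)
      moreover have "(4 * pi * t) powr (- n) = (4 * pi) powr (- n) * t powr (- n)"
        using True by (simp add: powr_mult)
      moreover have "A powr (- m) * (A * A powr (m - 1)) = 1"
        using A by (simp add: powr_diff powr_minus)
      moreover have "t powr (b - 1) * t powr (- n) = t powr (- 2) * t powr (1 - m)"
        by (simp add: powr_add[symmetric] m_def algebra_simps)
      ultimately show ?thesis by (simp add: mult_ac)
    qed
    moreover have "(norm z)\<^sup>2 / (4 * t) = A / t" by (simp add: A_def)
    ultimately show ?thesis using True
      by (simp add: heat_kernel_def ennreal_mult[symmetric] n_def[symmetric] mult_ac)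
  qed simp
  ultimately have "(\<integral>\<^sup>+t. ennreal (t powr (b - 1) * heat_kernel t z) * indicator {0<..} t \<partial>lborel)
      = ennreal ((4 * pi) powr (- n) * A powr (- m)) * ennreal (Gamma m)"
    by (simp add: nn_integral_cmult)
  also have "\<dots> = ennreal ((4 * pi) powr (- n) * Gamma m * A powr (b - n))"
    using m by (simp add: ennreal_mult[symmetric] m_def mult_ac Gamma_real_pos less_imp_le)
  finally show ?thesis by (simp add: n_def m_def A_def)
qed

section \<open>Beta integrals, complete and truncated\<close>

lemma nn_integral_Beta_interval:
  fixes a b c :: real
  assumes a: "0 < a" and b: "0 < b" and c: "0 < c"
  shows "(\<integral>\<^sup>+t. ennreal (t powr (a - 1) * (c - t) powr (b - 1)) * indicator {0<..<c} t \<partial>lborel) = ennreal (c powr (a + b - 1) * Beta a b)"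
proof -
  have "((\<lambda>t. t powr (a - 1) * (1 - t) powr (b - 1)) has_integral Beta a b) {0<..<1}"
    using has_integral_Beta_real[OF a b] by (simp add: has_integral_Icc_iff_Ioo)
  then have B: "(\<integral>\<^sup>+t. ennreal (t powr (a - 1) * (1 - t) powr (b - 1)) * indicator {0<..<1} t \<partial>lborel) = ennreal (Beta a b)"
    by (intro nn_integral_has_integral_lebesgue') auto
  have "(\<integral>\<^sup>+t. ennreal (t powr (a - 1) * (c - t) powr (b - 1)) * indicator {0<..<c} t \<partial>lborel)
     = ennreal c * (\<integral>\<^sup>+t. ennreal ((c * t) powr (a - 1) * (c - c * t) powr (b - 1)) * indicator {0<..<c} (c * t) \<partial>lborel)"
    using c by (subst nn_integral_real_affine[where c=c and t=0]) auto
  also have "(\<integral>\<^sup>+t. ennreal ((c * t) powr (a - 1) * (c - c * t) powr (b - 1)) * indicator {0<..<c} (c * t) \<partial>lborel)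
     = (\<integral>\<^sup>+t. ennreal (c powr (a + b - 2)) * (ennreal (t powr (a - 1) * (1 - t) powr (b - 1)) * indicator {0<..<1} t) \<partial>lborel)"
  proof (intro nn_integral_cong)
    fix t :: real
    show "ennreal ((c * t) powr (a - 1) * (c - c * t) powr (b - 1)) * indicator {0<..<c} (c * t)
      = ennreal (c powr (a + b - 2)) * (ennreal (t powr (a - 1) * (1 - t) powr (b - 1)) * indicator {0<..<1} t)"
    proof (cases "0 < t \<and> t < 1")
      case True
      then have "(c * t) powr (a - 1) * (c * (1 - t)) powr (b - 1) = (c powr (a - 1) * c powr (b - 1)) * (t powr (a - 1) * (1 - t) powr (b - 1))"
        using c by (simp add: powr_mult)
      also have "c powr (a - 1) * c powr (b - 1) = c powr (a + b - 2)" by (simp add: powr_add[symmetric])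
      finally show ?thesis using True c by (simp add: ennreal_mult[symmetric] right_diff_distrib)
    next
      case False
      then have "\<not> (0 < c * t \<and> c * t < c)" using c by (auto simp: zero_less_mult_iff)
      with False show ?thesis by (auto simp: indicator_def)
    qed
  qed
  also have "\<dots> = ennreal (c powr (a + b - 2)) * ennreal (Beta a b)"
    by (subst nn_integral_cmult) (auto simp: B)
  also have "ennreal c * \<dots> = ennreal (c powr (a + b - 1) * Beta a b)"
  proof -
    have "c powr (a + b - 1) = c * c powr (a + b - 2)" using c by (simp add: powr_mult_base)
    then show ?thesis using c by (simp add: ennreal_mult'[symmetric] ennreal_mult''[symmetric] mult_ac)
  qed
  finally show ?thesis .
qed

text \<open>
  The left-hand integrand is \<open>s\<close> times the derivative of
  \<open>- t powr (- s) * (c - t) powr b / s\<close>.  This replaces the analytic continuation of the Beta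
  function to the argument \<open>- s\<close>.
\<close>

lemma nn_integral_truncated_Beta_le:
  fixes s b c h :: real
  assumes s: "0 < s" and b: "s < b" and h: "0 < h"
  shows "(\<integral>\<^sup>+t. ennreal (c * (t powr (- 1 - s) * (c - t) powr (b - 1))
            + (b / s - 1) * (t powr (- s) * (c - t) powr (b - 1))) * indicator {h<..<c} t \<partial>lborel)
       \<le> ennreal (h powr (- s) * c powr b / s)"
proof (cases "h < c")
  case True
  let ?f = "\<lambda>t. c * (t powr (- 1 - s) * (c - t) powr (b - 1)) + (b / s - 1) * (t powr (- s) * (c - t) powr (b - 1))"
  let ?F = "\<lambda>t. - (t powr (- s) * (c - t) powr b) / s"
  have "(?f has_integral (?F c - ?F h)) {h..c}"
  proof (rule fundamental_theorem_of_calculus_interior)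
    show "continuous_on {h..c} ?F" using h s b by (intro continuous_intros continuous_on_powr') auto
    show "(?F has_vector_derivative ?f t) (at t)" if t: "t \<in> {h<..<c}" for t
    proof -
      have t0: "0 < t" "0 < c - t" using t h by auto
      have d1: "((\<lambda>t. t powr (- s)) has_real_derivative (- s) * t powr (- s - 1)) (at t)"
        using t0 by (auto intro!: derivative_eq_intros)
      have d2: "((\<lambda>t. (c - t) powr b) has_real_derivative b * (c - t) powr (b - 1) * (- 1)) (at t)"
        using t0 by (auto intro!: derivative_eq_intros)
      have "(?F has_real_derivative - ((- s * t powr (- s - 1)) * (c - t) powr b + t powr (- s) * (b * (c - t) powr (b - 1) * (- 1))) / s) (at t)"
        using DERIV_cdivide[OF DERIV_minus[OF DERIV_mult[OF d1 d2]]] by (simp only: mult.commute add.commute)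
      moreover have "- ((- s * t powr (- s - 1)) * (c - t) powr b + t powr (- s) * (b * (c - t) powr (b - 1) * (- 1))) / s = ?f t"
      proof -
        have 1: "(c - t) powr b = (c - t) * (c - t) powr (b - 1)" using t0 by (simp add: powr_mult_base)
        have 2: "t powr (- s) = t * t powr (- 1 - s)" using t0 powr_mult_base[of t "- 1 - s"] by simp
        have 3: "- s - 1 = - 1 - s" by simp
        have "- ((- s * B) * ((c - t) * A) + t * B * (b * A * (- 1))) / s = c * (B * A) + (b / s - 1) * (t * B * A)" for A B
          using s by (simp add: divide_simps) (simp add: algebra_simps)
        then show ?thesis unfolding 1 2 3 .
      qed
      ultimately show ?thesis by (simp add: has_real_derivative_iff_has_vector_derivative)
    qed
  qed (use True in auto)
  then have "(?f has_integral (?F c - ?F h)) {h<..<c}" by (simp add: has_integral_Icc_iff_Ioo)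
  moreover have "0 \<le> ?f t" if "t \<in> {h<..<c}" for t
    using that h s b by (intro add_nonneg_nonneg mult_nonneg_nonneg) (auto simp: field_simps)
  ultimately have "(\<integral>\<^sup>+t. ennreal (?f t) * indicator {h<..<c} t \<partial>lborel) = ennreal (?F c - ?F h)"
    by (intro nn_integral_has_integral_lebesgue') auto
  \<comment> \<open>The boundary term at \<open>c\<close> vanishes because \<open>b > 0\<close>. At
    \<open>h\<close> the factor \<open>(c - h) powr b\<close> is enlarged to
    \<open>c powr b\<close>; this is the only loss, and it turns the ground state into a
    supersolution of the truncated problem.\<close>
  also have "\<dots> \<le> ennreal (h powr (- s) * c powr b / s)"
    using True h s b by (intro ennreal_leI) (auto intro!: divide_right_mono mult_left_mono powr_mono2)
  finally show ?thesis .
qed simp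

section \<open>The sharp fractional Hardy inequality\<close>

text \<open>Extended values and an iterated integral: Tonelli applies freely, and an infinite energy
  stays visible instead of collapsing to a default value.\<close>

definition gagliardo :: "real \<Rightarrow> ('a::euclidean_space \<Rightarrow> real) \<Rightarrow> ennreal" where
  "gagliardo s u = (\<integral>\<^sup>+x. \<integral>\<^sup>+y. ennreal ((u x - u y)\<^sup>2 / norm (x - y) powr (real DIM('a) + 2 * s)) \<partial>lborel \<partial>lborel)"

section \<open>The truncated Levy kernel and the ground state\<close>

lemma nn_integral_powr_tail:
  fixes h s :: real
  assumes "0 < s" "0 < h"
  shows "(\<integral>\<^sup>+t. ennreal (t powr (- 1 - s)) * indicator {h<..} t \<partial>lborel) = ennreal (h powr (- s) / s)"
proof -
  have "((\<lambda>t. t powr (- 1 - s)) has_integral h powr (- s) / s) {h..}"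
    using has_integral_powr_to_inf[of "- 1 - s" h] assms by simp
  from has_integral_Ici_imp_Ioi[OF this] show ?thesis by (intro nn_integral_has_integral_lebesgue') auto
qed

text \<open>Integrating over all times \<open>t > 0\<close> would give a multiple of
  \<open>norm z powr - (N + 2 s)\<close>, which has infinite mass near the origin. Without the times
  below \<open>h\<close> the total mass is the finite number
  \<open>h powr (- s) / s\<close>.\<close>

definition heat_levy :: "real \<Rightarrow> real \<Rightarrow> 'a::euclidean_space \<Rightarrow> ennreal" where
  "heat_levy s h z = (\<integral>\<^sup>+t. ennreal (t powr (- 1 - s) * heat_kernel t z) * indicator {h<..} t \<partial>lborel)"

lemma heat_levy_measurable [measurable]:
  assumes [measurable]: "g \<in> borel_measurable M"
  shows "(\<lambda>p. heat_levy s h (g p :: 'a::euclidean_space)) \<in> borel_measurable M"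
  unfolding heat_levy_def by measurable

lemma heat_levy_minus_commute: "heat_levy s h (x - y) = heat_levy s h (y - x)"
  by (simp add: heat_levy_def heat_kernel_minus_commute)

lemma nn_integral_heat_levy:
  fixes x :: "'a::euclidean_space"
  assumes "0 < s" "0 < h"
  shows "(\<integral>\<^sup>+(y::'a). heat_levy s h (x - y) \<partial>lborel) = ennreal (h powr (- s) / s)"
proof -
  have "(\<integral>\<^sup>+(y::'a). heat_levy s h (x - y) \<partial>lborel)
    = (\<integral>\<^sup>+t. \<integral>\<^sup>+(y::'a). ennreal (t powr (- 1 - s) * heat_kernel t (x - y)) * indicator {h<..} t \<partial>lborel \<partial>lborel)"
    unfolding heat_levy_def by (rule lborel_pair.Fubini') measurable
  also have "\<dots> = (\<integral>\<^sup>+t. ennreal (t powr (- 1 - s)) * indicator {h<..} t \<partial>lborel)"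
  proof (intro nn_integral_cong)
    fix t :: real
    have "(\<integral>\<^sup>+(y::'a). ennreal (t powr (- 1 - s) * heat_kernel t (x - y)) * indicator {h<..} t \<partial>lborel)
        = (\<integral>\<^sup>+(y::'a). (ennreal (t powr (- 1 - s)) * indicator {h<..} t) * ennreal (heat_kernel t (x - y)) \<partial>lborel)"
      by (intro nn_integral_cong) (simp add: ennreal_mult mult_ac)
    also have "\<dots> = (ennreal (t powr (- 1 - s)) * indicator {h<..} t) * (\<integral>\<^sup>+(y::'a). ennreal (heat_kernel t (x - y)) \<partial>lborel)"
      by (rule nn_integral_cmult) measurable
    also have "\<dots> = ennreal (t powr (- 1 - s)) * indicator {h<..} t"
      using assms by (cases "h < t") (simp_all add: nn_integral_heat_kernel)
    finally show "(\<integral>\<^sup>+(y::'a). ennreal (t powr (- 1 - s) * heat_kernel t (x - y)) * indicator {h<..} t \<partial>lborel) = ennreal (t powr (- 1 - s)) * indicator {h<..} t" .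
  qed
  finally show ?thesis by (simp add: nn_integral_powr_tail assms)
qed

lemma norm_sq_quarter_powr:
  fixes z :: "'a::euclidean_space"
  assumes "z \<noteq> 0"
  shows "((norm z)\<^sup>2 / 4) powr (- c) = 4 powr c / norm z powr (2 * c)"
proof -
  have "((norm z)\<^sup>2 / 4) powr (- c) = 4 powr c / ((norm z)\<^sup>2) powr c"
    using assms by (simp add: powr_divide powr_minus_divide)
  also have "((norm z)\<^sup>2) powr c = norm z powr (2 * c)"
    using assms by (simp add: powr_powr[symmetric])
  finally show ?thesis .
qed

text \<open>Restoring the missing times only enlarges the kernel and produces the exact power, by
  the Mellin formula at exponent \<open>- s\<close>.\<close>

lemma heat_levy_le:
  fixes z :: "'a::euclidean_space"
  assumes s: "0 < s" and h: "0 \<le> h" and z: "z \<noteq> 0"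
  shows "heat_levy s h z \<le> ennreal (pi powr (- (real DIM('a) / 2)) * 4 powr s * Gamma (real DIM('a) / 2 + s)
          / norm z powr (real DIM('a) + 2 * s))"
proof -
  let ?n = "real DIM('a) / 2"
  have "heat_levy s h z \<le> (\<integral>\<^sup>+t. ennreal (t powr (- s - 1) * heat_kernel t z) * indicator {0<..} t \<partial>lborel)"
  proof -
    have e: "t powr (- 1 - s) = t powr (- s - 1)" for t by (rule arg_cong[where f="\<lambda>e. t powr e"]) simp
    show ?thesis unfolding heat_levy_def e using h by (intro nn_integral_mono) (auto simp: indicator_def)
  qed
  also have "\<dots> = ennreal ((4 * pi) powr (- ?n) * Gamma (?n - (- s)) * ((norm z)\<^sup>2 / 4) powr (- s - ?n))"
    using s by (intro nn_integral_heat_kernel_powr z) (auto intro: order_less_le_trans[of _ 0])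
  also have "(4 * pi) powr (- ?n) * Gamma (?n - (- s)) * ((norm z)\<^sup>2 / 4) powr (- s - ?n)
      = pi powr (- ?n) * 4 powr s * Gamma (?n + s) / norm z powr (real DIM('a) + 2 * s)"
  proof -
    have "((norm z)\<^sup>2 / 4) powr (- s - ?n) = 4 powr (s + ?n) / norm z powr (2 * (s + ?n))"
      using norm_sq_quarter_powr[OF z, of "s + ?n"] by (simp add: algebra_simps)
    moreover have "2 * (s + ?n) = real DIM('a) + 2 * s" by simp
    moreover have "(4 * pi) powr (- ?n) = 4 powr (- ?n) * pi powr (- ?n)" by (simp add: powr_mult)
    moreover have "4 powr (- ?n) * 4 powr (s + ?n) = 4 powr s" by (simp add: powr_add[symmetric])
    ultimately show ?thesis by (simp add: ac_simps)
  qed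
  finally show ?thesis .
qed

text \<open>
  The ground state is \<open>w y = norm y powr - (N - 2 s) / 2\<close> written as a superposition of heat
  kernels, so that the semigroup property turns convolution with the truncated Levy kernel
  into a one-dimensional integral.
\<close>

lemma heat_levy_convolution:
  fixes x :: "'a::euclidean_space"
  assumes s: "0 < s" and h: "0 < h"
  shows "(\<integral>\<^sup>+(y::'a). heat_levy s h (x - y) * (\<integral>\<^sup>+r. ennreal (r powr (b - 1) * heat_kernel r y) * indicator {0<..} r \<partial>lborel) \<partial>lborel)
     = (\<integral>\<^sup>+c. ennreal (heat_kernel c x) * (\<integral>\<^sup>+t. ennreal (t powr (- 1 - s) * (c - t) powr (b - 1)) * indicator {h<..<c} t \<partial>lborel) \<partial>lborel)"
proof -
  let ?g = "\<lambda>t r (y::'a). ennreal (t powr (- 1 - s) * r powr (b - 1)) * ennreal (heat_kernel t (x - y) * heat_kernel r y) * indicator {h<..} t * indicator {0<..} r"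
  have "(\<integral>\<^sup>+(y::'a). heat_levy s h (x - y) * (\<integral>\<^sup>+r. ennreal (r powr (b - 1) * heat_kernel r y) * indicator {0<..} r \<partial>lborel) \<partial>lborel)
     = (\<integral>\<^sup>+(y::'a). \<integral>\<^sup>+t. \<integral>\<^sup>+r. ?g t r y \<partial>lborel \<partial>lborel \<partial>lborel)"
    unfolding heat_levy_def
    by (subst nn_integral_multc[symmetric], measurable, subst nn_integral_cmult[symmetric], measurable,
        intro nn_integral_cong) (simp add: ennreal_mult mult_ac)
  also have "\<dots> = (\<integral>\<^sup>+t. \<integral>\<^sup>+(y::'a). \<integral>\<^sup>+r. ?g t r y \<partial>lborel \<partial>lborel \<partial>lborel)"
    by (rule lborel_pair.Fubini') measurable
  also have "\<dots> = (\<integral>\<^sup>+t. \<integral>\<^sup>+r. \<integral>\<^sup>+(y::'a). ?g t r y \<partial>lborel \<partial>lborel \<partial>lborel)"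
    by (intro nn_integral_cong lborel_pair.Fubini') measurable
  also have "\<dots> = (\<integral>\<^sup>+t. \<integral>\<^sup>+r. ennreal (t powr (- 1 - s) * r powr (b - 1)) * ennreal (heat_kernel (t + r) x) * indicator {h<..} t * indicator {0<..} r \<partial>lborel \<partial>lborel)"
  proof (intro nn_integral_cong)
    fix t r :: real
    show "(\<integral>\<^sup>+(y::'a). ?g t r y \<partial>lborel) = ennreal (t powr (- 1 - s) * r powr (b - 1)) * ennreal (heat_kernel (t + r) x) * indicator {h<..} t * indicator {0<..} r"
    proof (cases "h < t \<and> 0 < r")
      case True
      then show ?thesis using h heat_kernel_convolution[of t r x] by (simp add: nn_integral_cmult)
    qed auto
  qed
  \<comment> \<open>Substitute the total time \<open>c = t + r\<close>, so that
    \<open>heat_kernel c x\<close> no longer depends on \<open>t\<close>.\<close>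
  also have "\<dots> = (\<integral>\<^sup>+t. \<integral>\<^sup>+c. ennreal (t powr (- 1 - s) * (c - t) powr (b - 1)) * ennreal (heat_kernel c x) * indicator {h<..<c} t \<partial>lborel \<partial>lborel)"
  proof (rule nn_integral_cong)
    fix t :: real
    have "(\<integral>\<^sup>+r. ennreal (t powr (- 1 - s) * r powr (b - 1)) * ennreal (heat_kernel (t + r) x) * indicator {h<..} t * indicator {0<..} r \<partial>lborel)
       = (\<integral>\<^sup>+r. (\<lambda>c. ennreal (t powr (- 1 - s) * (c - t) powr (b - 1)) * ennreal (heat_kernel c x) * indicator {h<..<c} t) (t + r) \<partial>lborel)"
      by (intro nn_integral_cong) (auto simp: indicator_def)
    also have "\<dots> = (\<integral>\<^sup>+c. ennreal (t powr (- 1 - s) * (c - t) powr (b - 1)) * ennreal (heat_kernel c x) * indicator {h<..<c} t \<partial>lborel)"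
      by (rule nn_integral_lborel_shift) (unfold indicator_def of_bool_def greaterThanLessThan_iff, measurable)
    finally show "(\<integral>\<^sup>+r. ennreal (t powr (- 1 - s) * r powr (b - 1)) * ennreal (heat_kernel (t + r) x) * indicator {h<..} t * indicator {0<..} r \<partial>lborel)
       = (\<integral>\<^sup>+c. ennreal (t powr (- 1 - s) * (c - t) powr (b - 1)) * ennreal (heat_kernel c x) * indicator {h<..<c} t \<partial>lborel)" .
  qed
  also have "\<dots> = (\<integral>\<^sup>+c. \<integral>\<^sup>+t. ennreal (t powr (- 1 - s) * (c - t) powr (b - 1)) * ennreal (heat_kernel c x) * indicator {h<..<c} t \<partial>lborel \<partial>lborel)"
    by (rule lborel_pair.Fubini') (unfold indicator_def of_bool_def greaterThanLessThan_iff, measurable)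
  also have "\<dots> = (\<integral>\<^sup>+c. ennreal (heat_kernel c x) * (\<integral>\<^sup>+t. ennreal (t powr (- 1 - s) * (c - t) powr (b - 1)) * indicator {h<..<c} t \<partial>lborel) \<partial>lborel)"
    by (intro nn_integral_cong, subst nn_integral_cmult[symmetric]) (auto simp: mult_ac)
  finally show ?thesis .
qed

text \<open>The second summand of the integrand in \<open>nn_integral_truncated_Beta_le\<close>,
  divided by \<open>c\<close> and superposed with heat kernels. For \<open>h = 0\<close> it is a
  multiple of the ground state times \<open>norm x powr - (2 s)\<close>, that is, the Hardy
  term.\<close>

definition hardy_rest :: "real \<Rightarrow> real \<Rightarrow> real \<Rightarrow> 'a::euclidean_space \<Rightarrow> ennreal" where
  "hardy_rest s b h x = (\<integral>\<^sup>+c. ennreal ((b / s - 1) * heat_kernel c x / c) *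
      (\<integral>\<^sup>+t. ennreal (t powr (- s) * (c - t) powr (b - 1)) * indicator {h<..<c} t \<partial>lborel) * indicator {0<..} c \<partial>lborel)"

lemma hardy_rest_measurable [measurable]:
  assumes [measurable]: "g \<in> borel_measurable M"
  shows "(\<lambda>p. hardy_rest s b h (g p :: 'a::euclidean_space)) \<in> borel_measurable M"
  unfolding hardy_rest_def indicator_def of_bool_def greaterThanLessThan_iff by measurable

text \<open>As \<open>h powr (- s) / s\<close> is the mass of the kernel, this says that the
  truncated nonlocal operator applied to the ground state is at least \<open>hardy_rest\<close>. It
  holds separately for each total time \<open>c\<close>. The additive form avoids a difference of
  possibly infinite integrals.\<close>

lemma hardy_supersolution:
  fixes x :: "'a::euclidean_space"
  assumes s: "0 < s" and b: "s < b" and h: "0 < h"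
  shows "(\<integral>\<^sup>+(y::'a). heat_levy s h (x - y) * (\<integral>\<^sup>+r. ennreal (r powr (b - 1) * heat_kernel r y) * indicator {0<..} r \<partial>lborel) \<partial>lborel)
       + hardy_rest s b h x
     \<le> ennreal (h powr (- s) / s) * (\<integral>\<^sup>+r. ennreal (r powr (b - 1) * heat_kernel r x) * indicator {0<..} r \<partial>lborel)"
proof -
  let ?M = "\<lambda>c. \<integral>\<^sup>+t. ennreal (t powr (- 1 - s) * (c - t) powr (b - 1)) * indicator {h<..<c} t \<partial>lborel"
  let ?L = "\<lambda>c. \<integral>\<^sup>+t. ennreal (t powr (- s) * (c - t) powr (b - 1)) * indicator {h<..<c} t \<partial>lborel"
  have key: "ennreal (heat_kernel c x) * ?M c + ennreal ((b / s - 1) * heat_kernel c x / c) * ?L c * indicator {0<..} c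
      \<le> ennreal (h powr (- s) / s) * (ennreal (c powr (b - 1) * heat_kernel c x) * indicator {0<..} c)" for c
  proof (cases "0 < c")
    case True
    have bs: "0 \<le> b / s - 1" using s b by simp
    have "ennreal c * ?M c + ennreal (b / s - 1) * ?L c
        = (\<integral>\<^sup>+t. ennreal (c * (t powr (- 1 - s) * (c - t) powr (b - 1))
            + (b / s - 1) * (t powr (- s) * (c - t) powr (b - 1))) * indicator {h<..<c} t \<partial>lborel)"
      using True bs
      by (subst nn_integral_cmult[symmetric], measurable, subst nn_integral_cmult[symmetric], measurable,
          subst nn_integral_add[symmetric], measurable)
         (intro nn_integral_cong, auto simp: indicator_def ennreal_mult[symmetric] ennreal_plus[symmetric] simp del: ennreal_plus)
    also have "\<dots> \<le> ennreal (h powr (- s) * c powr b / s)"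
      by (rule nn_integral_truncated_Beta_le[OF s b h])
    finally have le: "ennreal c * ?M c + ennreal (b / s - 1) * ?L c \<le> ennreal (h powr (- s) * c powr b / s)" .
    have "ennreal (heat_kernel c x) * ?M c + ennreal ((b / s - 1) * heat_kernel c x / c) * ?L c
       = ennreal (heat_kernel c x / c) * (ennreal c * ?M c + ennreal (b / s - 1) * ?L c)"
    proof -
      have "ennreal (heat_kernel c x) = ennreal (heat_kernel c x / c) * ennreal c"
        using True by (simp add: ennreal_mult[symmetric])
      moreover have "ennreal ((b / s - 1) * heat_kernel c x / c) = ennreal (heat_kernel c x / c) * ennreal (b / s - 1)"
        using True bs by (simp add: ennreal_mult[symmetric] mult.commute)
      ultimately show ?thesis by (simp add: distrib_left mult.assoc)
    qed
    also have "\<dots> \<le> ennreal (heat_kernel c x / c) * ennreal (h powr (- s) * c powr b / s)"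
      by (rule mult_left_mono[OF le]) simp
    also have "\<dots> = ennreal (h powr (- s) / s) * ennreal (c powr (b - 1) * heat_kernel c x)"
      using True s by (simp add: ennreal_mult[symmetric] powr_diff mult_ac)
    finally show ?thesis using True by simp
  next
    case False
    then have "{h<..<c} = {}" using h by auto
    with False show ?thesis by simp
  qed
  have "(\<integral>\<^sup>+c. ennreal (heat_kernel c x) * ?M c \<partial>lborel) + hardy_rest s b h x
      = (\<integral>\<^sup>+c. ennreal (heat_kernel c x) * ?M c + ennreal ((b / s - 1) * heat_kernel c x / c) * ?L c * indicator {0<..} c \<partial>lborel)"
    unfolding hardy_rest_def
    by (rule nn_integral_add[symmetric]) (unfold indicator_def of_bool_def greaterThanLessThan_iff, measurable)
  also have "\<dots> \<le> (\<integral>\<^sup>+c. ennreal (h powr (- s) / s) * (ennreal (c powr (b - 1) * heat_kernel c x) * indicator {0<..} c) \<partial>lborel)"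
    by (intro nn_integral_mono key)
  also have "\<dots> = ennreal (h powr (- s) / s) * (\<integral>\<^sup>+c. ennreal (c powr (b - 1) * heat_kernel c x) * indicator {0<..} c \<partial>lborel)"
    by (rule nn_integral_cmult) measurable
  finally show ?thesis by (simp only: heat_levy_convolution[OF s h])
qed

text \<open>At \<open>h = 0\<close> the inner integral is a complete Beta integral, equal to a
  multiple of \<open>c powr (b - s)\<close>; the Mellin formula with \<open>b - s\<close> in place
  of \<open>b\<close> does the rest.\<close>

lemma hardy_rest_zero:
  fixes x :: "'a::euclidean_space"
  assumes s: "0 < s" "s < 1" and b: "s < b" and x: "x \<noteq> 0" and bN: "b - s < real DIM('a) / 2"
  shows "hardy_rest s b 0 x = ennreal ((b / s - 1) * Beta (1 - s) b * ((4 * pi) powr (- (real DIM('a) / 2))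
        * Gamma (real DIM('a) / 2 - (b - s)) * ((norm x)\<^sup>2 / 4) powr (b - s - real DIM('a) / 2)))"
proof -
  have bs: "0 \<le> b / s - 1" using s b by simp
  have B0: "0 \<le> Beta (1 - s) b" using s b by (simp add: Beta_def Gamma_real_pos less_imp_le)
  have "hardy_rest s b 0 x = (\<integral>\<^sup>+c. ennreal ((b / s - 1) * Beta (1 - s) b) * (ennreal (c powr (b - s - 1) * heat_kernel c x) * indicator {0<..} c) \<partial>lborel)"
    unfolding hardy_rest_def
  proof (intro nn_integral_cong)
    fix c :: real
    show "ennreal ((b / s - 1) * heat_kernel c x / c) *
      (\<integral>\<^sup>+t. ennreal (t powr (- s) * (c - t) powr (b - 1)) * indicator {0<..<c} t \<partial>lborel) * indicator {0<..} c
      = ennreal ((b / s - 1) * Beta (1 - s) b) * (ennreal (c powr (b - s - 1) * heat_kernel c x) * indicator {0<..} c)"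
    proof (cases "0 < c")
      case True
      have "(\<integral>\<^sup>+t. ennreal (t powr (- s) * (c - t) powr (b - 1)) * indicator {0<..<c} t \<partial>lborel) = ennreal (c powr (b - s) * Beta (1 - s) b)"
        using nn_integral_Beta_interval[of "1 - s" b c] s b True by (simp add: algebra_simps)
      then show ?thesis using True bs B0
        by (simp add: ennreal_mult[symmetric] powr_diff mult_ac)
    qed simp
  qed
  also have "\<dots> = ennreal ((b / s - 1) * Beta (1 - s) b) * ennreal ((4 * pi) powr (- (real DIM('a) / 2)) * Gamma (real DIM('a) / 2 - (b - s)) * ((norm x)\<^sup>2 / 4) powr (b - s - real DIM('a) / 2))"
    by (subst nn_integral_cmult) (measurable, subst nn_integral_heat_kernel_powr[OF x bN], simp)
  finally show ?thesis using bs B0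
    by (simp add: ennreal_mult'[symmetric])
qed

text \<open>The ground state inequality is available only for \<open>h > 0\<close>; monotone
  convergence along \<open>h = 1 / (n + 1)\<close> carries it to the full Hardy weight.\<close>

lemma hardy_rest_SUP: "hardy_rest s b 0 x = (SUP n. hardy_rest s b (1 / real (Suc n)) x)"
proof -
  let ?i = "\<lambda>n c t. ennreal (t powr (- s) * (c - t) powr (b - 1)) * indicator {1 / real (Suc n)<..<c} t"
  have inc: "incseq (\<lambda>n. ?i n c t)" for c t :: real
  proof (rule incseq_SucI)
    fix n
    have "1 / real (Suc (Suc n)) \<le> 1 / real (Suc n)" by (intro divide_left_mono) auto
    then show "?i n c t \<le> ?i (Suc n) c t" by (auto simp: indicator_def)
  qed
  have sup: "ennreal (t powr (- s) * (c - t) powr (b - 1)) * indicator {0<..<c} t = (SUP n. ?i n c t)" for c t :: real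
  proof (rule LIMSEQ_unique[OF _ LIMSEQ_SUP[OF inc]])
    have "eventually (\<lambda>n. ?i n c t = ennreal (t powr (- s) * (c - t) powr (b - 1)) * indicator {0<..<c} t) sequentially"
    proof (cases "0 < t")
      case True
      then obtain m where m: "inverse (real (Suc m)) < t" using reals_Archimedean by blast
      show ?thesis
      proof (rule eventually_sequentiallyI[of m])
        fix n assume "m \<le> n"
        then have "1 / real (Suc n) \<le> inverse (real (Suc m))" by (simp add: divide_simps)
        with m True show "?i n c t = ennreal (t powr (- s) * (c - t) powr (b - 1)) * indicator {0<..<c} t"
          by (auto simp: indicator_def)
      qed
    next
      case False
      then have "\<not> 1 / real (Suc n) < t" for n
        by (metis divide_pos_pos less_trans of_nat_0_less_iff zero_less_Suc zero_less_one)
      with False show ?thesis by (simp add: indicator_def)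
    qed
    then show "(\<lambda>n. ?i n c t) \<longlonglongrightarrow> ennreal (t powr (- s) * (c - t) powr (b - 1)) * indicator {0<..<c} t"
      by (rule tendsto_eventually)
  qed
  have "(\<integral>\<^sup>+t. ennreal (t powr (- s) * (c - t) powr (b - 1)) * indicator {0<..<c} t \<partial>lborel) = (SUP n. \<integral>\<^sup>+t. ?i n c t \<partial>lborel)" for c
    unfolding sup using inc
    by (intro nn_integral_monotone_convergence_SUP) (auto simp: incseq_def le_fun_def)
  then have "hardy_rest s b 0 x = (\<integral>\<^sup>+c. (SUP n. ennreal ((b / s - 1) * heat_kernel c x / c) * (\<integral>\<^sup>+t. ?i n c t \<partial>lborel) * indicator {0<..} c) \<partial>lborel)"
    unfolding hardy_rest_def
    by (intro nn_integral_cong) (simp add: SUP_mult_left_ennreal SUP_mult_right_ennreal)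
  also have "\<dots> = (SUP n. hardy_rest s b (1 / real (Suc n)) x)"
    unfolding hardy_rest_def
  proof (rule nn_integral_monotone_convergence_SUP)
    show "incseq (\<lambda>n c. ennreal ((b / s - 1) * heat_kernel c x / c) * (\<integral>\<^sup>+t. ?i n c t \<partial>lborel) * indicator {0<..} c)"
      by (intro incseq_SucI le_funI mult_right_mono mult_left_mono nn_integral_mono incseq_SucD[OF inc]) simp_all
  qed (unfold indicator_def of_bool_def greaterThanLessThan_iff, measurable)
  finally show ?thesis .
qed

lemma nn_integral_add3:
  assumes "f \<in> borel_measurable M" "g \<in> borel_measurable M" "h \<in> borel_measurable M"
  shows "(\<integral>\<^sup>+x. f x + (g x + h x) \<partial>M) = (\<integral>\<^sup>+x. f x \<partial>M) + ((\<integral>\<^sup>+x. g x \<partial>M) + (\<integral>\<^sup>+x. h x \<partial>M))"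
  using assms by (simp add: nn_integral_add)

text \<open>
  Ground state inequality: with \<open>q = w y / w x\<close>, the arithmetic-geometric mean inequality gives
  \<open>(u x - u y)\<^sup>2 \<ge> (u x)\<^sup>2 (1 - q) + (u y)\<^sup>2 (1 - 1 / q)\<close>.  The truncation at \<open>h\<close> makes each term
  integrable, so that they can be separated.
\<close>

lemma gagliardo_ground_state:
  fixes u :: "'a::euclidean_space \<Rightarrow> real"
  assumes s: "0 < s" and b: "s < b" "b < real DIM('a) / 2" and h: "0 < h"
    and u[measurable]: "u \<in> borel_measurable borel" and fin: "(\<integral>\<^sup>+x. ennreal ((u x)\<^sup>2) \<partial>lborel) < \<infinity>"
  defines "w \<equiv> \<lambda>x::'a. (4 * pi) powr (- (real DIM('a) / 2)) * Gamma (real DIM('a) / 2 - b) * ((norm x)\<^sup>2 / 4) powr (b - real DIM('a) / 2)"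
  shows "2 * (\<integral>\<^sup>+x. ennreal ((u x)\<^sup>2 / w x) * hardy_rest s b h x \<partial>lborel)
     \<le> ennreal (pi powr (- (real DIM('a) / 2)) * 4 powr s * Gamma (real DIM('a) / 2 + s)) * gagliardo s u"
proof -
  let ?K = "\<lambda>x y::'a. heat_levy s h (x - y)"
  define k where "k = pi powr (- (real DIM('a) / 2)) * 4 powr s * Gamma (real DIM('a) / 2 + s)"
  define c where "c = ennreal (h powr (- s) / s)"
  define W :: "'a \<Rightarrow> ennreal" where "W x = (\<integral>\<^sup>+r. ennreal (r powr (b - 1) * heat_kernel r x) * indicator {0<..} r \<partial>lborel)" for x
  have W[measurable]: "W \<in> borel_measurable borel" unfolding W_def by measurable
  have w[measurable]: "w \<in> borel_measurable borel" unfolding w_def by measurable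
  have wpos: "0 < w x" if "x \<noteq> 0" for x
    unfolding w_def using that b(2) by (intro mult_pos_pos) (auto intro: Gamma_real_pos)
  have Ww: "W x = ennreal (w x)" if "x \<noteq> 0" for x
    unfolding W_def w_def by (rule nn_integral_heat_kernel_powr[OF that b(2)])
  have k0: "0 \<le> k" unfolding k_def using s by (intro mult_nonneg_nonneg) (auto intro!: less_imp_le Gamma_real_pos add_nonneg_pos)
  \<comment> \<open>\<open>D\<close> is the mass term, \<open>A\<close> the interaction with the
    ground state, \<open>B\<close> the Hardy term and \<open>F\<close> the truncated energy. The
    supersolution property gives \<open>A + B \<le> D\<close>, the mean inequality
    \<open>D + D \<le> F + (A + A)\<close>; cancelling \<open>A + A\<close> leaves
    \<open>2 * B \<le> F\<close>.\<close>
  define D where "D = c * (\<integral>\<^sup>+x. ennreal ((u x)\<^sup>2) \<partial>lborel)"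
  define A where "A = (\<integral>\<^sup>+x. ennreal ((u x)\<^sup>2 / w x) * (\<integral>\<^sup>+y. ?K x y * W y \<partial>lborel) \<partial>lborel)"
  define B where "B = (\<integral>\<^sup>+x. ennreal ((u x)\<^sup>2 / w x) * hardy_rest s b h x \<partial>lborel)"
  define F where "F = (\<integral>\<^sup>+x. \<integral>\<^sup>+y. ?K x y * ennreal ((u x - u y)\<^sup>2) \<partial>lborel \<partial>lborel)"
  have Dfin: "D < \<infinity>" unfolding D_def c_def using fin by (simp add: ennreal_mult_less_top)
  have AB: "A + B \<le> D"
  proof -
    have "A + B = (\<integral>\<^sup>+x. ennreal ((u x)\<^sup>2 / w x) * (\<integral>\<^sup>+y. ?K x y * W y \<partial>lborel) + ennreal ((u x)\<^sup>2 / w x) * hardy_rest s b h x \<partial>lborel)"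
      unfolding A_def B_def by (rule nn_integral_add[symmetric]) measurable
    also have "\<dots> \<le> (\<integral>\<^sup>+x. c * ennreal ((u x)\<^sup>2) \<partial>lborel)"
    proof (rule nn_integral_mono_nonzero)
      fix x :: 'a assume x: "x \<noteq> 0"
      have "ennreal ((u x)\<^sup>2 / w x) * (\<integral>\<^sup>+y. ?K x y * W y \<partial>lborel) + ennreal ((u x)\<^sup>2 / w x) * hardy_rest s b h x
        = ennreal ((u x)\<^sup>2 / w x) * ((\<integral>\<^sup>+y. ?K x y * W y \<partial>lborel) + hardy_rest s b h x)"
        by (simp add: distrib_left)
      also have "\<dots> \<le> ennreal ((u x)\<^sup>2 / w x) * (c * W x)"
        unfolding W_def c_def by (intro mult_left_mono hardy_supersolution s b h) simp
      also have "\<dots> = c * (ennreal ((u x)\<^sup>2 / w x) * ennreal (w x))" by (simp add: Ww[OF x] mult_ac)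
      also have "ennreal ((u x)\<^sup>2 / w x) * ennreal (w x) = ennreal ((u x)\<^sup>2)"
        using wpos[OF x] by (simp add: ennreal_mult[symmetric])
      finally show "ennreal ((u x)\<^sup>2 / w x) * (\<integral>\<^sup>+y. ?K x y * W y \<partial>lborel) + ennreal ((u x)\<^sup>2 / w x) * hardy_rest s b h x
        \<le> c * ennreal ((u x)\<^sup>2)" .
    qed
    also have "\<dots> = D" unfolding D_def by (rule nn_integral_cmult) measurable
    finally show ?thesis .
  qed
  have Kx: "(\<integral>\<^sup>+y. ?K x y \<partial>lborel) = c" for x :: 'a unfolding c_def by (rule nn_integral_heat_levy[OF s h])
  have "D + D \<le> F + (A + A)"
  proof -
    have D1: "(\<integral>\<^sup>+x. \<integral>\<^sup>+y. ?K x y * ennreal ((u x)\<^sup>2) \<partial>lborel \<partial>lborel) = D"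
      by (simp add: nn_integral_multc Kx D_def nn_integral_cmult)
    have D2: "(\<integral>\<^sup>+x. \<integral>\<^sup>+y. ?K x y * ennreal ((u y)\<^sup>2) \<partial>lborel \<partial>lborel) = D"
    proof -
      have "(\<integral>\<^sup>+x. \<integral>\<^sup>+y. ?K x y * ennreal ((u y)\<^sup>2) \<partial>lborel \<partial>lborel) = (\<integral>\<^sup>+y. \<integral>\<^sup>+x. ?K x y * ennreal ((u y)\<^sup>2) \<partial>lborel \<partial>lborel)"
        by (rule lborel_pair.Fubini') measurable
      also have "\<dots> = D" by (subst heat_levy_minus_commute) (rule D1)
      finally show ?thesis .
    qed
    have A1: "(\<integral>\<^sup>+x. \<integral>\<^sup>+y. ?K x y * (ennreal ((u x)\<^sup>2 / w x) * W y) \<partial>lborel \<partial>lborel) = A"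
      unfolding A_def by (rule nn_integral_cong, subst nn_integral_cmult[symmetric]) (measurable, simp add: mult_ac)
    have A2: "(\<integral>\<^sup>+x. \<integral>\<^sup>+y. ?K x y * (ennreal ((u y)\<^sup>2 / w y) * W x) \<partial>lborel \<partial>lborel) = A"
    proof -
      have "(\<integral>\<^sup>+x. \<integral>\<^sup>+y. ?K x y * (ennreal ((u y)\<^sup>2 / w y) * W x) \<partial>lborel \<partial>lborel) = (\<integral>\<^sup>+y. \<integral>\<^sup>+x. ?K x y * (ennreal ((u y)\<^sup>2 / w y) * W x) \<partial>lborel \<partial>lborel)"
        by (rule lborel_pair.Fubini') measurable
      also have "\<dots> = A" by (subst heat_levy_minus_commute) (rule A1)
      finally show ?thesis .
    qed
    have "D + D = (\<integral>\<^sup>+x. (\<integral>\<^sup>+y. ?K x y * ennreal ((u x)\<^sup>2) \<partial>lborel) + (\<integral>\<^sup>+y. ?K x y * ennreal ((u y)\<^sup>2) \<partial>lborel) \<partial>lborel)"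
      by (subst nn_integral_add) (measurable, simp only: D1 D2)
    also have "\<dots> = (\<integral>\<^sup>+x. (\<integral>\<^sup>+y. ?K x y * ennreal ((u x)\<^sup>2) + ?K x y * ennreal ((u y)\<^sup>2) \<partial>lborel) \<partial>lborel)"
      by (rule nn_integral_cong, rule nn_integral_add[symmetric]) measurable
    also have "\<dots> \<le> (\<integral>\<^sup>+x. (\<integral>\<^sup>+y. ?K x y * ennreal ((u x - u y)\<^sup>2) + (?K x y * (ennreal ((u x)\<^sup>2 / w x) * W y) + ?K x y * (ennreal ((u y)\<^sup>2 / w y) * W x)) \<partial>lborel) \<partial>lborel)"
    proof (rule nn_integral_mono_nonzero, rule nn_integral_mono_nonzero)
      fix x y :: 'a assume x: "x \<noteq> 0" and y: "y \<noteq> 0"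
      have real: "(u x)\<^sup>2 + (u y)\<^sup>2 \<le> (u x - u y)\<^sup>2 + ((u x)\<^sup>2 / w x * w y + (u y)\<^sup>2 / w y * w x)"
      proof -
        have p: "0 < w x" "0 < w y" using wpos x y by auto
        have "(u x)\<^sup>2 / w x * w y + (u y)\<^sup>2 / w y * w x - 2 * u x * u y = (u x * w y - u y * w x)\<^sup>2 / (w x * w y)"
          using p by (simp add: field_simps power2_eq_square)
        moreover have "0 \<le> (u x * w y - u y * w x)\<^sup>2 / (w x * w y)" using p by simp
        ultimately have "2 * u x * u y \<le> (u x)\<^sup>2 / w x * w y + (u y)\<^sup>2 / w y * w x" by linarith
        then show ?thesis by (simp add: power2_diff)
      qed
      have "ennreal ((u x)\<^sup>2) + ennreal ((u y)\<^sup>2) \<le> ennreal ((u x - u y)\<^sup>2) + (ennreal ((u x)\<^sup>2 / w x) * W y + ennreal ((u y)\<^sup>2 / w y) * W x)"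
        using real wpos[OF x] wpos[OF y]
        by (simp add: Ww x y ennreal_mult[symmetric] ennreal_plus[symmetric] ennreal_leI del: ennreal_plus)
      then have "?K x y * (ennreal ((u x)\<^sup>2) + ennreal ((u y)\<^sup>2)) \<le> ?K x y * (ennreal ((u x - u y)\<^sup>2) + (ennreal ((u x)\<^sup>2 / w x) * W y + ennreal ((u y)\<^sup>2 / w y) * W x))"
        by (rule mult_left_mono) simp
      then show "?K x y * ennreal ((u x)\<^sup>2) + ?K x y * ennreal ((u y)\<^sup>2) \<le> ?K x y * ennreal ((u x - u y)\<^sup>2) + (?K x y * (ennreal ((u x)\<^sup>2 / w x) * W y) + ?K x y * (ennreal ((u y)\<^sup>2 / w y) * W x))"
        by (simp only: distrib_left)
    qed
    also have "\<dots> = (\<integral>\<^sup>+x. (\<integral>\<^sup>+y. ?K x y * ennreal ((u x - u y)\<^sup>2) \<partial>lborel) + ((\<integral>\<^sup>+y. ?K x y * (ennreal ((u x)\<^sup>2 / w x) * W y) \<partial>lborel) + (\<integral>\<^sup>+y. ?K x y * (ennreal ((u y)\<^sup>2 / w y) * W x) \<partial>lborel)) \<partial>lborel)"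
      by (rule nn_integral_cong, rule nn_integral_add3) measurable
    also have "\<dots> = F + (A + A)"
      by (rule trans[OF nn_integral_add3], measurable, measurable, measurable, simp only: A1 A2 F_def)
    finally show ?thesis .
  qed
  moreover have "(A + A) + (B + B) \<le> D + D"
    using add_mono[OF AB AB] by (simp add: ac_simps)
  ultimately have "(A + A) + (B + B) \<le> (A + A) + F"
    by (metis add.commute order_trans)
  \<comment> \<open>Cancellation in \<open>ennreal\<close> requires a finite term; \<open>A\<close>
    is bounded by \<open>D\<close>, which is finite since the kernel has finite mass and
    \<open>u\<close> is square integrable.\<close>
  moreover have "A + A \<noteq> top"
  proof -
    have "A \<le> D" using AB by (metis add_increasing2 order_trans zero_le order_refl)
    then have "A < top" using Dfin by (simp add: order_le_less_trans)
    then show ?thesis by simp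
  qed
  ultimately have "2 * B \<le> F"
    by (simp add: mult_2 ennreal_add_left_cancel_le)
  also have "F \<le> (\<integral>\<^sup>+x. \<integral>\<^sup>+y. ennreal k * ennreal ((u x - u y)\<^sup>2 / norm (x - y) powr (real DIM('a) + 2 * s)) \<partial>lborel \<partial>lborel)"
    unfolding F_def
  proof (intro nn_integral_mono)
    fix x y :: 'a
    show "?K x y * ennreal ((u x - u y)\<^sup>2) \<le> ennreal k * ennreal ((u x - u y)\<^sup>2 / norm (x - y) powr (real DIM('a) + 2 * s))"
    proof (cases "x = y")
      case False
      then have "?K x y * ennreal ((u x - u y)\<^sup>2) \<le> ennreal (k / norm (x - y) powr (real DIM('a) + 2 * s)) * ennreal ((u x - u y)\<^sup>2)"
        unfolding k_def using h by (intro mult_right_mono heat_levy_le s) auto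
      also have "\<dots> = ennreal k * ennreal ((u x - u y)\<^sup>2 / norm (x - y) powr (real DIM('a) + 2 * s))"
        using k0 by (simp add: ennreal_mult[symmetric])
      finally show ?thesis .
    qed simp
  qed
  also have "\<dots> = ennreal k * gagliardo s u"
    unfolding gagliardo_def by (subst nn_integral_cmult[symmetric], measurable, subst nn_integral_cmult[symmetric], measurable)
  finally show ?thesis unfolding B_def k_def .
qed

theorem fractional_hardy:
  fixes u :: "'a::euclidean_space \<Rightarrow> real"
  assumes s: "0 < s" "s < 1" and N: "2 * s < real DIM('a)"
    and u[measurable]: "u \<in> borel_measurable borel" and fin: "(\<integral>\<^sup>+x. ennreal ((u x)\<^sup>2) \<partial>lborel) < \<infinity>"
  shows "ennreal (gamma_H DIM('a) s) * (\<integral>\<^sup>+x. ennreal ((u x)\<^sup>2 / norm x powr (2 * s)) \<partial>lborel)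
     \<le> ennreal (C_const DIM('a) s / 2) * gagliardo s u"
proof -
  define N where "N = real DIM('a)"
  \<comment> \<open>This choice makes \<open>b - s = N / 2 - b\<close>, so that the Gamma factors
    pair up to the squared quotient in \<open>gamma_H\<close>, and it gives the ground state the
    exponent \<open>- (N - 2 s) / 2\<close>.\<close>
  define b where "b = (N + 2 * s) / 4"
  define k where "k = pi powr (- (N / 2)) * 4 powr s * Gamma (N / 2 + s)"
  define w where "w = (\<lambda>x::'a. (4 * pi) powr (- (N / 2)) * Gamma (N / 2 - b) * ((norm x)\<^sup>2 / 4) powr (b - N / 2))"
  have Ns: "2 * s < N" using N by (simp add: N_def)
  have b: "s < b" "b < N / 2" using s Ns by (simp_all add: b_def field_simps)
  \<comment> \<open>The common factor of both sides: the Beta factor in the Hardy term contributes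
    \<open>G * gamma_H\<close>, and \<open>k = G * C_const\<close>.\<close>
  define G where "G = Gamma (1 - s) / s"
  have G: "0 < G" using s by (auto simp: G_def intro!: divide_pos_pos Gamma_real_pos)
  have w[measurable]: "w \<in> borel_measurable borel" unfolding w_def by measurable
  have rest0: "ennreal ((u x)\<^sup>2 / w x) * hardy_rest s b 0 x = ennreal (G * gamma_H DIM('a) s) * ennreal ((u x)\<^sup>2 / norm x powr (2 * s))" if x: "x \<noteq> 0" for x :: 'a
  proof -
    define R where "R = (b / s - 1) * Beta (1 - s) b * ((4 * pi) powr (- (N / 2)) * Gamma (N / 2 - (b - s)) * ((norm x)\<^sup>2 / 4) powr (b - s - N / 2))"
    have bs: "b - s < real DIM('a) / 2" using b s by (simp add: N_def)
    have "hardy_rest s b 0 x = ennreal R"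
      unfolding R_def N_def by (rule hardy_rest_zero[OF s b(1) x bs])
    moreover have e: "R = G * gamma_H DIM('a) s / norm x powr (2 * s) * w x"
    proof -
      have g1: "Gamma (b - s) \<noteq> 0" "Gamma (N / 2 - b) \<noteq> 0"
        using b by (auto intro!: less_imp_neq[THEN not_sym] Gamma_real_pos)
      have f1: "(b / s - 1) * Beta (1 - s) b = G * Gamma b / Gamma (b - s)"
      proof -
        have "Gamma (1 - s + b) = (b - s) * Gamma (b - s)"
        proof -
          have "b - s \<notin> \<int>\<^sub>\<le>\<^sub>0" using b(1) by (auto dest: nonpos_Ints_nonpos)
          from Gamma_plus1[OF this] show ?thesis by (simp add: algebra_simps)
        qed
        moreover have "b / s - 1 = (b - s) / s" using s by (simp add: diff_divide_distrib)
        ultimately show ?thesis using b(1) by (simp add: Beta_def G_def)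
      qed
      have f2: "((norm x)\<^sup>2 / 4) powr (b - s - N / 2) = ((norm x)\<^sup>2 / 4) powr (b - N / 2) * (4 powr s / norm x powr (2 * s))"
      proof -
        have "((norm x)\<^sup>2 / 4) powr (b - s - N / 2) = ((norm x)\<^sup>2 / 4) powr (b - N / 2) * ((norm x)\<^sup>2 / 4) powr (- s)"
          by (simp add: powr_add[symmetric] algebra_simps)
        then show ?thesis by (simp only: norm_sq_quarter_powr[OF x, of s])
      qed
      have f3: "gamma_H DIM('a) s = 4 powr s * (Gamma b * Gamma b / (Gamma (b - s) * Gamma (b - s)))"
      proof -
        have e1: "2 powr (2 * s) = 4 powr s" by (simp add: powr_powr[symmetric])
        have e2: "(real DIM('a) - 2 * s) / 4 = b - s" by (simp add: b_def N_def field_simps)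
        have e3: "(real DIM('a) + 2 * s) / 4 = b" by (simp add: b_def N_def)
        show ?thesis unfolding gamma_H_def e1 e2 e3 by (simp add: power2_eq_square)
      qed
      have f4: "N / 2 - (b - s) = b" "N / 2 - b = b - s" by (simp_all add: b_def field_simps)
      show ?thesis
        unfolding R_def w_def f1 f2 f3 f4 using g1 by (simp add: mult_ac)
    qed
    moreover have "0 < w x" unfolding w_def using x b by (intro mult_pos_pos) (auto intro: Gamma_real_pos)
    moreover have "0 \<le> gamma_H DIM('a) s" by (simp add: gamma_H_def)
    ultimately show ?thesis using G by (simp add: ennreal_mult'[symmetric] ennreal_mult''[symmetric] mult_ac)
  qed
  have "2 * (\<integral>\<^sup>+x. ennreal ((u x)\<^sup>2 / w x) * hardy_rest s b 0 x \<partial>lborel) \<le> ennreal k * gagliardo s u"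
  proof -
    have "(\<integral>\<^sup>+x. ennreal ((u x)\<^sup>2 / w x) * hardy_rest s b 0 x \<partial>lborel)
       = (\<integral>\<^sup>+x. (SUP n. ennreal ((u x)\<^sup>2 / w x) * hardy_rest s b (1 / real (Suc n)) x) \<partial>lborel)"
      by (simp add: hardy_rest_SUP SUP_mult_left_ennreal)
    also have "\<dots> = (SUP n. \<integral>\<^sup>+x. ennreal ((u x)\<^sup>2 / w x) * hardy_rest s b (1 / real (Suc n)) x \<partial>lborel)"
    proof (rule nn_integral_monotone_convergence_SUP)
      show "incseq (\<lambda>n x. ennreal ((u x)\<^sup>2 / w x) * hardy_rest s b (1 / real (Suc n)) x)"
        unfolding hardy_rest_def
      proof (intro incseq_SucI le_funI mult_left_mono nn_integral_mono mult_right_mono)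
        fix n c t
        have "1 / real (Suc (Suc n)) \<le> 1 / real (Suc n)" by (intro divide_left_mono) auto
        then show "indicator {1 / real (Suc n)<..<c} t \<le> (indicator {1 / real (Suc (Suc n))<..<c} t :: ennreal)"
          by (auto simp: indicator_def)
      qed simp_all
    qed measurable
    finally have eq: "(\<integral>\<^sup>+x. ennreal ((u x)\<^sup>2 / w x) * hardy_rest s b 0 x \<partial>lborel) = (SUP n. \<integral>\<^sup>+x. ennreal ((u x)\<^sup>2 / w x) * hardy_rest s b (1 / real (Suc n)) x \<partial>lborel)" .
    have "2 * (\<integral>\<^sup>+x. ennreal ((u x)\<^sup>2 / w x) * hardy_rest s b (1 / real (Suc n)) x \<partial>lborel) \<le> ennreal k * gagliardo s u" for n
      unfolding w_def k_def N_def
      by (rule gagliardo_ground_state[OF s(1) b(1) _ _ u fin]) (use b in \<open>simp_all add: N_def\<close>)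
    then show ?thesis unfolding eq SUP_mult_left_ennreal by (intro SUP_least)
  qed
  moreover have "(\<integral>\<^sup>+x. ennreal ((u x)\<^sup>2 / w x) * hardy_rest s b 0 x \<partial>lborel)
      = ennreal (G * gamma_H DIM('a) s) * (\<integral>\<^sup>+x. ennreal ((u x)\<^sup>2 / norm x powr (2 * s)) \<partial>lborel)"
    by (subst nn_integral_cmult[symmetric], measurable, rule nn_integral_cong_nonzero, rule rest0)
  ultimately have *: "2 * (ennreal (G * gamma_H DIM('a) s) * (\<integral>\<^sup>+x. ennreal ((u x)\<^sup>2 / norm x powr (2 * s)) \<partial>lborel)) \<le> ennreal k * gagliardo s u"
    by simp
  have C: "C_const DIM('a) s / 2 = k / (2 * G)"
  proof -
    have "1 - s \<notin> \<int>\<^sub>\<le>\<^sub>0" using s by (auto dest: nonpos_Ints_nonpos)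
    then have e1: "Gamma (2 - s) = (1 - s) * Gamma (1 - s)" using Gamma_plus1[of "1 - s"] by simp
    have e2: "2 powr (2 * s) = 4 powr s" by (simp add: powr_powr[symmetric])
    have e3: "(real DIM('a) + 2 * s) / 2 = N / 2 + s" by (simp add: N_def field_simps)
    show ?thesis unfolding C_const_def e1 e2 e3 k_def G_def using s by (simp add: N_def)
  qed
  have k0: "0 \<le> k" unfolding k_def using s Ns by (auto intro!: mult_nonneg_nonneg less_imp_le[OF Gamma_real_pos])
  have "ennreal (1 / (2 * G)) * (2 * (ennreal (G * gamma_H DIM('a) s) * (\<integral>\<^sup>+x. ennreal ((u x)\<^sup>2 / norm x powr (2 * s)) \<partial>lborel)))
      \<le> ennreal (1 / (2 * G)) * (ennreal k * gagliardo s u)"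
    by (rule mult_left_mono[OF *]) simp
  moreover have "ennreal (1 / (2 * G)) * (2 * (ennreal (G * gamma_H DIM('a) s) * X)) = ennreal (gamma_H DIM('a) s) * X" for X
  proof -
    have "ennreal (1 / (2 * G)) * (2 * (ennreal (G * gamma_H DIM('a) s) * X)) = (ennreal (1 / (2 * G)) * ennreal 2 * ennreal (G * gamma_H DIM('a) s)) * X"
      by (simp add: mult_ac)
    also have "ennreal (1 / (2 * G)) * ennreal 2 * ennreal (G * gamma_H DIM('a) s) = ennreal (1 / (2 * G) * 2 * (G * gamma_H DIM('a) s))"
      using G by (subst ennreal_mult[symmetric], simp, simp, subst ennreal_mult[symmetric]) (auto simp: gamma_H_def)
    also have "1 / (2 * G) * 2 * (G * gamma_H DIM('a) s) = gamma_H DIM('a) s" using G by simp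
    finally show ?thesis .
  qed
  moreover have "ennreal (1 / (2 * G)) * (ennreal k * gagliardo s u) = ennreal (C_const DIM('a) s / 2) * gagliardo s u"
    unfolding C mult.assoc[symmetric] using G k0 by (simp add: ennreal_mult[symmetric])
  ultimately show ?thesis by simp
qed

section \<open>Test functions\<close>

lemma C_k_Suc_D: "C_k (Suc k) f \<Longrightarrow> C_k k f"
proof (induction k arbitrary: f)
  case 0
  then show ?case
    by (auto intro!: continuous_at_imp_continuous_on dest: has_derivative_continuous)
next
  case (Suc k)
  then obtain f' where "\<forall>x. (f has_derivative f' x) (at x)" "\<forall>v. C_k (Suc k) (\<lambda>x. f' x v)" by auto
  with Suc.IH show ?case by auto
qed

lemma C_k_const: "C_k k (\<lambda>x. c)"
proof (induction k arbitrary: c)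
  case (Suc k)
  then show ?case by (auto intro!: exI[of _ "\<lambda>_ _. 0"])
qed simp

lemma C_k_add: "C_k k f \<Longrightarrow> C_k k g \<Longrightarrow> C_k k (\<lambda>x. f x + g x)"
proof (induction k arbitrary: f g)
  case (Suc k)
  then obtain f' g' where "\<forall>x. (f has_derivative f' x) (at x)" "\<forall>v. C_k k (\<lambda>x. f' x v)"
    "\<forall>x. (g has_derivative g' x) (at x)" "\<forall>v. C_k k (\<lambda>x. g' x v)" by auto
  with Suc.IH show ?case
    by (auto intro!: exI[of _ "\<lambda>x h. f' x h + g' x h"] has_derivative_add)
qed (auto intro: continuous_intros)

lemma C_k_mult: "C_k k f \<Longrightarrow> C_k k g \<Longrightarrow> C_k k (\<lambda>x. f x * g x)"
proof (induction k arbitrary: f g)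
  case (Suc k)
  then obtain f' g' where "\<forall>x. (f has_derivative f' x) (at x)" "\<forall>v. C_k k (\<lambda>x. f' x v)"
    "\<forall>x. (g has_derivative g' x) (at x)" "\<forall>v. C_k k (\<lambda>x. g' x v)" by auto
  with Suc show ?case
    by (auto intro!: exI[of _ "\<lambda>x h. f x * g' x h + f' x h * g x"] has_derivative_mult C_k_add dest!: C_k_Suc_D simp del: C_k.simps(2) simp: C_k.simps(2)[of k "\<lambda>x. f x * g x"])
qed (auto intro: continuous_intros)

lemma C_k_minus: "C_k k f \<Longrightarrow> C_k k (\<lambda>x. - f x)"
  using C_k_mult[OF C_k_const[of k "-1"], of f] by simp

lemma C_k_diff: "C_k k f \<Longrightarrow> C_k k g \<Longrightarrow> C_k k (\<lambda>x. f x - g x)"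
  using C_k_add[of k f "\<lambda>x. - g x"] C_k_minus[of k g] by simp

lemma C_k_inverse: "C_k k f \<Longrightarrow> (\<And>x. f x \<noteq> 0) \<Longrightarrow> C_k k (\<lambda>x. inverse (f x))"
proof (induction k)
  case (Suc k)
  then obtain f' where f': "\<forall>x. (f has_derivative f' x) (at x)" "\<forall>v. C_k k (\<lambda>x. f' x v)" by auto
  have i: "C_k k (\<lambda>x. inverse (f x))" using Suc C_k_Suc_D by blast
  have "C_k k (\<lambda>x. - (inverse (f x) * f' x v * inverse (f x)))" for v
    using f' i by (intro C_k_minus C_k_mult) auto
  moreover have "((\<lambda>x. inverse (f x)) has_derivative (\<lambda>h. - (inverse (f x) * f' x h * inverse (f x)))) (at x)" for x
    using f' Suc.prems by (intro Deriv.has_derivative_inverse) auto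
  ultimately show ?case
    unfolding C_k.simps by (intro exI[of _ "\<lambda>x h. - (inverse (f x) * f' x h * inverse (f x))"]) auto
qed (auto intro: continuous_intros)

lemma C_k_ln: "C_k k f \<Longrightarrow> (\<And>x. 0 < f x) \<Longrightarrow> C_k k (\<lambda>x. ln (f x))"
proof (cases k)
  case (Suc j)
  assume f: "C_k k f" and pos: "\<And>x. 0 < f x"
  then obtain f' where f': "\<forall>x. (f has_derivative f' x) (at x)" "\<forall>v. C_k j (\<lambda>x. f' x v)" using Suc by auto
  have ne: "f x \<noteq> 0" for x using pos[of x] by simp
  have "C_k j f" using f Suc C_k_Suc_D by blast
  then have "C_k j (\<lambda>x. f' x v * inverse (f x))" for v
    using f' ne by (intro C_k_mult C_k_inverse) auto
  moreover have "((\<lambda>x. ln (f x)) has_derivative (\<lambda>h. f' x h * inverse (f x))) (at x)" for x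
    by (rule has_derivative_ln) (use f' pos in auto)
  ultimately show ?thesis
    unfolding Suc C_k.simps by (intro exI[of _ "\<lambda>x h. f' x h * inverse (f x)"]) auto
next
  case 0
  assume "C_k k f" "\<And>x. 0 < f x"
  then show ?thesis using 0 by (auto intro!: continuous_intros) (metis less_irrefl)
qed

lemma C_k_exp: "C_k k f \<Longrightarrow> C_k k (\<lambda>x. exp (f x))"
proof (induction k)
  case (Suc k)
  then obtain f' where f': "\<forall>x. (f has_derivative f' x) (at x)" "\<forall>v. C_k k (\<lambda>x. f' x v)" by auto
  have "C_k k (\<lambda>x. exp (f x) * f' x v)" for v
    using f' Suc C_k_Suc_D by (intro C_k_mult) blast+
  moreover have "((\<lambda>x. exp (f x)) has_derivative (\<lambda>h. exp (f x) * f' x h)) (at x)" for x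
    using has_derivative_exp[of f "f' x" x UNIV] f' by (auto simp: mult.commute)
  ultimately show ?case
    unfolding C_k.simps by (intro exI[of _ "\<lambda>x h. exp (f x) * f' x h"]) auto
qed (auto intro: continuous_intros)

lemma C_k_inner_const: "C_k k (\<lambda>x. x \<bullet> a)"
proof (cases k)
  case (Suc j)
  show ?thesis unfolding Suc C_k.simps
    by (intro exI[of _ "\<lambda>x h. h \<bullet> a"]) (auto intro!: derivative_eq_intros C_k_const)
qed (auto intro: continuous_intros)

lemma C_k_inner_self: "C_k k (\<lambda>x. x \<bullet> x)"
proof (cases k)
  case (Suc j)
  have "C_k j (\<lambda>x. 2 * (x \<bullet> v))" for v :: 'a by (intro C_k_mult C_k_const C_k_inner_const)
  moreover have "((\<lambda>x. x \<bullet> x) has_derivative (\<lambda>h. 2 * (x \<bullet> h))) (at x)" for x :: 'a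
    by (auto intro!: derivative_eq_intros simp: inner_commute)
  ultimately show ?thesis unfolding Suc C_k.simps by (intro exI[of _ "\<lambda>x h. 2 * (x \<bullet> h)"]) auto
qed (auto intro: continuous_intros)

lemma C_k_shift:
  fixes f :: "'a::euclidean_space \<Rightarrow> real"
  shows "C_k k f \<Longrightarrow> C_k k (\<lambda>x. f (x - a))"
proof (induction k arbitrary: f)
  case 0
  then show ?case by (auto intro!: continuous_on_compose2[of UNIV f] continuous_intros)
next
  case (Suc k)
  then obtain f' where f': "\<forall>x. (f has_derivative f' x) (at x)" "\<forall>v. C_k k (\<lambda>x. f' x v)" by auto
  have "((\<lambda>x. f (x - a)) has_derivative f' (x - a)) (at x)" for x
  proof -
    have "((\<lambda>x. x - a) has_derivative (\<lambda>h. h)) (at x)" by (auto intro!: derivative_eq_intros)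
    from has_derivative_compose[OF this, of f "f' (x - a)"] f' show ?thesis by simp
  qed
  then show ?case using f' Suc.IH unfolding C_k.simps by (intro exI[of _ "\<lambda>x. f' (x - a)"]) auto
qed

section \<open>Supports, bounds and Lipschitz constants of test functions\<close>

lemma Cc_infty_I:
  assumes "\<And>k. C_k k f" and "\<And>x. R < norm x \<Longrightarrow> f x = 0"
  shows "f \<in> Cc_infty"
proof -
  have "{x. f x \<noteq> 0} \<subseteq> cball 0 R" using assms(2) by (auto simp: not_less[symmetric])
  then have "compact (closure {x. f x \<noteq> 0})"
    using bounded_subset compact_closure bounded_cball by blast
  with assms(1) show ?thesis by (simp add: Cc_infty_def)
qed

lemma Cc_infty_support:
  assumes "f \<in> Cc_infty"
  obtains R where "0 < R" "\<And>x. R < norm x \<Longrightarrow> f x = 0"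
proof -
  have "bounded {x. f x \<noteq> 0}"
    using assms by (auto simp: Cc_infty_def intro: bounded_subset[OF compact_imp_bounded closure_subset])
  then obtain R where "0 < R" "\<forall>x\<in>{x. f x \<noteq> 0}. norm x \<le> R" using bounded_pos by blast
  then have "R < norm x \<Longrightarrow> f x = 0" for x by force
  with \<open>0 < R\<close> that show ?thesis by blast
qed

lemma Cc_infty_continuous: "f \<in> Cc_infty \<Longrightarrow> continuous_on UNIV f"
  by (auto simp: Cc_infty_def dest: spec[of _ 0])

lemma Cc_infty_borel_measurable: "f \<in> Cc_infty \<Longrightarrow> f \<in> borel_measurable borel"
  by (intro borel_measurable_continuous_onI Cc_infty_continuous)

lemma Cc_infty_mult:
  assumes "\<And>k. C_k k g" "f \<in> Cc_infty"
  shows "(\<lambda>x. g x * f x) \<in> Cc_infty"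
proof -
  obtain R where "\<And>x. R < norm x \<Longrightarrow> f x = 0" using Cc_infty_support[OF assms(2)] by blast
  then show ?thesis using assms by (intro Cc_infty_I[of _ R] C_k_mult) (auto simp: Cc_infty_def)
qed

lemma Cc_infty_diff:
  assumes "f \<in> Cc_infty" "g \<in> Cc_infty"
  shows "(\<lambda>x. f x - g x) \<in> Cc_infty"
proof -
  obtain R where R: "\<And>x. R < norm x \<Longrightarrow> f x = 0" using Cc_infty_support[OF assms(1)] by blast
  obtain S where S: "\<And>x. S < norm x \<Longrightarrow> g x = 0" using Cc_infty_support[OF assms(2)] by blast
  show ?thesis using assms R S by (intro Cc_infty_I[of _ "max R S"] C_k_diff) (auto simp: Cc_infty_def)
qed

lemma Cc_infty_shift:
  fixes f :: "'a::euclidean_space \<Rightarrow> real"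
  assumes "f \<in> Cc_infty"
  shows "(\<lambda>x. f (x - a)) \<in> Cc_infty"
proof -
  obtain R where R: "\<And>x. R < norm x \<Longrightarrow> f x = 0" using Cc_infty_support[OF assms] by blast
  show ?thesis
  proof (rule Cc_infty_I[of _ "R + norm a"])
    fix x :: 'a assume "R + norm a < norm x"
    moreover have "norm x \<le> norm (x - a) + norm a" using norm_triangle_sub[of x a] by simp
    ultimately show "f (x - a) = 0" by (intro R) linarith
  qed (use assms in \<open>auto simp: Cc_infty_def intro: C_k_shift\<close>)
qed

lemma Cc_infty_bounded:
  assumes "f \<in> Cc_infty"
  obtains B where "0 < B" "\<And>x. \<bar>f x\<bar> \<le> B"
proof -
  obtain R where R: "\<And>x. R < norm x \<Longrightarrow> f x = 0" using Cc_infty_support[OF assms] by blast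
  have "compact (f ` cball 0 R)"
    by (rule compact_continuous_image[OF continuous_on_subset[OF Cc_infty_continuous[OF assms]]]) auto
  then have "bounded (f ` cball 0 R)" by (rule compact_imp_bounded)
  then obtain B where B: "\<forall>x\<in>cball 0 R. \<bar>f x\<bar> \<le> B" unfolding bounded_iff by auto
  have "\<bar>f x\<bar> \<le> max B 1" for x
  proof (cases "norm x \<le> R")
    case True
    then show ?thesis using B by (auto intro: max.coboundedI1)
  qed (simp add: R)
  then show ?thesis using that[of "max B 1"] by auto
qed

text \<open>\<open>C_k\<close> provides continuity only of each directional derivative. These vanish
  outside the support ball and are bounded inside by compactness; summing the bounds over
  \<open>Basis\<close> controls the operator norm of the derivative.\<close>

lemma Cc_infty_Lipschitz:
  fixes f :: "'a::euclidean_space \<Rightarrow> real"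
  assumes "f \<in> Cc_infty"
  shows "\<exists>L>0. \<forall>x y. \<bar>f x - f y\<bar> \<le> L * norm (x - y)"
proof -
  have "C_k (Suc 0) f" using assms by (auto simp: Cc_infty_def simp del: C_k.simps)
  then obtain f' where f': "\<And>x. (f has_derivative f' x) (at x)" "\<And>v. continuous_on UNIV (\<lambda>x. f' x v)" by auto
  obtain R where R: "\<And>x. R < norm x \<Longrightarrow> f x = 0" using Cc_infty_support[OF assms] by blast
  have z: "f' x = (\<lambda>_. 0)" if "R < norm x" for x
  proof -
    have op: "open {x::'a. R < norm x}" by (intro open_Collect_less continuous_intros)
    have "(f has_derivative (\<lambda>_. 0)) (at x)"
      by (rule has_derivative_transform_within_open[OF has_derivative_const[of 0] op]) (use that R in auto)
    then show ?thesis using f' has_derivative_unique by blast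
  qed
  have "\<exists>B. \<forall>x. \<bar>f' x b\<bar> \<le> B" for b
  proof -
    have "compact ((\<lambda>x. f' x b) ` cball 0 R)"
      by (rule compact_continuous_image[OF continuous_on_subset[OF f'(2)]]) auto
    then have "bounded ((\<lambda>x. f' x b) ` cball 0 R)" by (rule compact_imp_bounded)
    then obtain B where B: "\<forall>x\<in>cball 0 R. \<bar>f' x b\<bar> \<le> B" unfolding bounded_iff by auto
    have "\<bar>f' x b\<bar> \<le> max B 0" for x
    proof (cases "norm x \<le> R")
      case True
      then show ?thesis using B by (auto intro: max.coboundedI1)
    qed (simp add: z)
    then show ?thesis by blast
  qed
  then obtain B where B: "\<And>b x. \<bar>f' x b\<bar> \<le> B b" by metis
  have on: "onorm (f' x) \<le> (\<Sum>b\<in>Basis. B b)" for x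
  proof -
    have "onorm (f' x) \<le> (\<Sum>b\<in>Basis. norm (f' x b))"
      by (intro onorm_componentwise has_derivative_bounded_linear[OF f'(1)])
    also have "\<dots> \<le> (\<Sum>b\<in>Basis. B b)" using B by (intro sum_mono) auto
    finally show ?thesis .
  qed
  have "\<bar>f x - f y\<bar> \<le> (\<Sum>b\<in>Basis. B b) * norm (x - y)" for x y
    using differentiable_bound[of UNIV f f' "\<Sum>b\<in>Basis. B b" y x] f'(1) on
    by (auto simp: norm_minus_commute abs_minus_commute)
  then have "\<bar>f x - f y\<bar> \<le> (max (\<Sum>b\<in>Basis. B b) 1) * norm (x - y)" for x y
    by (rule order_trans[OF _ mult_right_mono]) auto
  then show ?thesis by (intro exI[of _ "max (\<Sum>b\<in>Basis. B b) 1"]) auto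
qed

section \<open>Finiteness of the energy of test functions\<close>

lemma ennreal_norm_powr_layer:
  fixes z :: "'a::euclidean_space"
  assumes "0 < a" "z \<noteq> 0"
  shows "ennreal (norm z powr (- a)) = (\<integral>\<^sup>+r. ennreal (a * r powr (- 1 - a)) * indicator {norm z<..} r \<partial>lborel)"
proof -
  have "(\<integral>\<^sup>+r. ennreal (a * r powr (- 1 - a)) * indicator {norm z<..} r \<partial>lborel)
      = (\<integral>\<^sup>+r. ennreal a * (ennreal (r powr (- 1 - a)) * indicator {norm z<..} r) \<partial>lborel)"
    using assms by (intro nn_integral_cong) (simp add: ennreal_mult mult_ac)
  also have "\<dots> = ennreal a * ennreal (norm z powr (- a) / a)"
    using assms by (simp add: nn_integral_cmult nn_integral_powr_tail)
  also have "\<dots> = ennreal (norm z powr (- a))" using assms by (simp add: ennreal_mult[symmetric])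
  finally show ?thesis by simp
qed

text \<open>A substitute for polar coordinates: the layer-cake formula reduces a radial integral to
  volumes of balls.\<close>

lemma nn_integral_norm_powr_layer:
  fixes S :: "'a::euclidean_space set"
  assumes a: "0 < a" and [measurable]: "S \<in> sets borel"
  shows "(\<integral>\<^sup>+z. ennreal (norm z powr (- a)) * indicator S z \<partial>lborel)
     = (\<integral>\<^sup>+r. ennreal (a * r powr (- 1 - a)) * emeasure lborel (S \<inter> ball 0 r) * indicator {0<..} r \<partial>lborel)"
proof -
  have "(\<integral>\<^sup>+z. ennreal (norm z powr (- a)) * indicator S z \<partial>lborel)
     = (\<integral>\<^sup>+z. \<integral>\<^sup>+r. ennreal (a * r powr (- 1 - a)) * indicator {norm z<..} r * indicator S z \<partial>lborel \<partial>lborel)"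
  proof (rule nn_integral_cong_nonzero)
    fix z :: 'a assume z: "z \<noteq> 0"
    show "ennreal (norm z powr (- a)) * indicator S z = (\<integral>\<^sup>+r. ennreal (a * r powr (- 1 - a)) * indicator {norm z<..} r * indicator S z \<partial>lborel)"
      unfolding ennreal_norm_powr_layer[OF a z] by (rule nn_integral_multc[symmetric]) measurable
  qed
  also have "\<dots> = (\<integral>\<^sup>+r. \<integral>\<^sup>+z. ennreal (a * r powr (- 1 - a)) * indicator {norm z<..} r * indicator S z \<partial>lborel \<partial>lborel)"
    by (rule lborel_pair.Fubini') (unfold indicator_def of_bool_def greaterThan_iff, measurable)
  also have "\<dots> = (\<integral>\<^sup>+r. ennreal (a * r powr (- 1 - a)) * emeasure lborel (S \<inter> ball 0 r) * indicator {0<..} r \<partial>lborel)"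
  proof (rule nn_integral_cong)
    fix r :: real
    show "(\<integral>\<^sup>+z. ennreal (a * r powr (- 1 - a)) * indicator {norm z<..} r * indicator S z \<partial>lborel)
      = ennreal (a * r powr (- 1 - a)) * emeasure lborel (S \<inter> ball 0 r) * indicator {0<..} r"
    proof (cases "0 < r")
      case True
      have "(\<integral>\<^sup>+z. ennreal (a * r powr (- 1 - a)) * indicator {norm z<..} r * indicator S z \<partial>lborel)
         = (\<integral>\<^sup>+z. ennreal (a * r powr (- 1 - a)) * indicator (S \<inter> ball 0 r) z \<partial>lborel)"
        by (intro nn_integral_cong) (auto simp: indicator_def)
      also have "\<dots> = ennreal (a * r powr (- 1 - a)) * emeasure lborel (S \<inter> ball 0 r)"
        by (rule nn_integral_cmult_indicator) simp
      finally show ?thesis using True by simp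
    next
      case False
      then have "\<not> norm z < r" for z :: 'a using norm_ge_zero[of z] by linarith
      with False show ?thesis by (simp add: indicator_def)
    qed
  qed
  finally show ?thesis .
qed

lemma nn_integral_norm_powr_ball:
  assumes "0 < a" "a < real DIM('a)"
  shows "(\<integral>\<^sup>+(z::'a::euclidean_space). ennreal (norm z powr (- a)) * indicator (ball 0 1) z \<partial>lborel) < \<infinity>"
proof -
  let ?v = "unit_ball_vol (real DIM('a))"
  have "(\<integral>\<^sup>+(z::'a). ennreal (norm z powr (- a)) * indicator (ball 0 1) z \<partial>lborel)
     = (\<integral>\<^sup>+r. ennreal (a * r powr (- 1 - a)) * emeasure lborel (ball (0::'a) 1 \<inter> ball 0 r) * indicator {0<..} r \<partial>lborel)"
    by (rule nn_integral_norm_powr_layer) (use assms in auto)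
  \<comment> \<open>Up to \<open>r = 1\<close> the volume grows like \<open>r powr N\<close>, beyond
    that it is constant. The factor \<open>(2 - r) powr (1 - 1)\<close> equals 1 on the open
    interval from 0 to 2 and brings the first part into the form of
    \<open>nn_integral_Beta_interval\<close>; the endpoint 2 leaves room for
    \<open>r = 1\<close>.\<close>
  also have "\<dots> \<le> (\<integral>\<^sup>+r. ennreal (a * ?v) * (ennreal (r powr (real DIM('a) - a - 1) * (2 - r) powr (1 - 1)) * indicator {0<..<2} r)
         + ennreal (a * ?v) * (ennreal (r powr (- 1 - a)) * indicator {1<..} r) \<partial>lborel)"
  proof (rule nn_integral_mono)
    fix r :: real
    show "ennreal (a * r powr (- 1 - a)) * emeasure lborel (ball (0::'a) 1 \<inter> ball 0 r) * indicator {0<..} r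
      \<le> ennreal (a * ?v) * (ennreal (r powr (real DIM('a) - a - 1) * (2 - r) powr (1 - 1)) * indicator {0<..<2} r)
         + ennreal (a * ?v) * (ennreal (r powr (- 1 - a)) * indicator {1<..} r)"
    proof (cases "0 < r")
      case True
      show ?thesis
      proof (cases "r \<le> 1")
        case le: True
        have "ennreal (a * r powr (- 1 - a)) * emeasure lborel (ball (0::'a) 1 \<inter> ball 0 r) \<le> ennreal (a * r powr (- 1 - a)) * emeasure lborel (ball (0::'a) r)"
          by (intro mult_left_mono emeasure_mono) auto
        also have "\<dots> = ennreal (a * r powr (- 1 - a) * (?v * r powr real DIM('a)))"
          using True assms by (simp add: emeasure_ball ennreal_mult powr_realpow)
        also have "a * r powr (- 1 - a) * (?v * r powr real DIM('a)) = a * ?v * r powr (real DIM('a) - a - 1)"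
          using True by (simp add: powr_add[symmetric] algebra_simps)
        finally show ?thesis using True le assms by (auto simp: indicator_def ennreal_mult)
      next
        case False
        have "ennreal (a * r powr (- 1 - a)) * emeasure lborel (ball (0::'a) 1 \<inter> ball 0 r) \<le> ennreal (a * r powr (- 1 - a)) * emeasure lborel (ball (0::'a) 1)"
          by (intro mult_left_mono emeasure_mono) auto
        also have "\<dots> = ennreal (a * ?v) * ennreal (r powr (- 1 - a))"
          using True assms by (simp add: emeasure_ball ennreal_mult mult_ac)
        finally show ?thesis using True False by (simp add: add_increasing)
      qed
    qed simp
  qed
  also have "\<dots> = ennreal (a * ?v) * ennreal (2 powr (real DIM('a) - a + 1 - 1) * Beta (real DIM('a) - a) 1) + ennreal (a * ?v) * ennreal (1 powr (- a) / a)"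
    using assms nn_integral_Beta_interval[of "real DIM('a) - a" 1 2]
    by (subst nn_integral_add, measurable, subst nn_integral_cmult, measurable, subst nn_integral_cmult, measurable)
       (simp add: nn_integral_powr_tail)
  also have "\<dots> < \<infinity>" by (simp add: ennreal_mult_less_top)
  finally show ?thesis .
qed

lemma nn_integral_norm_powr_outside:
  assumes "real DIM('a) < a"
  shows "(\<integral>\<^sup>+(z::'a::euclidean_space). ennreal (norm z powr (- a)) * indicator (- ball 0 1) z \<partial>lborel) < \<infinity>"
proof -
  let ?v = "unit_ball_vol (real DIM('a))"
  have a: "0 < a" using assms by (rule le_less_trans[rotated]) simp
  have "(\<integral>\<^sup>+(z::'a). ennreal (norm z powr (- a)) * indicator (- ball 0 1) z \<partial>lborel)
     = (\<integral>\<^sup>+r. ennreal (a * r powr (- 1 - a)) * emeasure lborel (- ball (0::'a) 1 \<inter> ball 0 r) * indicator {0<..} r \<partial>lborel)"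
    by (rule nn_integral_norm_powr_layer) (use a in auto)
  also have "\<dots> \<le> (\<integral>\<^sup>+r. ennreal (a * ?v) * (ennreal (r powr (- 1 - (a - real DIM('a)))) * indicator {1<..} r) \<partial>lborel)"
  proof (rule nn_integral_mono)
    fix r :: real
    show "ennreal (a * r powr (- 1 - a)) * emeasure lborel (- ball (0::'a) 1 \<inter> ball 0 r) * indicator {0<..} r
      \<le> ennreal (a * ?v) * (ennreal (r powr (- 1 - (a - real DIM('a)))) * indicator {1<..} r)"
    proof (cases "1 < r")
      case True
      have "ennreal (a * r powr (- 1 - a)) * emeasure lborel (- ball (0::'a) 1 \<inter> ball 0 r) \<le> ennreal (a * r powr (- 1 - a)) * emeasure lborel (ball (0::'a) r)"
        by (intro mult_left_mono emeasure_mono) auto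
      also have "\<dots> = ennreal (a * r powr (- 1 - a) * (?v * r powr real DIM('a)))"
        using True a by (simp add: emeasure_ball ennreal_mult powr_realpow)
      also have "a * r powr (- 1 - a) * (?v * r powr real DIM('a)) = a * ?v * r powr (- 1 - (a - real DIM('a)))"
        using True by (simp add: powr_add[symmetric] algebra_simps)
      finally show ?thesis using True a by (auto simp: indicator_def ennreal_mult)
    next
      case False
      then have "- ball (0::'a) 1 \<inter> ball 0 r = {}" by auto
      then show ?thesis by simp
    qed
  qed
  also have "\<dots> = ennreal (a * ?v) * ennreal (1 powr (- (a - real DIM('a))) / (a - real DIM('a)))"
    using assms by (subst nn_integral_cmult) (measurable, subst nn_integral_powr_tail, auto)
  also have "\<dots> < \<infinity>" by (simp add: ennreal_mult_less_top)
  finally show ?thesis .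
qed

text \<open>Quadratic below distance 1, where differences are controlled by a Lipschitz or
  logarithmic bound, and growth of order \<open>d\<close> beyond. Bounded functions use
  \<open>d = 0\<close>, the logarithmic cut-offs \<open>d = 3 * s / 2\<close>; both stay below
  \<open>2 * s\<close>, as integrability at infinity demands.\<close>

definition levy_weight :: "real \<Rightarrow> real \<Rightarrow> 'a::euclidean_space \<Rightarrow> real" where
  "levy_weight s d z = (if norm z < 1 then (norm z)\<^sup>2 else norm z powr d) / norm z powr (real DIM('a) + 2 * s)"

lemma levy_weight_measurable [measurable]: "levy_weight s d \<in> borel_measurable borel"
  unfolding levy_weight_def[abs_def] by measurable

lemma levy_weight_nonneg [simp]: "0 \<le> levy_weight s d z"
  by (simp add: levy_weight_def)

lemma nn_integral_levy_weight_finite: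
  fixes s d :: real
  assumes s: "0 < s" "s < 1" and d: "d < 2 * s"
  shows "(\<integral>\<^sup>+(z::'a::euclidean_space). ennreal (levy_weight s d z) \<partial>lborel) < \<infinity>"
proof -
  let ?N = "real DIM('a)"
  \<comment> \<open>The singularity at the origin has order \<open>N + 2 s - 2\<close>, which need
    not be positive; the maximum with \<open>N / 2\<close> is an order strictly between 0 and
    \<open>N\<close> that dominates it on the unit ball.\<close>
  define a where "a = max (?N / 2) (?N + 2 * s - 2)"
  have N1: "1 \<le> ?N" by (simp add: Suc_leI)
  have a: "0 < a" "a < ?N" using s N1 unfolding a_def by (simp_all add: less_max_iff_disj)
  have le: "ennreal (levy_weight s d z)
     \<le> ennreal (norm z powr (- a)) * indicator (ball 0 1) z + ennreal (norm z powr (- (?N + 2 * s - d))) * indicator (- ball 0 1) z" for z :: 'a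
  proof (cases "norm z < 1")
    case True
    have "levy_weight s d z \<le> norm z powr (- a)"
    proof (cases "z = 0")
      case False
      have "levy_weight s d z = norm z powr 2 / norm z powr (?N + 2 * s)"
        using True False by (simp add: levy_weight_def)
      also have "\<dots> = norm z powr (2 - (?N + 2 * s))" by (rule powr_diff[symmetric])
      also have "\<dots> \<le> norm z powr (- a)"
        using True False by (intro powr_mono') (auto simp: a_def)
      finally show ?thesis .
    qed (simp add: levy_weight_def)
    then show ?thesis using True by (simp add: ennreal_leI)
  next
    case False
    then have "levy_weight s d z = norm z powr (d - (?N + 2 * s))"
      by (simp add: levy_weight_def powr_diff)
    also have "d - (?N + 2 * s) = - (?N + 2 * s - d)" by simp
    finally show ?thesis using False by simp
  qed
  have "(\<integral>\<^sup>+(z::'a). ennreal (levy_weight s d z) \<partial>lborel)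
    \<le> (\<integral>\<^sup>+(z::'a). ennreal (norm z powr (- a)) * indicator (ball 0 1) z + ennreal (norm z powr (- (?N + 2 * s - d))) * indicator (- ball 0 1) z \<partial>lborel)"
    by (intro nn_integral_mono le)
  also have "\<dots> = (\<integral>\<^sup>+(z::'a). ennreal (norm z powr (- a)) * indicator (ball 0 1) z \<partial>lborel)
      + (\<integral>\<^sup>+(z::'a). ennreal (norm z powr (- (?N + 2 * s - d))) * indicator (- ball 0 1) z \<partial>lborel)"
    by (rule nn_integral_add) (use borel_open[OF open_ball] in measurable)
  also have "\<dots> < \<infinity>"
  proof -
    have "?N < ?N + 2 * s - d" using d by simp
    from nn_integral_norm_powr_ball[OF a] nn_integral_norm_powr_outside[OF this] show ?thesis
      by (simp only: infinity_ennreal_def ennreal_add_less_top)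
  qed
  finally show ?thesis .
qed

text \<open>The difference \<open>u x - u y\<close> vanishes unless one of the points lies in the
  support ball. The Lipschitz bound serves short distances and the sup bound long ones, so the
  integrand is at most \<open>C * levy_weight s 0 (x - y)\<close>; integrating first over the
  unrestricted point leaves the volume of the ball.\<close>

lemma gagliardo_Lipschitz_finite:
  fixes u :: "'a::euclidean_space \<Rightarrow> real"
  assumes s: "0 < s" "s < 1" and [measurable]: "u \<in> borel_measurable borel"
    and L: "\<And>x y. \<bar>u x - u y\<bar> \<le> L * norm (x - y)" and B: "\<And>x. \<bar>u x\<bar> \<le> B"
    and R: "\<And>x. R < norm x \<Longrightarrow> u x = 0"
  shows "gagliardo s u < \<infinity>"
proof -
  let ?N = "real DIM('a)"
  define C where "C = L\<^sup>2 + 4 * B\<^sup>2"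
  let ?i = "indicator (cball 0 R) :: 'a \<Rightarrow> ennreal"
  have C: "0 \<le> C" by (simp add: C_def)
  have pt: "ennreal ((u x - u y)\<^sup>2 / norm (x - y) powr (?N + 2 * s)) \<le> ennreal C * (ennreal (levy_weight s 0 (x - y)) * ?i x) + ennreal C * (ennreal (levy_weight s 0 (x - y)) * ?i y)" for x y
  proof (cases "norm x \<le> R \<or> norm y \<le> R")
    case True
    have "(u x - u y)\<^sup>2 \<le> L\<^sup>2 * (norm (x - y))\<^sup>2"
      using power_mono[OF L[of x y], of 2] by (simp add: power_mult_distrib)
    also have "\<dots> \<le> C * (norm (x - y))\<^sup>2" by (intro mult_right_mono) (auto simp: C_def)
    finally have 1: "(u x - u y)\<^sup>2 \<le> C * (norm (x - y))\<^sup>2" .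
    have "\<bar>u x - u y\<bar> \<le> 2 * B" using B[of x] B[of y] by linarith
    from power_mono[OF this, of 2] have "(u x - u y)\<^sup>2 \<le> 4 * B\<^sup>2" by (simp add: power_mult_distrib)
    also have "\<dots> \<le> C" by (simp add: C_def)
    finally have "(u x - u y)\<^sup>2 \<le> C" .
    with 1 have "(u x - u y)\<^sup>2 / norm (x - y) powr (?N + 2 * s) \<le> C * levy_weight s 0 (x - y)"
      unfolding levy_weight_def times_divide_eq_right by (intro divide_right_mono) auto
    then have "ennreal ((u x - u y)\<^sup>2 / norm (x - y) powr (?N + 2 * s)) \<le> ennreal C * ennreal (levy_weight s 0 (x - y))"
      using C by (simp add: ennreal_mult[symmetric] ennreal_leI)
    then show ?thesis using True by (auto simp: indicator_def intro: add_increasing add_increasing2)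
  next
    case False
    then show ?thesis using R[of x] R[of y] by simp
  qed
  have [measurable]: "cball (0::'a) R \<in> sets borel" by simp
  have [measurable]: "(\<lambda>(x, y). ennreal (levy_weight s 0 (x - y))) \<in> borel_measurable ((borel :: 'a measure) \<Otimes>\<^sub>M borel)" by measurable
  have k: "(\<integral>\<^sup>+y. ennreal (levy_weight s 0 (x - y)) \<partial>lborel) = (\<integral>\<^sup>+(z::'a). ennreal (levy_weight s 0 z) \<partial>lborel)" for x :: 'a
    by (rule nn_integral_lborel_reflect) measurable
  have sym: "levy_weight s 0 (x - y) = levy_weight s 0 (y - x)" for x y :: 'a
    by (simp add: levy_weight_def norm_minus_commute)
  let ?J = "\<integral>\<^sup>+(z::'a). ennreal (levy_weight s 0 z) \<partial>lborel"
  have i1: "(\<integral>\<^sup>+x. \<integral>\<^sup>+y. ennreal C * (ennreal (levy_weight s 0 (x - y)) * ?i x) \<partial>lborel \<partial>lborel) = ennreal C * (?J * emeasure lborel (cball (0::'a) R))"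
  proof -
    have "(\<integral>\<^sup>+y. ennreal C * (ennreal (levy_weight s 0 (x - y)) * ?i x) \<partial>lborel) = ennreal C * ?J * ?i x" for x
      by (subst nn_integral_cmult, measurable, subst nn_integral_multc, measurable, simp only: k mult.assoc)
    then show ?thesis by (simp only:) (subst nn_integral_cmult_indicator, simp_all add: mult.assoc)
  qed
  have i2: "(\<integral>\<^sup>+x. \<integral>\<^sup>+y. ennreal C * (ennreal (levy_weight s 0 (x - y)) * ?i y) \<partial>lborel \<partial>lborel) = ennreal C * (?J * emeasure lborel (cball (0::'a) R))"
  proof -
    have "(\<integral>\<^sup>+x. \<integral>\<^sup>+y. ennreal C * (ennreal (levy_weight s 0 (x - y)) * ?i y) \<partial>lborel \<partial>lborel) = (\<integral>\<^sup>+y. \<integral>\<^sup>+x. ennreal C * (ennreal (levy_weight s 0 (x - y)) * ?i y) \<partial>lborel \<partial>lborel)"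
      by (rule lborel_pair.Fubini') measurable
    also have "\<dots> = ennreal C * (?J * emeasure lborel (cball (0::'a) R))" by (subst sym) (rule i1)
    finally show ?thesis .
  qed
  have "gagliardo s u \<le> (\<integral>\<^sup>+x. \<integral>\<^sup>+y. ennreal C * (ennreal (levy_weight s 0 (x - y)) * ?i x) + ennreal C * (ennreal (levy_weight s 0 (x - y)) * ?i y) \<partial>lborel \<partial>lborel)"
    unfolding gagliardo_def by (intro nn_integral_mono pt)
  also have "\<dots> = (\<integral>\<^sup>+x. (\<integral>\<^sup>+y. ennreal C * (ennreal (levy_weight s 0 (x - y)) * ?i x) \<partial>lborel) + (\<integral>\<^sup>+y. ennreal C * (ennreal (levy_weight s 0 (x - y)) * ?i y) \<partial>lborel) \<partial>lborel)"
    by (rule nn_integral_cong, rule nn_integral_add) measurable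
  also have "\<dots> = ennreal C * (?J * emeasure lborel (cball (0::'a) R)) + ennreal C * (?J * emeasure lborel (cball (0::'a) R))"
    by (rule trans[OF nn_integral_add], measurable, measurable, simp only: i1 i2)
  also have "\<dots> < \<infinity>"
  proof -
    have "?J < \<infinity>" by (rule nn_integral_levy_weight_finite) (use s in auto)
    moreover have "emeasure lborel (cball (0::'a) R) < \<infinity>" by (rule emeasure_bounded_finite) simp
    ultimately show ?thesis by (simp add: ennreal_mult_less_top)
  qed
  finally show ?thesis .
qed

lemma gagliardo_Cc_infty_finite:
  assumes "0 < s" "s < 1" "u \<in> Cc_infty"
  shows "gagliardo s u < \<infinity>"
proof -
  obtain R where R: "\<And>x. R < norm x \<Longrightarrow> u x = 0" using Cc_infty_support[OF assms(3)] by blast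
  obtain B where B: "\<And>x. \<bar>u x\<bar> \<le> B" using Cc_infty_bounded[OF assms(3)] by blast
  obtain L where L: "\<And>x y. \<bar>u x - u y\<bar> \<le> L * norm (x - y)" using Cc_infty_Lipschitz[OF assms(3)] by metis
  show ?thesis
    by (rule gagliardo_Lipschitz_finite[OF assms(1,2) Cc_infty_borel_measurable[OF assms(3)] L B R])
qed

lemma nn_integral_Cc_infty_powr_finite:
  fixes u :: "'a::euclidean_space \<Rightarrow> real"
  assumes "u \<in> Cc_infty" "0 \<le> p"
  shows "(\<integral>\<^sup>+x. ennreal (\<bar>u x\<bar> powr p) \<partial>lborel) < \<infinity>"
proof -
  obtain R where R: "\<And>x. R < norm x \<Longrightarrow> u x = 0" using Cc_infty_support[OF assms(1)] by blast
  obtain B where B: "\<And>x. \<bar>u x\<bar> \<le> B" using Cc_infty_bounded[OF assms(1)] by blast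
  have "(\<integral>\<^sup>+x. ennreal (\<bar>u x\<bar> powr p) \<partial>lborel) \<le> (\<integral>\<^sup>+x. ennreal (B powr p) * indicator (cball (0::'a) R) x \<partial>lborel)"
  proof (rule nn_integral_mono)
    fix x
    show "ennreal (\<bar>u x\<bar> powr p) \<le> ennreal (B powr p) * indicator (cball (0::'a) R) x"
      using R[of x] B[of x] assms(2) by (cases "norm x \<le> R") (auto intro!: ennreal_leI powr_mono2)
  qed
  also have "\<dots> = ennreal (B powr p) * emeasure lborel (cball (0::'a) R)" by (rule nn_integral_cmult_indicator) simp
  also have "\<dots> < \<infinity>"
    using emeasure_bounded_finite[of "cball (0::'a) R"] by (simp add: ennreal_mult_less_top)
  finally show ?thesis .
qed

section \<open>The fractional Sobolev inequality\<close>

lemma ennreal_affine3: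
  assumes "0 \<le> a" "0 \<le> b" "0 \<le> c" "0 \<le> d" "0 \<le> e"
  shows "ennreal (a * b + (c + d * e)) = ennreal a * ennreal b + (ennreal c + ennreal d * ennreal e)"
  using assms by (simp add: ennreal_plus ennreal_mult)

text \<open>
  Compare \<open>u x\<close> with its mean over the ball of radius \<open>r\<close> about \<open>x\<close>.  The radius with
  \<open>r powr N\<close> proportional to \<open>I / \<bar>u x\<bar> powr p\<close> lets the contribution of the mean be absorbed.
\<close>

lemma sobolev_pointwise:
  fixes u :: "'a::euclidean_space \<Rightarrow> real" and x :: 'a
  assumes s: "0 < s" and N: "2 * s < real DIM('a)"
    and u[measurable]: "u \<in> borel_measurable borel"
    and I: "(\<integral>\<^sup>+y. ennreal (\<bar>u y\<bar> powr p) \<partial>lborel) = ennreal I" "0 < I"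
    and D: "(\<integral>\<^sup>+y. ennreal ((u x - u y)\<^sup>2 / norm (x - y) powr (real DIM('a) + 2 * s)) \<partial>lborel) = ennreal D" "0 \<le> D"
    and p: "p = 2 * real DIM('a) / (real DIM('a) - 2 * s)"
    and v: "v = unit_ball_vol (real DIM('a))"
  shows "\<bar>u x\<bar> powr p \<le> 4 / v * (8 powr (p / 2) / v) powr (2 * s / real DIM('a)) * I powr (2 * s / real DIM('a)) * D"
proof (cases "u x = 0")
  case False
  define N where "N = real DIM('a)"
  have N0: "0 < N" "2 * s < N" using N by (simp_all add: N_def)
  have v0: "0 < v" unfolding v by simp
  have p2: "2 < p" using s N0 by (simp add: p N_def[symmetric] field_simps)
  define c where "c = 8 powr (p / 2) / v"
  have c0: "0 < c" using v0 by (simp add: c_def)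
  define a where "a = \<bar>u x\<bar>"
  have a0: "0 < a" using False by (simp add: a_def)
  have ux: "(u x)\<^sup>2 = a\<^sup>2" by (simp add: a_def)
  \<comment> \<open>\<open>k\<close> and the ball size \<open>M = r powr N\<close> are matched so
    that each of the two terms coming from \<open>(u y)\<^sup>2\<close> equals a quarter of the
    left-hand side; half of it remains to be bounded by the energy term.\<close>
  define k where "k = a\<^sup>2 / 8"
  have k0: "0 < k" using a0 by (simp add: k_def)
  define M where "M = c * I * a powr (- p)"
  have M0: "0 < M" using c0 I a0 by (simp add: M_def)
  define r where "r = M powr (1 / N)"
  have r0: "0 < r" using M0 by (simp add: r_def)
  have rN: "r powr N = M" using M0 N0 by (simp add: r_def powr_powr)
  have rN': "r ^ DIM('a) = M" using rN r0 by (simp add: N_def powr_realpow)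
  have young: "t\<^sup>2 \<le> k + k powr (1 - p / 2) * \<bar>t\<bar> powr p" for t :: real
  proof (cases "t\<^sup>2 \<le> k")
    case False
    then have t: "k < t\<^sup>2" "0 < t\<^sup>2" using k0 by auto
    have "t\<^sup>2 = (t\<^sup>2) powr (1 - p / 2) * (t\<^sup>2) powr (p / 2)"
      using t by (simp add: powr_add[symmetric])
    also have "(t\<^sup>2) powr (p / 2) = \<bar>t\<bar> powr p"
    proof -
      have "t\<^sup>2 = \<bar>t\<bar> powr 2" using t by simp
      then show ?thesis by (simp only: powr_powr) simp
    qed
    also have "(t\<^sup>2) powr (1 - p / 2) * \<bar>t\<bar> powr p \<le> k powr (1 - p / 2) * \<bar>t\<bar> powr p"
      using t k0 p2 by (intro mult_right_mono powr_mono2') auto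
    finally show ?thesis using k0 by linarith
  qed (simp add: add_increasing2)
  have pt: "ennreal (a\<^sup>2) * indicator (ball x r) y
     \<le> ennreal (2 * r powr (N + 2 * s)) * ennreal ((u x - u y)\<^sup>2 / norm (x - y) powr (real DIM('a) + 2 * s))
       + (ennreal (2 * k) * indicator (ball x r) y + ennreal (2 * k powr (1 - p / 2)) * ennreal (\<bar>u y\<bar> powr p))" for y
  proof (cases "y \<in> ball x r")
    case True
    have "(u x)\<^sup>2 \<le> 2 * (u x - u y)\<^sup>2 + 2 * (u y)\<^sup>2"
      using sum_squares_bound[of "u x - 2 * u y" 0] by (simp add: power2_eq_square algebra_simps)
    then have 1: "a\<^sup>2 \<le> 2 * (u x - u y)\<^sup>2 + 2 * (u y)\<^sup>2" by (simp only: ux)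
    have 2: "(u x - u y)\<^sup>2 \<le> r powr (N + 2 * s) * ((u x - u y)\<^sup>2 / norm (x - y) powr (real DIM('a) + 2 * s))"
    proof (cases "x = y")
      case False
      then have n: "0 < norm (x - y)" by simp
      have "norm (x - y) powr (N + 2 * s) \<le> r powr (N + 2 * s)"
        using True N0 s by (intro powr_mono2) (auto simp: dist_norm)
      then have "(u x - u y)\<^sup>2 * norm (x - y) powr (N + 2 * s) \<le> (u x - u y)\<^sup>2 * r powr (N + 2 * s)"
        by (rule mult_left_mono) simp
      then show ?thesis using n by (simp add: N_def field_simps)
    qed simp
    have "a\<^sup>2 \<le> 2 * r powr (N + 2 * s) * ((u x - u y)\<^sup>2 / norm (x - y) powr (real DIM('a) + 2 * s)) + (2 * k + 2 * k powr (1 - p / 2) * \<bar>u y\<bar> powr p)"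
      using 1 2 young[of "u y"] by linarith
    from ennreal_leI[OF this] show ?thesis
      using True k0 by (subst (asm) ennreal_affine3) (auto simp del: ennreal_plus)
  qed simp
  have "ennreal (a\<^sup>2) * emeasure lborel (ball x r) = (\<integral>\<^sup>+y. ennreal (a\<^sup>2) * indicator (ball x r) y \<partial>lborel)"
    by (rule nn_integral_cmult_indicator[symmetric]) simp
  also have "\<dots> \<le> (\<integral>\<^sup>+y. ennreal (2 * r powr (N + 2 * s)) * ennreal ((u x - u y)\<^sup>2 / norm (x - y) powr (real DIM('a) + 2 * s))
       + (ennreal (2 * k) * indicator (ball x r) y + ennreal (2 * k powr (1 - p / 2)) * ennreal (\<bar>u y\<bar> powr p)) \<partial>lborel)"
    by (rule nn_integral_mono) (rule pt)
  also have "\<dots> = (\<integral>\<^sup>+y. ennreal (2 * r powr (N + 2 * s)) * ennreal ((u x - u y)\<^sup>2 / norm (x - y) powr (real DIM('a) + 2 * s)) \<partial>lborel)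
       + ((\<integral>\<^sup>+y. ennreal (2 * k) * indicator (ball x r) y \<partial>lborel) + (\<integral>\<^sup>+y. ennreal (2 * k powr (1 - p / 2)) * ennreal (\<bar>u y\<bar> powr p) \<partial>lborel))"
    by (rule nn_integral_add3) (use borel_open[OF open_ball[of x r]] in measurable)
  also have "\<dots> = ennreal (2 * r powr (N + 2 * s)) * ennreal D + (ennreal (2 * k) * emeasure lborel (ball x r) + ennreal (2 * k powr (1 - p / 2)) * ennreal I)"
  proof -
    have "(\<integral>\<^sup>+y. ennreal (2 * r powr (N + 2 * s)) * ennreal ((u x - u y)\<^sup>2 / norm (x - y) powr (real DIM('a) + 2 * s)) \<partial>lborel)
      = ennreal (2 * r powr (N + 2 * s)) * ennreal D"
      unfolding D(1)[symmetric] by (rule nn_integral_cmult) measurable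
    moreover have "(\<integral>\<^sup>+y. ennreal (2 * k) * indicator (ball x r) y \<partial>lborel) = ennreal (2 * k) * emeasure lborel (ball x r)"
      by (rule nn_integral_cmult_indicator) simp
    moreover have "(\<integral>\<^sup>+y. ennreal (2 * k powr (1 - p / 2)) * ennreal (\<bar>u y\<bar> powr p) \<partial>lborel) = ennreal (2 * k powr (1 - p / 2)) * ennreal I"
      unfolding I(1)[symmetric] by (rule nn_integral_cmult) measurable
    ultimately show ?thesis by (simp only:)
  qed
  also have "emeasure lborel (ball x r) = ennreal (v * M)" using r0 by (simp add: emeasure_ball v rN')
  also have "ennreal (2 * r powr (N + 2 * s)) * ennreal D + (ennreal (2 * k) * ennreal (v * M) + ennreal (2 * k powr (1 - p / 2)) * ennreal I)
      = ennreal (2 * r powr (N + 2 * s) * D + (2 * k * (v * M) + 2 * k powr (1 - p / 2) * I))"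
    using k0 v0 M0 D(2) I(2) by (subst ennreal_affine3) (auto simp: ennreal_mult simp del: ennreal_plus)
  also have "ennreal (a\<^sup>2) * ennreal (v * M) = ennreal (a\<^sup>2 * (v * M))"
    using v0 M0 by (simp add: ennreal_mult)
  finally have "ennreal (a\<^sup>2 * (v * M)) \<le> ennreal (2 * r powr (N + 2 * s) * D + (2 * k * (v * M) + 2 * k powr (1 - p / 2) * I))" .
  moreover have "0 \<le> 2 * r powr (N + 2 * s) * D + (2 * k * (v * M) + 2 * k powr (1 - p / 2) * I)"
    using k0 v0 M0 D(2) I(2) by auto
  ultimately have main: "a\<^sup>2 * (v * M) \<le> 2 * r powr (N + 2 * s) * D + (2 * k * (v * M) + 2 * k powr (1 - p / 2) * I)"
    by (simp add: ennreal_le_iff)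
  have e1: "2 * k * (v * M) = a\<^sup>2 * (v * M) / 4" by (simp add: k_def)
  have e2: "2 * k powr (1 - p / 2) * I = a\<^sup>2 * (v * M) / 4"
  proof -
    have "k powr (1 - p / 2) = a powr (2 - p) * 8 powr (p / 2 - 1)"
    proof -
      have "k powr (1 - p / 2) = (a powr 2) powr (1 - p / 2) / 8 powr (1 - p / 2)"
        using a0 by (simp add: k_def powr_divide)
      also have "(a powr 2) powr (1 - p / 2) = a powr (2 - p)" by (simp add: powr_powr algebra_simps)
      also have "a powr (2 - p) / 8 powr (1 - p / 2) = a powr (2 - p) * 8 powr (p / 2 - 1)"
        using powr_minus_divide[of 8 "1 - p / 2"] by simp
      finally show ?thesis .
    qed
    moreover have "a powr (2 - p) = a\<^sup>2 * a powr (- p)" using a0 powr_add[of a 2 "- p"] by simp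
    moreover have "8 powr (p / 2 - 1) = 8 powr (p / 2) / (8::real)" by (simp add: powr_diff)
    ultimately have "k powr (1 - p / 2) = a\<^sup>2 * a powr (- p) * (8 powr (p / 2) / 8)" by (simp only:)
    then show ?thesis using v0 by (simp add: M_def c_def mult_ac)
  qed
  have "a\<^sup>2 * (v * M) / 2 \<le> 2 * r powr (N + 2 * s) * D"
    using main e1 e2 by linarith
  moreover have "r powr (N + 2 * s) = M * r powr (2 * s)" by (simp add: powr_add rN)
  ultimately have "(v * M) * (a\<^sup>2) \<le> (v * M) * (4 / v * r powr (2 * s) * D)"
    using v0 by (simp add: mult_ac)
  then have a2: "a\<^sup>2 \<le> 4 / v * r powr (2 * s) * D"
    using v0 M0 by (simp only: mult_le_cancel_left_pos mult_pos_pos)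
  have r2s: "r powr (2 * s) = c powr (2 * s / N) * I powr (2 * s / N) * a powr (- p * (2 * s / N))"
    using c0 I a0 by (simp add: r_def M_def powr_powr powr_mult)
  have "p = 2 + p * (2 * s / N)" using N0 by (simp add: p N_def[symmetric] field_simps)
  then have "a powr p = a powr 2 * a powr (p * (2 * s / N))" by (metis powr_add)
  also have "\<dots> = a\<^sup>2 * a powr (p * (2 * s / N))" using a0 by simp
  also have "\<dots> \<le> 4 / v * r powr (2 * s) * D * a powr (p * (2 * s / N))"
    by (rule mult_right_mono[OF a2]) simp
  also have "\<dots> = 4 / v * c powr (2 * s / N) * I powr (2 * s / N) * D * (a powr (- p * (2 * s / N)) * a powr (p * (2 * s / N)))"
    unfolding r2s by (simp only: mult_ac)
  also have "a powr (- p * (2 * s / N)) * a powr (p * (2 * s / N)) = 1"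
    using a0 by (simp add: powr_add[symmetric])
  finally show ?thesis by (simp add: a_def c_def N_def)
qed (use D v in auto)

text \<open>The pointwise bound still contains the factor \<open>I powr (2 s / N)\<close>. After
  integration it is divided out, which is possible because \<open>I\<close> is finite and
  positive.\<close>

theorem fractional_sobolev:
  fixes u :: "'a::euclidean_space \<Rightarrow> real"
  assumes s: "0 < s" and N: "2 * s < real DIM('a)"
    and u[measurable]: "u \<in> borel_measurable borel"
    and p: "p = 2 * real DIM('a) / (real DIM('a) - 2 * s)"
    and I: "(\<integral>\<^sup>+y. ennreal (\<bar>u y\<bar> powr p) \<partial>lborel) = ennreal I" "0 < I"
    and v: "v = unit_ball_vol (real DIM('a))"
  shows "ennreal (I powr (1 - 2 * s / real DIM('a))) \<le> ennreal (4 / v * (8 powr (p / 2) / v) powr (2 * s / real DIM('a))) * gagliardo s u"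
proof (cases "gagliardo s u = top")
  case False
  define K where "K = 4 / v * (8 powr (p / 2) / v) powr (2 * s / real DIM('a))"
  let ?q = "2 * s / real DIM('a)"
  have v0: "0 < v" unfolding v by simp
  have K0: "0 < K" using v0 by (simp add: K_def)
  let ?D = "\<lambda>x. \<integral>\<^sup>+y. ennreal ((u x - u y)\<^sup>2 / norm (x - y) powr (real DIM('a) + 2 * s)) \<partial>lborel"
  have le: "ennreal (\<bar>u x\<bar> powr p) \<le> ennreal (K * I powr ?q) * ?D x" for x
  proof (cases "?D x = top")
    case True
    then show ?thesis using K0 I by (simp add: ennreal_mult_top)
  next
    case False
    then obtain d where d: "?D x = ennreal d" "0 \<le> d" by (cases "?D x") auto
    have "\<bar>u x\<bar> powr p \<le> K * I powr ?q * d"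
      unfolding K_def by (rule sobolev_pointwise[OF s N u I d p v])
    then show ?thesis unfolding d(1) using K0 d(2) by (simp add: ennreal_mult[symmetric] ennreal_leI)
  qed
  have "ennreal I \<le> ennreal (K * I powr ?q) * gagliardo s u"
    unfolding I(1)[symmetric] gagliardo_def
    by (subst nn_integral_cmult[symmetric]) (measurable, intro nn_integral_mono le)
  then have "ennreal (I powr (- ?q)) * ennreal I \<le> ennreal (I powr (- ?q)) * (ennreal (K * I powr ?q) * gagliardo s u)"
    by (rule mult_left_mono) simp
  moreover have "ennreal (I powr (- ?q)) * ennreal I = ennreal (I powr (1 - ?q))"
    using I(2) powr_mult_base[of I "- ?q"] by (simp add: ennreal_mult[symmetric] mult.commute)
  moreover have "ennreal (I powr (- ?q)) * (ennreal (K * I powr ?q) * gagliardo s u) = ennreal K * gagliardo s u"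
  proof -
    have "I powr (- ?q) * (K * I powr ?q) = K * (I powr (- ?q) * I powr ?q)" by simp
    also have "I powr (- ?q) * I powr ?q = 1" using I(2) by (simp add: powr_add[symmetric])
    finally have "I powr (- ?q) * (K * I powr ?q) = K" by simp
    moreover have "ennreal (I powr (- ?q)) * (ennreal (K * I powr ?q) * gagliardo s u) = ennreal (I powr (- ?q) * (K * I powr ?q)) * gagliardo s u"
      using K0 by (subst ennreal_mult) (auto simp: mult.assoc)
    ultimately show ?thesis by (simp only:)
  qed
  ultimately show ?thesis by (simp add: K_def)
next
  case True
  have "0 < v" unfolding v by simp
  then show ?thesis using True by (simp add: ennreal_mult_top)
qed

text \<open>A bound on the form of \<open>\<bar>V\<bar>\<close> relative to the energy without its
  constant \<open>C_const\<close>, tested on smooth functions; Fatou's lemma later extends it to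
  limits of such functions.\<close>

definition form_bdd :: "real \<Rightarrow> ('a::euclidean_space \<Rightarrow> real) \<Rightarrow> real \<Rightarrow> bool" where
  "form_bdd s V K \<longleftrightarrow> V \<in> borel_measurable borel \<and> 0 \<le> K \<and>
     (\<forall>u\<in>Cc_infty. (\<integral>\<^sup>+x. ennreal (\<bar>V x\<bar> * (u x)\<^sup>2) \<partial>lborel) \<le> ennreal K * gagliardo s u)"

text \<open>Hoelder's inequality combined with the Sobolev inequality. The constant is uniform in
  \<open>W\<close>, so a small \<open>L\<^sup>p\<close> norm forces a small form bound; the tails of
  the potentials use exactly this.\<close>

theorem form_bdd_Lp:
  assumes s: "0 < s" and N: "2 * s < real DIM('a)"
  shows "\<exists>K>0. \<forall>(W :: 'a::euclidean_space \<Rightarrow> real) w. W \<in> borel_measurable borel \<longrightarrow> 0 \<le> w \<longrightarrow>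
     (\<integral>\<^sup>+x. ennreal (\<bar>W x\<bar> powr (real DIM('a) / (2 * s))) \<partial>lborel) = ennreal w \<longrightarrow>
     form_bdd s W (K * w powr (2 * s / real DIM('a)))"
proof -
  let ?N = "real DIM('a)"
  define p where "p = 2 * ?N / (?N - 2 * s)"
  define v where "v = unit_ball_vol ?N"
  define K where "K = 4 / v * (8 powr (p / 2) / v) powr (2 * s / ?N)"
  define q where "q = 2 * s / ?N"
  have N0: "0 < ?N" by simp
  have v0: "0 < v" unfolding v_def by simp
  have K0: "0 < K" using v0 by (simp add: K_def)
  have q: "0 < q" "q < 1" using s N by (simp_all add: q_def)
  have p2: "2 < p" using s N by (simp add: p_def field_simps)
  have pq: "(p - 2) / 2 * (1 / q - 1) = 1" "p - 2 = 4 * s / (?N - 2 * s)"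
    using s N N0 by (simp_all add: p_def q_def field_simps)
  have Nq: "?N / (2 * s) = 1 / q" using s by (simp add: q_def)
  have main: "(\<integral>\<^sup>+x. ennreal (\<bar>W x\<bar> * (u x)\<^sup>2) \<partial>lborel) \<le> ennreal (2 * K * w powr q) * gagliardo s u"
    if W[measurable]: "W \<in> borel_measurable borel" and u: "u \<in> Cc_infty" and w: "0 \<le> w" "(\<integral>\<^sup>+x. ennreal (\<bar>W x\<bar> powr (1 / q)) \<partial>lborel) = ennreal w"
    for W u :: "'a \<Rightarrow> real" and w
  proof -
    have um[measurable]: "u \<in> borel_measurable borel" by (rule Cc_infty_borel_measurable[OF u])
    have "(\<integral>\<^sup>+x. ennreal (\<bar>u x\<bar> powr p) \<partial>lborel) < \<infinity>"
      using p2 by (intro nn_integral_Cc_infty_powr_finite u) auto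
    then obtain I where I: "(\<integral>\<^sup>+x. ennreal (\<bar>u x\<bar> powr p) \<partial>lborel) = ennreal I" "0 \<le> I"
      by (cases "\<integral>\<^sup>+x. ennreal (\<bar>u x\<bar> powr p) \<partial>lborel") auto
    consider "I = 0" | "w = 0" | "0 < I" "0 < w" using I(2) w(1) by fastforce
    then show ?thesis
    proof cases
      case 1
      then have "AE x in lborel. u x = 0"
        using I(1) by (simp add: nn_integral_0_iff_AE)
      then have "(\<integral>\<^sup>+x. ennreal (\<bar>W x\<bar> * (u x)\<^sup>2) \<partial>lborel) = 0"
        by (subst nn_integral_0_iff_AE) auto
      then show ?thesis by simp
    next
      case 2
      then have "AE x in lborel. W x = 0"
        using w(2) by (simp add: nn_integral_0_iff_AE)
      then have "(\<integral>\<^sup>+x. ennreal (\<bar>W x\<bar> * (u x)\<^sup>2) \<partial>lborel) = 0"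
        by (subst nn_integral_0_iff_AE) auto
      then show ?thesis by simp
    next
      case 3
      \<comment> \<open>The weight in Young's inequality that balances the two sides: after
        integration each term equals \<open>w powr q * I powr (1 - q)\<close>, which reproduces
        Hoelder's inequality up to a factor 2.\<close>
      define k where "k = (w / I) powr q"
      have k0: "0 < k" using 3 by (simp add: k_def)
      have young: "b * t\<^sup>2 \<le> k * \<bar>t\<bar> powr p + k powr (1 - 1 / q) * b powr (1 / q)" if b: "0 \<le> b" for b t :: real
      proof (cases "t = 0 \<or> b = 0")
        case True
        then show ?thesis using k0 by auto
      next
        case False
        then have t: "0 < \<bar>t\<bar>" and b: "0 < b" using b by auto
        show ?thesis
        proof (cases "b \<le> k * \<bar>t\<bar> powr (p - 2)")
          case True
          have "b * t\<^sup>2 \<le> k * \<bar>t\<bar> powr (p - 2) * t\<^sup>2" by (rule mult_right_mono[OF True]) simp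
          also have "t\<^sup>2 = \<bar>t\<bar> powr 2" using t by simp
          also have "k * \<bar>t\<bar> powr (p - 2) * \<bar>t\<bar> powr 2 = k * \<bar>t\<bar> powr p"
            by (simp only: mult.assoc powr_add[symmetric]) simp
          finally show ?thesis by (simp add: add_increasing2)
        next
          case False
          then have "\<bar>t\<bar> powr (p - 2) \<le> b / k" using k0 by (simp add: field_simps)
          then have "(\<bar>t\<bar> powr (p - 2)) powr (1 / q - 1) \<le> (b / k) powr (1 / q - 1)"
            using q by (intro powr_mono2) auto
          moreover have "(\<bar>t\<bar> powr (p - 2)) powr (1 / q - 1) = \<bar>t\<bar> powr 2"
          proof -
            have "(p - 2) * (1 / q - 1) = 2" using pq(1) by simp
            then show ?thesis by (simp only: powr_powr)
          qed
          ultimately have "t\<^sup>2 \<le> (b / k) powr (1 / q - 1)" using t by simp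
          then have "b * t\<^sup>2 \<le> b * (b / k) powr (1 / q - 1)" using b by (intro mult_left_mono) auto
          also have "(b / k) powr (1 / q - 1) = b powr (1 / q - 1) * k powr (1 - 1 / q)"
            using b k0 powr_minus_divide[of k "1 / q - 1"] by (simp add: powr_divide)
          also have "b * (b powr (1 / q - 1) * k powr (1 - 1 / q)) = k powr (1 - 1 / q) * b powr (1 / q)"
            using b powr_mult_base[of b "1 / q - 1"] by simp
          finally show ?thesis using k0 by (simp add: add_increasing)
        qed
      qed
      have "(\<integral>\<^sup>+x. ennreal (\<bar>W x\<bar> * (u x)\<^sup>2) \<partial>lborel) \<le> (\<integral>\<^sup>+x. ennreal k * ennreal (\<bar>u x\<bar> powr p) + ennreal (k powr (1 - 1 / q)) * ennreal (\<bar>W x\<bar> powr (1 / q)) \<partial>lborel)"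
      proof (rule nn_integral_mono)
        fix x
        from ennreal_leI[OF young[of "\<bar>W x\<bar>" "u x"]]
        show "ennreal (\<bar>W x\<bar> * (u x)\<^sup>2) \<le> ennreal k * ennreal (\<bar>u x\<bar> powr p) + ennreal (k powr (1 - 1 / q)) * ennreal (\<bar>W x\<bar> powr (1 / q))"
          using k0 by (simp add: ennreal_plus ennreal_mult)
      qed
      also have "\<dots> = ennreal k * ennreal I + ennreal (k powr (1 - 1 / q)) * ennreal w"
        by (subst nn_integral_add, measurable, subst nn_integral_cmult, measurable, subst nn_integral_cmult, measurable) (simp only: I w)
      also have "\<dots> = ennreal (2 * w powr q) * ennreal (I powr (1 - q))"
      proof -
        have 1: "k * I = w powr q * I powr (1 - q)"
          using 3 by (simp add: k_def powr_divide powr_diff)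
        have "k powr (1 - 1 / q) = (w / I) powr (q - 1)"
          using q by (simp add: k_def powr_powr algebra_simps)
        then have 2: "k powr (1 - 1 / q) * w = w powr q * I powr (1 - q)"
          using 3 by (simp add: powr_divide powr_diff)
        have "ennreal k * ennreal I + ennreal (k powr (1 - 1 / q)) * ennreal w = ennreal (k * I + k powr (1 - 1 / q) * w)"
          using 3 k0 by (simp add: ennreal_plus ennreal_mult)
        also have "\<dots> = ennreal (2 * w powr q * I powr (1 - q))" unfolding 1 2 by simp
        finally show ?thesis by (simp add: ennreal_mult)
      qed
      also have "\<dots> \<le> ennreal (2 * w powr q) * (ennreal K * gagliardo s u)"
        unfolding K_def q_def by (intro mult_left_mono fractional_sobolev[OF s N um p_def I(1) 3(1) v_def]) simp
      also have "\<dots> = ennreal (2 * K * w powr q) * gagliardo s u"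
      proof -
        have "ennreal (2 * K * w powr q) = ennreal (2 * w powr q) * ennreal K"
          using K0 by (subst ennreal_mult[symmetric]) (auto simp: mult_ac)
        then show ?thesis by (simp only: mult.assoc)
      qed
      finally show ?thesis .
    qed
  qed
  show ?thesis unfolding Nq q_def[symmetric] form_bdd_def
    by (intro exI[of _ "2 * K"] conjI allI impI ballI main) (use K0 in auto)
qed

section \<open>Localisation by slowly varying cut-offs\<close>

text \<open>
  The two cut-offs are the cosine and the sine of the angle \<open>arctan (e * log_radius x)\<close>.  The angle
  varies so slowly that the localisation error is \<open>O(e\<^sup>2)\<close> relative to the Hardy term.
\<close>

definition log_radius :: "'a::euclidean_space \<Rightarrow> real" where
  "log_radius x = ln (1 + (norm x)\<^sup>2)"

definition cut_near :: "real \<Rightarrow> 'a::euclidean_space \<Rightarrow> real" where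
  "cut_near e x = 1 / sqrt (1 + (e * log_radius x)\<^sup>2)"

definition cut_far :: "real \<Rightarrow> 'a::euclidean_space \<Rightarrow> real" where
  "cut_far e x = e * log_radius x / sqrt (1 + (e * log_radius x)\<^sup>2)"

lemma log_radius_nonneg [simp]: "0 \<le> log_radius x"
  by (simp add: log_radius_def)

lemma log_radius_mono: "norm x \<le> norm y \<Longrightarrow> log_radius x \<le> log_radius y"
  by (simp add: log_radius_def add_pos_nonneg)

lemma log_radius_measurable [measurable]: "log_radius \<in> borel_measurable borel"
  unfolding log_radius_def[abs_def] by measurable

lemma cut_near_measurable [measurable]: "cut_near e \<in> borel_measurable borel"
  unfolding cut_near_def[abs_def] by measurable

lemma cut_far_measurable [measurable]: "cut_far e \<in> borel_measurable borel"
  unfolding cut_far_def[abs_def] by measurable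

lemma C_k_log_radius: "C_k k (log_radius :: 'a::euclidean_space \<Rightarrow> real)"
proof -
  have "C_k k (\<lambda>x::'a. ln (1 + x \<bullet> x))"
    by (intro C_k_ln C_k_add C_k_const C_k_inner_self) (simp add: add_pos_nonneg)
  then show ?thesis by (simp add: log_radius_def[abs_def] power2_norm_eq_inner)
qed

lemma C_k_cut_near: "C_k k (cut_near e :: 'a::euclidean_space \<Rightarrow> real)"
proof -
  let ?g = "\<lambda>x::'a. 1 + (e * log_radius x) * (e * log_radius x)"
  have pos: "0 < ?g x" for x by (simp add: add_pos_nonneg)
  \<comment> \<open>The reciprocal root as an exponential of a logarithm, whose argument is at least
    1, so that the closure rules for \<open>C_k\<close> apply.\<close>
  have "C_k k (\<lambda>x. exp ((- 1 / 2) * ln (?g x)))"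
    by (intro C_k_exp C_k_mult C_k_ln C_k_add C_k_const C_k_log_radius pos)
  moreover have "exp ((- 1 / 2) * ln (?g x)) = cut_near e x" for x
  proof -
    have "exp ((- 1 / 2) * ln (?g x)) = ?g x powr (- (1 / 2))" using pos[of x] by (simp add: powr_def)
    also have "\<dots> = 1 / sqrt (?g x)" using pos[of x] by (simp add: powr_minus_divide powr_half_sqrt)
    finally show ?thesis by (simp add: cut_near_def power2_eq_square)
  qed
  ultimately show ?thesis by simp
qed

lemma C_k_cut_far: "C_k k (cut_far e :: 'a::euclidean_space \<Rightarrow> real)"
proof -
  have "C_k k (\<lambda>x::'a. (e * log_radius x) * cut_near e x)"
    by (intro C_k_mult C_k_const C_k_log_radius C_k_cut_near)
  then show ?thesis by (simp add: cut_far_def[abs_def] cut_near_def)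
qed

lemma cut_sum_squares: "(cut_near e x)\<^sup>2 + (cut_far e x)\<^sup>2 = 1"
proof -
  have "0 < 1 + (e * log_radius x)\<^sup>2" by (simp add: add_pos_nonneg)
  then show ?thesis
    by (simp add: cut_near_def cut_far_def power_divide add_divide_distrib[symmetric])
qed

text \<open>The pairs of cut-offs are points of the unit circle: a chord is at most the difference
  of the angles, and \<open>arctan\<close> is Lipschitz with constant 1.\<close>

lemma cut_diff_squares:
  "(cut_near e x - cut_near e y)\<^sup>2 + (cut_far e x - cut_far e y)\<^sup>2 \<le> e\<^sup>2 * (log_radius x - log_radius y)\<^sup>2"
proof -
  define p q where "p = arctan (e * log_radius x)" and "q = arctan (e * log_radius y)"
  have c: "cut_near e x = cos p" "cut_far e x = sin p" "cut_near e y = cos q" "cut_far e y = sin q"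
    by (simp_all add: cut_near_def cut_far_def p_def q_def cos_arctan sin_arctan)
  have "(cos p - cos q)\<^sup>2 + (sin p - sin q)\<^sup>2 = 2 - 2 * cos (p - q)"
    by (simp add: cos_diff power2_diff cos_squared_eq)
  also have "\<dots> = (2 * sin ((p - q) / 2))\<^sup>2"
  proof -
    have "p - q = 2 * ((p - q) / 2)" by simp
    then have "cos (p - q) = 1 - 2 * (sin ((p - q) / 2))\<^sup>2" by (metis cos_double_sin)
    then show ?thesis by (simp add: power_mult_distrib)
  qed
  also have "\<dots> \<le> (p - q)\<^sup>2"
  proof -
    have "\<bar>2 * sin ((p - q) / 2)\<bar> \<le> \<bar>p - q\<bar>"
      using abs_sin_x_le_abs_x[of "(p - q) / 2"] by simp
    then show ?thesis by (simp only: abs_le_square_iff)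
  qed
  also have "\<dots> \<le> (e * log_radius x - e * log_radius y)\<^sup>2"
  proof -
    have "\<bar>arctan a - arctan b\<bar> \<le> \<bar>a - b\<bar>" for a b :: real
    proof -
      have "norm (arctan a - arctan b) \<le> 1 * norm (a - b)"
      proof (rule field_differentiable_bound[of UNIV arctan "\<lambda>x. inverse (1 + x\<^sup>2)"])
        show "(arctan has_field_derivative inverse (1 + z\<^sup>2)) (at z within UNIV)" for z
          by (rule DERIV_arctan)
        show "norm (inverse (1 + z\<^sup>2)) \<le> 1" for z :: real
          by (simp add: inverse_le_1_iff)
      qed auto
      then show ?thesis by simp
    qed
    then show ?thesis unfolding p_def q_def abs_le_square_iff[symmetric] .
  qed
  also have "\<dots> = e\<^sup>2 * (log_radius x - log_radius y)\<^sup>2"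
    by (simp add: power_mult_distrib[symmetric] right_diff_distrib)
  finally show ?thesis by (simp only: c)
qed

text \<open>For \<open>norm x \<le> norm y\<close>, passing from the ratio of
  \<open>1 + (norm x)\<^sup>2\<close> and \<open>1 + (norm y)\<^sup>2\<close> to the ratio of the
  squared norms can only enlarge the logarithm. The bound depends on \<open>norm y / norm x\<close>
  alone; this scale invariance is what makes the localisation error a multiple of the Hardy
  weight.\<close>

lemma log_radius_diff_le:
  fixes x y :: "'a::euclidean_space"
  assumes "x \<noteq> 0" "y \<noteq> 0"
  shows "\<bar>log_radius x - log_radius y\<bar> \<le> 2 * \<bar>ln (norm y / norm x)\<bar>"
proof -
  have le: "\<bar>log_radius x - log_radius y\<bar> \<le> 2 * \<bar>ln (norm y / norm x)\<bar>"
    if "norm x \<le> norm y" "x \<noteq> 0" "y \<noteq> 0" for x y :: 'a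
  proof -
    have p: "0 < norm x" "0 < norm y" using that by auto
    have "(norm x)\<^sup>2 \<le> (norm y)\<^sup>2" using that by (intro power_mono) auto
    then have "(1 + (norm y)\<^sup>2) * (norm x)\<^sup>2 \<le> (1 + (norm x)\<^sup>2) * (norm y)\<^sup>2" by (simp add: algebra_simps)
    then have "(1 + (norm y)\<^sup>2) / (1 + (norm x)\<^sup>2) \<le> (norm y / norm x)\<^sup>2"
      using p by (simp add: power_divide divide_simps add_pos_nonneg mult.commute split: if_splits)
    then have "ln ((1 + (norm y)\<^sup>2) / (1 + (norm x)\<^sup>2)) \<le> ln ((norm y / norm x)\<^sup>2)"
      using p by (subst ln_le_cancel_iff) (auto intro!: divide_pos_pos add_pos_nonneg)
    also have "\<dots> = 2 * ln (norm y / norm x)" using p by (simp add: ln_realpow)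
    also have "ln ((1 + (norm y)\<^sup>2) / (1 + (norm x)\<^sup>2)) = log_radius y - log_radius x"
    proof -
      have "0 < 1 + (norm z)\<^sup>2" for z :: 'a by (simp add: add_pos_nonneg)
      from this[of x] this[of y] show ?thesis unfolding log_radius_def by (subst ln_div) auto
    qed
    finally have "log_radius y - log_radius x \<le> 2 * ln (norm y / norm x)" .
    moreover have "0 \<le> ln (norm y / norm x)" using p that by simp
    ultimately show ?thesis using log_radius_mono[OF that(1)] by simp
  qed
  show ?thesis
  proof (cases "norm x \<le> norm y")
    case False
    have "ln (norm x / norm y) = - ln (norm y / norm x)"
      using assms by (simp add: ln_div)
    then show ?thesis using le[of y x] assms False by (simp add: abs_minus_commute)
  qed (use le assms in auto)
qed

text \<open>For small \<open>q\<close> the logarithm is linear in \<open>q\<close> or bounded after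
  weighting, for \<open>r\<close> near 0 the weight \<open>r powr s\<close> absorbs it, and for
  large \<open>r\<close> it costs only \<open>r powr (s / 2)\<close> when squared. The resulting
  exponent \<open>3 * s / 2\<close> is still below \<open>2 * s\<close>.\<close>

lemma ln_powr_weight:
  fixes r q s :: real
  assumes s: "0 < s" "s < 1" and r: "0 < r" and q: "\<bar>r - 1\<bar> \<le> q"
  shows "(2 * ln r)\<^sup>2 * r powr s \<le> 256 / s\<^sup>2 * (if q < 1 then q\<^sup>2 else q powr (3 * s / 2))"
proof -
  have s2: "1 \<le> 1 / s\<^sup>2" using s by (simp add: power_le_one)
  have small: "(ln r)\<^sup>2 * r powr s \<le> 4 / s\<^sup>2" if "r < 1"
  proof -
    have "ln (1 / r) \<le> (1 / r) powr (s / 2) / (s / 2)" using that r s by (intro ln_powr_bound) auto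
    then have a: "- ln r \<le> 2 / s * r powr (- (s / 2))"
      using r s by (simp add: ln_div powr_divide powr_minus_divide mult.commute)
    have "(ln r)\<^sup>2 \<le> (2 / s * r powr (- (s / 2)))\<^sup>2"
      using power_mono[OF a, of 2] that r by simp
    also have "\<dots> = 4 / s\<^sup>2 * r powr (- s)"
    proof -
      have "(r powr (- (s / 2)))\<^sup>2 = r powr (- s)" by (simp add: power2_eq_square powr_add[symmetric])
      then show ?thesis by (simp add: power_mult_distrib power_divide)
    qed
    finally have "(ln r)\<^sup>2 * r powr s \<le> 4 / s\<^sup>2 * r powr (- s) * r powr s"
      by (rule mult_right_mono) simp
    also have "\<dots> = 4 / s\<^sup>2" using r by (simp add: powr_minus)
    finally show ?thesis .
  qed
  have sq: "(2 * ln r)\<^sup>2 * r powr s = 4 * ((ln r)\<^sup>2 * r powr s)" by (simp add: power_mult_distrib)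
  have q0: "0 \<le> q" using q by linarith
  consider "q < 1" "1 / 2 \<le> r" | "q < 1" "r < 1 / 2" | "1 \<le> q" "r < 1" | "1 \<le> q" "1 \<le> r" by linarith
  then show ?thesis
  proof cases
    case 1
    have "\<bar>ln r\<bar> \<le> 2 * q"
    proof (cases "1 \<le> r")
      case True
      then have "ln r \<le> r - 1" "0 \<le> ln r" using r by (auto intro: ln_le_minus_one)
      then show ?thesis using q by linarith
    next
      case False
      have "- ln r \<le> 1 / r - 1" using r ln_le_minus_one[of "1 / r"] by (simp add: ln_div)
      also have "\<dots> = (1 - r) / r" using r by (simp add: field_simps)
      also have "\<dots> \<le> (1 - r) / (1 / 2)" using 1 r False by (intro divide_left_mono) auto
      finally show ?thesis using False r q by (simp add: abs_if)
    qed
    then have "(ln r)\<^sup>2 \<le> (2 * q)\<^sup>2" by (metis abs_ge_zero power2_abs power_mono)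
    moreover have "r powr s \<le> 2"
    proof -
      have "r \<le> 2" using 1 q by linarith
      then have "r powr s \<le> 2 powr s" using s r by (intro powr_mono2) auto
      also have "\<dots> \<le> 2 powr 1" using s by (intro powr_mono) auto
      finally show ?thesis by simp
    qed
    ultimately have "(ln r)\<^sup>2 * r powr s \<le> (2 * q)\<^sup>2 * 2" by (intro mult_mono) auto
    moreover have "(2 * q)\<^sup>2 = 4 * q\<^sup>2" by (simp add: power_mult_distrib)
    ultimately have "4 * ((ln r)\<^sup>2 * r powr s) \<le> 32 * q\<^sup>2" by linarith
    then have "(2 * ln r)\<^sup>2 * r powr s \<le> 32 * q\<^sup>2" by (simp only: sq)
    also have "\<dots> \<le> 256 / s\<^sup>2 * q\<^sup>2"
      using s2 by (intro mult_right_mono) auto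
    finally show ?thesis using 1 by simp
  next
    case 2
    then have "1 / 2 \<le> q" using q by linarith
    then have "(1 / 2)\<^sup>2 \<le> q\<^sup>2" by (intro power_mono) auto
    then have q2: "1 \<le> 4 * q\<^sup>2" by (simp add: power2_eq_square)
    have "(2 * ln r)\<^sup>2 * r powr s \<le> 16 / s\<^sup>2 * 1" unfolding sq using small 2 by simp
    also have "\<dots> \<le> 16 / s\<^sup>2 * (4 * q\<^sup>2)" by (rule mult_left_mono[OF q2]) simp
    also have "\<dots> \<le> 256 / s\<^sup>2 * q\<^sup>2" using s by (simp add: divide_simps)
    finally show ?thesis using 2 by simp
  next
    case 3
    have "(2 * ln r)\<^sup>2 * r powr s \<le> 16 / s\<^sup>2 * 1" unfolding sq using small 3 by simp
    also have "\<dots> \<le> 256 / s\<^sup>2 * q powr (3 * s / 2)"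
      using s 3 by (intro mult_mono ge_one_powr_ge_zero) (auto simp: divide_right_mono)
    finally show ?thesis using 3 by simp
  next
    case 4
    have a: "ln r \<le> r powr (s / 4) / (s / 4)" using 4 s by (intro ln_powr_bound) auto
    have "(ln r)\<^sup>2 \<le> (r powr (s / 4) / (s / 4))\<^sup>2" using a 4 by (intro power_mono) auto
    also have "\<dots> = 16 / s\<^sup>2 * r powr (s / 2)"
    proof -
      have "(r powr (s / 4))\<^sup>2 = r powr (s / 2)" by (simp add: power2_eq_square powr_add[symmetric])
      then show ?thesis by (simp add: power_mult_distrib power_divide)
    qed
    finally have "(ln r)\<^sup>2 * r powr s \<le> 16 / s\<^sup>2 * r powr (s / 2) * r powr s" by (rule mult_right_mono) simp
    also have "\<dots> = 16 / s\<^sup>2 * r powr (3 * s / 2)" by (simp add: powr_add[symmetric] field_simps)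
    finally have b: "(ln r)\<^sup>2 * r powr s \<le> 16 / s\<^sup>2 * r powr (3 * s / 2)" .
    have "r powr (3 * s / 2) \<le> (2 * q) powr (3 * s / 2)"
      using q 4 s by (intro powr_mono2) auto
    also have "\<dots> = 2 powr (3 * s / 2) * q powr (3 * s / 2)" by (rule powr_mult)
    also have "\<dots> \<le> 2 powr 2 * q powr (3 * s / 2)"
      using s by (intro mult_right_mono powr_mono) auto
    finally have "16 / s\<^sup>2 * r powr (3 * s / 2) \<le> 16 / s\<^sup>2 * (2 powr 2 * q powr (3 * s / 2))"
      by (rule mult_left_mono) simp
    with b have "(ln r)\<^sup>2 * r powr s \<le> 64 / s\<^sup>2 * q powr (3 * s / 2)" by simp
    then show ?thesis unfolding sq using 4 by simp
  qed
qed

text \<open>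
  The factor \<open>(norm y / norm x) powr s\<close> is the Schur weight: it makes the kernel integrable in
  \<open>y\<close> both near \<open>0\<close>, where the logarithm is unbounded, and at infinity.
\<close>

lemma nn_integral_log_radius_kernel:
  fixes x :: "'a::euclidean_space"
  assumes s: "0 < s" "s < 1" and x: "x \<noteq> 0"
  shows "(\<integral>\<^sup>+y. ennreal ((log_radius x - log_radius y)\<^sup>2 * (norm y / norm x) powr s / norm (x - y) powr (real DIM('a) + 2 * s)) \<partial>lborel)
    \<le> ennreal (256 / s\<^sup>2) * (\<integral>\<^sup>+(z::'a). ennreal (levy_weight s (3 * s / 2) z) \<partial>lborel) * ennreal (1 / norm x powr (2 * s))"
proof -
  let ?N = "real DIM('a)" and ?w = "levy_weight s (3 * s / 2) :: 'a \<Rightarrow> real"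
  have nx: "0 < norm x" using x by simp
  have pt: "(log_radius x - log_radius y)\<^sup>2 * (norm y / norm x) powr s / norm (x - y) powr (?N + 2 * s)
      \<le> 256 / s\<^sup>2 * (norm x powr (- ?N - 2 * s) * ?w ((1 / norm x) *\<^sub>R (y - x)))" if y: "y \<noteq> 0" for y
  proof -
    define r q where "r = norm y / norm x" and "q = norm (x - y) / norm x"
    have r: "0 < r" using y nx by (simp add: r_def)
    have "\<bar>norm y - norm x\<bar> \<le> norm (x - y)" by (metis norm_triangle_ineq3 norm_minus_commute)
    then have "\<bar>norm y - norm x\<bar> / norm x \<le> q" using nx by (simp add: q_def divide_right_mono)
    moreover have "r - 1 = (norm y - norm x) / norm x" using nx by (simp add: r_def diff_divide_distrib)
    ultimately have q: "\<bar>r - 1\<bar> \<le> q" by simp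
    have "(log_radius x - log_radius y)\<^sup>2 \<le> (2 * ln r)\<^sup>2"
      using power_mono[OF log_radius_diff_le[OF x y], of 2] by (simp add: r_def power_mult_distrib)
    then have "(log_radius x - log_radius y)\<^sup>2 * r powr s \<le> (2 * ln r)\<^sup>2 * r powr s"
      by (rule mult_right_mono) simp
    also have "\<dots> \<le> 256 / s\<^sup>2 * (if q < 1 then q\<^sup>2 else q powr (3 * s / 2))"
      by (rule ln_powr_weight[OF s r q])
    finally have "(log_radius x - log_radius y)\<^sup>2 * r powr s / norm (x - y) powr (?N + 2 * s)
       \<le> 256 / s\<^sup>2 * (if q < 1 then q\<^sup>2 else q powr (3 * s / 2)) / norm (x - y) powr (?N + 2 * s)"
      by (rule divide_right_mono) simp
    also have "\<dots> = 256 / s\<^sup>2 * (norm x powr (- ?N - 2 * s) * ?w ((1 / norm x) *\<^sub>R (y - x)))"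
    proof -
      have nz: "norm ((1 / norm x) *\<^sub>R (y - x)) = q" by (simp add: q_def norm_minus_commute)
      have e: "norm (x - y) = norm x * q" using nx by (simp add: q_def)
      have "norm (x - y) powr (?N + 2 * s) = norm x powr (?N + 2 * s) * q powr (?N + 2 * s)"
        unfolding e by (rule powr_mult)
      moreover have "norm x powr (- ?N - 2 * s) = 1 / norm x powr (?N + 2 * s)"
        using powr_minus_divide[of "norm x" "?N + 2 * s"] by (simp add: algebra_simps)
      ultimately show ?thesis unfolding levy_weight_def nz by simp
    qed
    finally show ?thesis by (simp add: r_def)
  qed
  define g where "g y = ennreal (256 / s\<^sup>2 * norm x powr (- ?N - 2 * s)) * ennreal (?w ((1 / norm x) *\<^sub>R (y - x)))" for y
  have [measurable]: "g \<in> borel_measurable borel" unfolding g_def[abs_def] by measurable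
  have le: "ennreal ((log_radius x - log_radius y)\<^sup>2 * (norm y / norm x) powr s / norm (x - y) powr (?N + 2 * s)) \<le> g y" if "y \<noteq> 0" for y
    using ennreal_leI[OF pt[OF that]] by (simp add: g_def ennreal_mult[symmetric] mult.assoc)
  have "(\<integral>\<^sup>+y. ennreal ((log_radius x - log_radius y)\<^sup>2 * (norm y / norm x) powr s / norm (x - y) powr (?N + 2 * s)) \<partial>lborel) \<le> (\<integral>\<^sup>+y. g y \<partial>lborel)"
    by (rule nn_integral_mono_nonzero, rule le)
  \<comment> \<open>Rescale about \<open>x\<close> by \<open>norm x\<close>: the Jacobian has power
    \<open>N\<close>, the kernel \<open>- N - 2 s\<close>, and together they leave the Hardy
    weight.\<close>
  also have "\<dots> = ennreal (\<bar>norm x\<bar> ^ DIM('a)) * (\<integral>\<^sup>+z. g (x + norm x *\<^sub>R z) \<partial>lborel)"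
    using x by (intro nn_integral_lborel_affine) auto
  also have "(\<integral>\<^sup>+z. g (x + norm x *\<^sub>R z) \<partial>lborel) = (\<integral>\<^sup>+z. ennreal (256 / s\<^sup>2 * norm x powr (- ?N - 2 * s)) * ennreal (?w z) \<partial>lborel)"
    using nx by (simp add: g_def)
  also have "\<dots> = ennreal (256 / s\<^sup>2 * norm x powr (- ?N - 2 * s)) * (\<integral>\<^sup>+z. ennreal (?w z) \<partial>lborel)"
    by (rule nn_integral_cmult) measurable
  also have "ennreal (\<bar>norm x\<bar> ^ DIM('a)) * \<dots> = ennreal (256 / s\<^sup>2) * (\<integral>\<^sup>+z. ennreal (?w z) \<partial>lborel) * ennreal (1 / norm x powr (2 * s))"
  proof -
    have "\<bar>norm x\<bar> ^ DIM('a) * (256 / s\<^sup>2 * norm x powr (- ?N - 2 * s)) = 256 / s\<^sup>2 * (norm x powr ?N * norm x powr (- ?N - 2 * s))"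
      using nx by (simp add: powr_realpow)
    also have "norm x powr ?N * norm x powr (- ?N - 2 * s) = norm x powr (- (2 * s))"
      by (simp add: powr_add[symmetric])
    also have "\<dots> = 1 / norm x powr (2 * s)" by (rule powr_minus_divide)
    finally have "ennreal (\<bar>norm x\<bar> ^ DIM('a)) * ennreal (256 / s\<^sup>2 * norm x powr (- ?N - 2 * s)) = ennreal (256 / s\<^sup>2) * ennreal (1 / norm x powr (2 * s))"
      by (simp add: ennreal_mult[symmetric])
    then show ?thesis by (simp add: mult.assoc[symmetric]) (simp add: mult_ac)
  qed
  finally show ?thesis .
qed

section \<open>The localisation formula for the nonlocal energy\<close>

lemma gagliardo_shift:
  fixes u :: "'a::euclidean_space \<Rightarrow> real"
  assumes [measurable]: "u \<in> borel_measurable borel"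
  shows "gagliardo s (\<lambda>x. u (x - a)) = gagliardo s u"
proof -
  define F where "F x y = ennreal ((u x - u y)\<^sup>2 / norm (x - y) powr (real DIM('a) + 2 * s))" for x y
  have [measurable]: "(\<lambda>(x, y). F x y) \<in> borel_measurable (borel \<Otimes>\<^sub>M borel)" unfolding F_def by measurable
  have "gagliardo s (\<lambda>x. u (x - a)) = (\<integral>\<^sup>+x. \<integral>\<^sup>+y. F (- a + x) (- a + y) \<partial>lborel \<partial>lborel)"
    by (simp add: gagliardo_def F_def algebra_simps)
  also have "\<dots> = (\<integral>\<^sup>+x. \<integral>\<^sup>+y. F (- a + x) y \<partial>lborel \<partial>lborel)"
    by (rule nn_integral_cong, rule nn_integral_lborel_shift) measurable
  also have "\<dots> = (\<integral>\<^sup>+x. \<integral>\<^sup>+y. F x y \<partial>lborel \<partial>lborel)"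
    by (rule nn_integral_lborel_shift[where f="\<lambda>x. \<integral>\<^sup>+y. F x y \<partial>lborel"]) measurable
  finally show ?thesis by (simp add: gagliardo_def F_def)
qed

text \<open>For unit vectors \<open>(n, f)\<close> and \<open>(n', f')\<close> the error is exactly
  \<open>u * v\<close> times their squared distance; first-order terms cancel because the squares
  add up to 1. The free weight \<open>\<rho>\<close> splits \<open>u * v\<close> as in a Schur
  test.\<close>

lemma ims_pointwise:
  fixes u v n n' f f' T \<rho> :: real
  assumes nf: "n\<^sup>2 + f\<^sup>2 = 1" "n'\<^sup>2 + f'\<^sup>2 = 1" and T: "(n - n')\<^sup>2 + (f - f')\<^sup>2 \<le> T" and \<rho>: "0 < \<rho>"
  shows "\<bar>(n * u - n' * v)\<^sup>2 + (f * u - f' * v)\<^sup>2 - (u - v)\<^sup>2\<bar> \<le> T / 2 * (u\<^sup>2 * \<rho> + v\<^sup>2 * (1 / \<rho>))"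
proof -
  have "(n * u - n' * v)\<^sup>2 + (f * u - f' * v)\<^sup>2 - (u - v)\<^sup>2
      = u\<^sup>2 * (n\<^sup>2 + f\<^sup>2 - 1) + v\<^sup>2 * (n'\<^sup>2 + f'\<^sup>2 - 1) + u * v * (2 - 2 * (n * n' + f * f'))"
    by (simp add: power2_eq_square algebra_simps)
  also have "2 - 2 * (n * n' + f * f') = (n - n')\<^sup>2 + (f - f')\<^sup>2 - (n\<^sup>2 + f\<^sup>2 - 1) - (n'\<^sup>2 + f'\<^sup>2 - 1)"
    by (simp add: power2_eq_square algebra_simps)
  finally have "(n * u - n' * v)\<^sup>2 + (f * u - f' * v)\<^sup>2 - (u - v)\<^sup>2 = u * v * ((n - n')\<^sup>2 + (f - f')\<^sup>2)"
    by (simp add: nf)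
  then have "\<bar>(n * u - n' * v)\<^sup>2 + (f * u - f' * v)\<^sup>2 - (u - v)\<^sup>2\<bar> = \<bar>u * v\<bar> * ((n - n')\<^sup>2 + (f - f')\<^sup>2)"
    by (simp add: abs_mult)
  also have "\<dots> \<le> (1 / 2 * (u\<^sup>2 * \<rho> + v\<^sup>2 * (1 / \<rho>))) * T"
  proof (rule mult_mono[OF _ T])
    have "0 \<le> (\<bar>u\<bar> * \<rho> - \<bar>v\<bar>)\<^sup>2 / \<rho>" using \<rho> by simp
    also have "\<dots> = u\<^sup>2 * \<rho> + v\<^sup>2 * (1 / \<rho>) - 2 * \<bar>u * v\<bar>"
      using \<rho> by (simp add: power2_diff power_mult_distrib abs_mult field_simps) (simp add: power2_eq_square)
    finally show "\<bar>u * v\<bar> \<le> 1 / 2 * (u\<^sup>2 * \<rho> + v\<^sup>2 * (1 / \<rho>))" by simp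
  qed (use \<rho> in auto)
  finally show ?thesis by (simp add: mult.commute)
qed

text \<open>The weight in the Schur test is \<open>(norm y / norm x) powr s\<close>. Exchanging
  \<open>x\<close> and \<open>y\<close> inverts it, so the two error terms are mirror images with
  equal integrals. The estimate of a difference is given as two inequalities because both sides are
  extended numbers.\<close>

lemma gagliardo_ims_zero:
  assumes s: "0 < s" "s < 1"
  shows "\<exists>C\<ge>0. \<forall>e. \<forall>u :: 'a::euclidean_space \<Rightarrow> real. u \<in> borel_measurable borel \<longrightarrow>
    gagliardo s (\<lambda>x. cut_near e x * u x) + gagliardo s (\<lambda>x. cut_far e x * u x)
      \<le> gagliardo s u + ennreal (e\<^sup>2 * C) * (\<integral>\<^sup>+x. ennreal ((u x)\<^sup>2 / norm x powr (2 * s)) \<partial>lborel) \<and>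
    gagliardo s u \<le> gagliardo s (\<lambda>x. cut_near e x * u x) + gagliardo s (\<lambda>x. cut_far e x * u x)
      + ennreal (e\<^sup>2 * C) * (\<integral>\<^sup>+x. ennreal ((u x)\<^sup>2 / norm x powr (2 * s)) \<partial>lborel)"
proof -
  let ?N = "real DIM('a)"
  let ?J = "\<integral>\<^sup>+(z::'a). ennreal (levy_weight s (3 * s / 2) z) \<partial>lborel"
  have "?J < \<infinity>" using s by (intro nn_integral_levy_weight_finite) auto
  then obtain J where J: "?J = ennreal J" "0 \<le> J" by (cases ?J) auto
  define C where "C = 256 / s\<^sup>2 * J"
  have C0: "0 \<le> C" using J by (simp add: C_def)
  define h where "h x y = (log_radius x - log_radius y)\<^sup>2 * (norm y / norm x) powr s / norm (x - y) powr (?N + 2 * s)" for x y :: 'a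
  have h0: "0 \<le> h x y" for x y by (simp add: h_def)
  have hm: "(\<lambda>(x, y). h x y) \<in> borel_measurable (borel \<Otimes>\<^sub>M borel)" unfolding h_def by measurable
  note [measurable] = hm
  have hJ: "(\<integral>\<^sup>+y. ennreal (h x y) \<partial>lborel) \<le> ennreal C * ennreal (1 / norm x powr (2 * s))" if "x \<noteq> 0" for x :: 'a
    using nn_integral_log_radius_kernel[OF s that] J by (simp add: h_def C_def ennreal_mult[symmetric])
  have main: "gagliardo s (\<lambda>x. cut_near e x * u x) + gagliardo s (\<lambda>x. cut_far e x * u x)
      \<le> gagliardo s u + ennreal (e\<^sup>2 * C) * (\<integral>\<^sup>+x. ennreal ((u x)\<^sup>2 / norm x powr (2 * s)) \<partial>lborel) \<and>
    gagliardo s u \<le> gagliardo s (\<lambda>x. cut_near e x * u x) + gagliardo s (\<lambda>x. cut_far e x * u x)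
      + ennreal (e\<^sup>2 * C) * (\<integral>\<^sup>+x. ennreal ((u x)\<^sup>2 / norm x powr (2 * s)) \<partial>lborel)"
    if u[measurable]: "u \<in> borel_measurable borel" for e and u :: "'a \<Rightarrow> real"
  proof -
    define k where "k x y = norm (x - y) powr (?N + 2 * s)" for x y :: 'a
    define A where "A x y = (cut_near e x * u x - cut_near e y * u y)\<^sup>2 / k x y" for x y
    define B where "B x y = (cut_far e x * u x - cut_far e y * u y)\<^sup>2 / k x y" for x y
    define D where "D x y = (u x - u y)\<^sup>2 / k x y" for x y
    define P where "P x y = e\<^sup>2 / 2 * ((u x)\<^sup>2 * h x y)" for x y
    have nn: "0 \<le> A x y" "0 \<le> B x y" "0 \<le> D x y" "0 \<le> P x y" for x y
      by (simp_all add: A_def B_def D_def P_def k_def h0)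
    have m[measurable]: "(\<lambda>(x, y). A x y) \<in> borel_measurable (borel \<Otimes>\<^sub>M borel)"
      "(\<lambda>(x, y). B x y) \<in> borel_measurable (borel \<Otimes>\<^sub>M borel)"
      "(\<lambda>(x, y). D x y) \<in> borel_measurable (borel \<Otimes>\<^sub>M borel)"
      "(\<lambda>(x, y). P x y) \<in> borel_measurable (borel \<Otimes>\<^sub>M borel)"
      unfolding A_def B_def D_def P_def k_def by measurable
    have pt: "\<bar>A x y + B x y - D x y\<bar> \<le> P x y + P y x" if xy: "x \<noteq> 0" "y \<noteq> 0" for x y
    proof -
      let ?r = "(norm y / norm x) powr s"
      let ?l = "(log_radius x - log_radius y)\<^sup>2"
      have r: "0 < ?r" using xy by simp
      have r': "(norm x / norm y) powr s = 1 / ?r" using xy by (simp add: powr_divide)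
      have "\<bar>A x y + B x y - D x y\<bar> = \<bar>(cut_near e x * u x - cut_near e y * u y)\<^sup>2 + (cut_far e x * u x - cut_far e y * u y)\<^sup>2 - (u x - u y)\<^sup>2\<bar> / k x y"
        by (simp add: A_def B_def D_def k_def add_divide_distrib[symmetric] diff_divide_distrib[symmetric] abs_divide)
      also have "\<dots> \<le> e\<^sup>2 * ?l / 2 * ((u x)\<^sup>2 * ?r + (u y)\<^sup>2 * (1 / ?r)) / k x y"
        by (intro divide_right_mono ims_pointwise cut_sum_squares cut_diff_squares r) (simp add: k_def)
      also have "\<dots> = P x y + P y x"
        unfolding P_def h_def r' k_def norm_minus_commute[of y x] power2_commute[of "log_radius y" "log_radius x"]
        by (simp add: add_divide_distrib distrib_left mult_ac)
      finally show ?thesis .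
    qed
    let ?I = "\<lambda>F. \<integral>\<^sup>+x. \<integral>\<^sup>+y. ennreal (F x y) \<partial>lborel \<partial>lborel"
    have PI: "?I P \<le> ennreal (e\<^sup>2 / 2 * C) * (\<integral>\<^sup>+x. ennreal ((u x)\<^sup>2 / norm x powr (2 * s)) \<partial>lborel)"
    proof -
      have "?I P \<le> (\<integral>\<^sup>+x. ennreal (e\<^sup>2 / 2 * C) * ennreal ((u x)\<^sup>2 / norm x powr (2 * s)) \<partial>lborel)"
      proof (rule nn_integral_mono_nonzero)
        fix x :: 'a assume x: "x \<noteq> 0"
        have "(\<integral>\<^sup>+y. ennreal (P x y) \<partial>lborel) = (\<integral>\<^sup>+y. ennreal (e\<^sup>2 / 2 * (u x)\<^sup>2) * ennreal (h x y) \<partial>lborel)"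
          by (intro nn_integral_cong) (simp add: P_def ennreal_mult[symmetric] h0)
        also have "\<dots> = ennreal (e\<^sup>2 / 2 * (u x)\<^sup>2) * (\<integral>\<^sup>+y. ennreal (h x y) \<partial>lborel)"
          by (rule nn_integral_cmult) measurable
        also have "\<dots> \<le> ennreal (e\<^sup>2 / 2 * (u x)\<^sup>2) * (ennreal C * ennreal (1 / norm x powr (2 * s)))"
          by (rule mult_left_mono[OF hJ[OF x]]) simp
        also have "\<dots> = ennreal (e\<^sup>2 / 2 * C) * ennreal ((u x)\<^sup>2 / norm x powr (2 * s))"
          using C0 by (simp add: ennreal_mult[symmetric] mult_ac)
        finally show "(\<integral>\<^sup>+y. ennreal (P x y) \<partial>lborel) \<le> ennreal (e\<^sup>2 / 2 * C) * ennreal ((u x)\<^sup>2 / norm x powr (2 * s))" .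
      qed
      also have "\<dots> = ennreal (e\<^sup>2 / 2 * C) * (\<integral>\<^sup>+x. ennreal ((u x)\<^sup>2 / norm x powr (2 * s)) \<partial>lborel)"
        by (rule nn_integral_cmult) measurable
      finally show ?thesis .
    qed
    have PI': "?I (\<lambda>x y. P y x) = ?I P" by (rule lborel_pair.Fubini') measurable
    have add: "?I (\<lambda>x y. F x y + G x y) = ?I F + ?I G"
      if [measurable]: "(\<lambda>(x, y). F x y) \<in> borel_measurable (borel \<Otimes>\<^sub>M borel)" "(\<lambda>(x, y). G x y) \<in> borel_measurable (borel \<Otimes>\<^sub>M borel)"
        and "\<And>x y. 0 \<le> F x y" "\<And>x y. 0 \<le> G x y" for F G :: "'a \<Rightarrow> 'a \<Rightarrow> real"
    proof -
      have "?I (\<lambda>x y. F x y + G x y) = (\<integral>\<^sup>+x. (\<integral>\<^sup>+y. ennreal (F x y) \<partial>lborel) + (\<integral>\<^sup>+y. ennreal (G x y) \<partial>lborel) \<partial>lborel)"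
        by (rule nn_integral_cong, subst nn_integral_add[symmetric]) (measurable, simp add: that ennreal_plus)
      also have "\<dots> = ?I F + ?I G" by (rule nn_integral_add) measurable
      finally show ?thesis .
    qed
    have err: "?I (\<lambda>x y. P x y + P y x) \<le> ennreal (e\<^sup>2 * C) * (\<integral>\<^sup>+x. ennreal ((u x)\<^sup>2 / norm x powr (2 * s)) \<partial>lborel)" (is "_ \<le> ?R")
    proof -
      have "?I (\<lambda>x y. P x y + P y x) = ?I P + ?I P"
        using add[of P "\<lambda>x y. P y x"] nn PI' by simp
      also have "\<dots> \<le> ennreal (e\<^sup>2 / 2 * C) * (\<integral>\<^sup>+x. ennreal ((u x)\<^sup>2 / norm x powr (2 * s)) \<partial>lborel)
          + ennreal (e\<^sup>2 / 2 * C) * (\<integral>\<^sup>+x. ennreal ((u x)\<^sup>2 / norm x powr (2 * s)) \<partial>lborel)"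
        by (rule add_mono[OF PI PI])
      also have "\<dots> = ?R"
        using C0 by (simp add: distrib_right[symmetric] ennreal_plus[symmetric] mult.commute[of C] del: ennreal_plus)
      finally show ?thesis .
    qed
    have mono: "?I F \<le> ?I G" if "\<And>x y. x \<noteq> 0 \<Longrightarrow> y \<noteq> 0 \<Longrightarrow> F x y \<le> G x y" for F G :: "'a \<Rightarrow> 'a \<Rightarrow> real"
      by (rule nn_integral_mono_nonzero,
          rule nn_integral_mono_nonzero, rule ennreal_leI, rule that)
    have gA: "gagliardo s (\<lambda>x. cut_near e x * u x) = ?I A" "gagliardo s (\<lambda>x. cut_far e x * u x) = ?I B" "gagliardo s u = ?I D"
      by (simp_all add: gagliardo_def A_def B_def D_def k_def)
    have "?I A + ?I B \<le> ?I D + ?R"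
    proof -
      have "?I A + ?I B = ?I (\<lambda>x y. A x y + B x y)" using add[of A B] nn by simp
      also have "\<dots> \<le> ?I (\<lambda>x y. D x y + (P x y + P y x))"
        by (rule mono) (use pt in \<open>smt (verit)\<close>)
      also have "\<dots> = ?I D + ?I (\<lambda>x y. P x y + P y x)"
        by (rule add) (measurable, auto simp: nn)
      also have "\<dots> \<le> ?I D + ?R" by (rule add_left_mono[OF err])
      finally show ?thesis .
    qed
    moreover have "?I D \<le> ?I A + ?I B + ?R"
    proof -
      have "?I D \<le> ?I (\<lambda>x y. (A x y + B x y) + (P x y + P y x))"
        by (rule mono) (use pt in \<open>smt (verit)\<close>)
      also have "\<dots> = ?I (\<lambda>x y. A x y + B x y) + ?I (\<lambda>x y. P x y + P y x)"
        by (rule add) (measurable, auto simp: nn)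
      also have "?I (\<lambda>x y. A x y + B x y) = ?I A + ?I B" using add[of A B] nn by simp
      also have "?I A + ?I B + ?I (\<lambda>x y. P x y + P y x) \<le> ?I A + ?I B + ?R" by (rule add_left_mono[OF err])
      finally show ?thesis .
    qed
    ultimately show ?thesis by (simp only: gA)
  qed
  then show ?thesis using C0 by blast
qed

section \<open>Form-bounded potentials\<close>

lemma form_bdd_measurable: "form_bdd s V K \<Longrightarrow> V \<in> borel_measurable borel"
  by (simp add: form_bdd_def)

lemma form_bdd_mono:
  assumes "form_bdd s V K" "W \<in> borel_measurable borel" "AE x in lborel. \<bar>W x\<bar> \<le> \<bar>V x\<bar>" "K \<le> L"
  shows "form_bdd s W L"
  unfolding form_bdd_def
proof (intro conjI ballI)
  fix u :: "'a \<Rightarrow> real" assume u: "u \<in> Cc_infty"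
  have "(\<integral>\<^sup>+x. ennreal (\<bar>W x\<bar> * (u x)\<^sup>2) \<partial>lborel) \<le> (\<integral>\<^sup>+x. ennreal (\<bar>V x\<bar> * (u x)\<^sup>2) \<partial>lborel)"
    by (rule nn_integral_mono_AE, rule AE_mp[OF assms(3)], rule AE_I2) (auto intro!: ennreal_leI mult_right_mono)
  also have "\<dots> \<le> ennreal K * gagliardo s u" using assms(1) u by (simp add: form_bdd_def)
  also have "\<dots> \<le> ennreal L * gagliardo s u" by (intro mult_right_mono ennreal_leI assms(4)) simp
  finally show "(\<integral>\<^sup>+x. ennreal (\<bar>W x\<bar> * (u x)\<^sup>2) \<partial>lborel) \<le> ennreal L * gagliardo s u" .
qed (use assms in \<open>auto simp: form_bdd_def\<close>)

text \<open>Absolute values make the sum a majorant: together with \<open>form_bdd_mono\<close> it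
  serves potentials that are only dominated pointwise by two pieces on different regions.\<close>

lemma form_bdd_add:
  assumes "form_bdd s V K" "form_bdd s W L"
  shows "form_bdd s (\<lambda>x. \<bar>V x\<bar> + \<bar>W x\<bar>) (K + L)"
  unfolding form_bdd_def
proof (intro conjI ballI)
  have [measurable]: "V \<in> borel_measurable borel" "W \<in> borel_measurable borel"
    using assms by (simp_all add: form_bdd_def)
  show "(\<lambda>x. \<bar>V x\<bar> + \<bar>W x\<bar>) \<in> borel_measurable borel" by measurable
  fix u :: "'a \<Rightarrow> real" assume u: "u \<in> Cc_infty"
  note [measurable] = Cc_infty_borel_measurable[OF u]
  have "(\<integral>\<^sup>+x. ennreal (\<bar>\<bar>V x\<bar> + \<bar>W x\<bar>\<bar> * (u x)\<^sup>2) \<partial>lborel)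
      = (\<integral>\<^sup>+x. ennreal (\<bar>V x\<bar> * (u x)\<^sup>2) + ennreal (\<bar>W x\<bar> * (u x)\<^sup>2) \<partial>lborel)"
    by (rule nn_integral_cong) (simp add: ennreal_plus[symmetric] distrib_right del: ennreal_plus)
  also have "\<dots> = (\<integral>\<^sup>+x. ennreal (\<bar>V x\<bar> * (u x)\<^sup>2) \<partial>lborel) + (\<integral>\<^sup>+x. ennreal (\<bar>W x\<bar> * (u x)\<^sup>2) \<partial>lborel)"
    by (rule nn_integral_add) measurable
  also have "\<dots> \<le> ennreal K * gagliardo s u + ennreal L * gagliardo s u"
    using assms u by (intro add_mono) (simp_all add: form_bdd_def)
  also have "\<dots> = ennreal (K + L) * gagliardo s u"
    using assms by (simp add: form_bdd_def distrib_right)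
  finally show "(\<integral>\<^sup>+x. ennreal (\<bar>\<bar>V x\<bar> + \<bar>W x\<bar>\<bar> * (u x)\<^sup>2) \<partial>lborel) \<le> ennreal (K + L) * gagliardo s u" .
qed (use assms in \<open>auto simp: form_bdd_def\<close>)

lemma form_bdd_cmult:
  assumes "form_bdd s V K"
  shows "form_bdd s (\<lambda>x. c * V x) (\<bar>c\<bar> * K)"
  unfolding form_bdd_def
proof (intro conjI ballI)
  have [measurable]: "V \<in> borel_measurable borel" using assms by (simp add: form_bdd_def)
  show "(\<lambda>x. c * V x) \<in> borel_measurable borel" by measurable
  fix u :: "'a \<Rightarrow> real" assume u: "u \<in> Cc_infty"
  note [measurable] = Cc_infty_borel_measurable[OF u]
  have "(\<integral>\<^sup>+x. ennreal (\<bar>c * V x\<bar> * (u x)\<^sup>2) \<partial>lborel) = (\<integral>\<^sup>+x. ennreal \<bar>c\<bar> * ennreal (\<bar>V x\<bar> * (u x)\<^sup>2) \<partial>lborel)"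
    by (rule nn_integral_cong) (simp add: ennreal_mult[symmetric] abs_mult mult.assoc)
  also have "\<dots> = ennreal \<bar>c\<bar> * (\<integral>\<^sup>+x. ennreal (\<bar>V x\<bar> * (u x)\<^sup>2) \<partial>lborel)"
    by (rule nn_integral_cmult) measurable
  also have "\<dots> \<le> ennreal \<bar>c\<bar> * (ennreal K * gagliardo s u)"
    using assms u by (intro mult_left_mono) (simp_all add: form_bdd_def)
  also have "\<dots> = ennreal (\<bar>c\<bar> * K) * gagliardo s u"
    using assms by (simp add: form_bdd_def ennreal_mult mult.assoc)
  finally show "(\<integral>\<^sup>+x. ennreal (\<bar>c * V x\<bar> * (u x)\<^sup>2) \<partial>lborel) \<le> ennreal (\<bar>c\<bar> * K) * gagliardo s u" .
qed (use assms in \<open>auto simp: form_bdd_def\<close>)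

lemma form_bdd_shift:
  fixes V :: "'a::euclidean_space \<Rightarrow> real"
  assumes "form_bdd s V K"
  shows "form_bdd s (\<lambda>x. V (x - y)) K"
  unfolding form_bdd_def
proof (intro conjI ballI)
  have [measurable]: "V \<in> borel_measurable borel" using assms by (simp add: form_bdd_def)
  show "(\<lambda>x. V (x - y)) \<in> borel_measurable borel" by measurable
  fix u :: "'a \<Rightarrow> real" assume u: "u \<in> Cc_infty"
  note um[measurable] = Cc_infty_borel_measurable[OF u]
  have v: "(\<lambda>x. u (x - (- y))) \<in> Cc_infty" by (rule Cc_infty_shift[OF u])
  have "(\<integral>\<^sup>+x. ennreal (\<bar>V (x - y)\<bar> * (u x)\<^sup>2) \<partial>lborel) = (\<integral>\<^sup>+x. ennreal (\<bar>V ((y + x) - y)\<bar> * (u (y + x))\<^sup>2) \<partial>lborel)"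
    by (rule nn_integral_lborel_shift[symmetric, where f="\<lambda>x. ennreal (\<bar>V (x - y)\<bar> * (u x)\<^sup>2)"]) measurable
  also have "\<dots> = (\<integral>\<^sup>+x. ennreal (\<bar>V x\<bar> * (u (x - (- y)))\<^sup>2) \<partial>lborel)"
    by (simp add: add.commute)
  also have "\<dots> \<le> ennreal K * gagliardo s (\<lambda>x. u (x - (- y)))"
  proof -
    have "\<forall>u\<in>Cc_infty. (\<integral>\<^sup>+x. ennreal (\<bar>V x\<bar> * (u x)\<^sup>2) \<partial>lborel) \<le> ennreal K * gagliardo s u"
      using assms by (simp add: form_bdd_def)
    from bspec[OF this v] show ?thesis .
  qed
  also have "gagliardo s (\<lambda>x. u (x - (- y))) = gagliardo s u" by (rule gagliardo_shift[OF um])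
  finally show "(\<integral>\<^sup>+x. ennreal (\<bar>V (x - y)\<bar> * (u x)\<^sup>2) \<partial>lborel) \<le> ennreal K * gagliardo s u" .
qed (use assms in \<open>auto simp: form_bdd_def\<close>)

lemma gamma_H_pos:
  assumes "0 < s" "2 * s < real N"
  shows "0 < gamma_H N s"
proof -
  have "0 < Gamma ((real N + 2 * s) / 4)" "0 < Gamma ((real N - 2 * s) / 4)"
    using assms by (simp_all add: add_nonneg_pos)
  then show ?thesis unfolding gamma_H_def by simp
qed

lemma C_const_pos:
  assumes "0 < s" "s < 1"
  shows "0 < C_const N s"
proof -
  have "0 < Gamma ((real N + 2 * s) / 2)" "0 < Gamma (2 - s)"
    using assms by (simp_all add: add_nonneg_pos)
  then show ?thesis using assms unfolding C_const_def by simp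
qed

lemma form_bdd_hardy:
  assumes s: "0 < s" "s < 1" and N: "2 * s < real DIM('a::euclidean_space)"
  shows "form_bdd s (\<lambda>x::'a. 1 / norm x powr (2 * s)) (C_const DIM('a) s / 2 / gamma_H DIM('a) s)"
  unfolding form_bdd_def
proof (intro conjI ballI)
  let ?g = "gamma_H DIM('a) s" and ?C = "C_const DIM('a) s / 2"
  have g: "0 < ?g" by (rule gamma_H_pos[OF s(1) N])
  have C: "0 < C_const DIM('a) s" by (rule C_const_pos[OF s])
  show "0 \<le> ?C / ?g" using g C by simp
  fix u :: "'a \<Rightarrow> real" assume u: "u \<in> Cc_infty"
  have "(\<integral>\<^sup>+x. ennreal (\<bar>u x\<bar> powr 2) \<partial>lborel) < \<infinity>"
    by (rule nn_integral_Cc_infty_powr_finite[OF u]) simp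
  then have fin: "(\<integral>\<^sup>+x. ennreal ((u x)\<^sup>2) \<partial>lborel) < \<infinity>" by simp
  let ?X = "\<integral>\<^sup>+x. ennreal ((u x)\<^sup>2 / norm x powr (2 * s)) \<partial>lborel"
  have "ennreal ?g * ?X \<le> ennreal ?C * gagliardo s u"
    by (rule fractional_hardy[OF s N Cc_infty_borel_measurable[OF u] fin])
  then have "ennreal (1 / ?g) * (ennreal ?g * ?X) \<le> ennreal (1 / ?g) * (ennreal ?C * gagliardo s u)"
    by (rule mult_left_mono) simp
  moreover have "ennreal (1 / ?g) * (ennreal ?g * ?X) = ?X"
    using g by (simp add: mult.assoc[symmetric] ennreal_mult[symmetric])
  moreover have "ennreal (1 / ?g) * (ennreal ?C * gagliardo s u) = ennreal (?C / ?g) * gagliardo s u"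
  proof -
    have "ennreal (?C / ?g) = ennreal (1 / ?g) * ennreal ?C" using g C by (subst ennreal_mult[symmetric]) auto
    then show ?thesis by (simp only: mult.assoc)
  qed
  ultimately show "(\<integral>\<^sup>+x. ennreal (\<bar>1 / norm x powr (2 * s)\<bar> * (u x)\<^sup>2) \<partial>lborel) \<le> ennreal (?C / ?g) * gagliardo s u"
    by simp
qed measurable

text \<open>
  \<open>form_tail\<close> describes what is left of a potential in the class \<open>\<Theta>\<close> after its Hardy part at
  infinity \<open>lam_inf / norm x powr (2 * s)\<close> is subtracted on the whole space.
\<close>

definition form_tail :: "real \<Rightarrow> ('a::euclidean_space \<Rightarrow> real) \<Rightarrow> bool" where
  "form_tail s V \<longleftrightarrow> (\<exists>K. form_bdd s V K) \<and>
     (\<forall>d>0. \<exists>r>0. form_bdd s (\<lambda>x. indicator (- ball 0 r) x * V x) d)"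

lemma form_tail_measurable: "form_tail s V \<Longrightarrow> V \<in> borel_measurable borel"
  by (auto simp: form_tail_def form_bdd_def)

lemma form_tail_mono:
  fixes V W :: "'a::euclidean_space \<Rightarrow> real"
  assumes V: "form_tail s V" and W[measurable]: "W \<in> borel_measurable borel" and le: "\<And>x. \<bar>W x\<bar> \<le> \<bar>V x\<bar>"
  shows "form_tail s W"
  unfolding form_tail_def
proof (intro conjI allI impI)
  show "\<exists>K. form_bdd s W K" using V le form_bdd_mono[OF _ W, of s V] by (auto simp: form_tail_def)
  fix d :: real assume "0 < d"
  then obtain r where r: "0 < r" "form_bdd s (\<lambda>x. indicator (- ball 0 r) x * V x) d" using V by (auto simp: form_tail_def)
  have m: "(\<lambda>x. indicator (- ball 0 r) x * W x) \<in> borel_measurable borel"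
    using borel_open[OF open_ball[of "0::'a" r]] by measurable
  have "form_bdd s (\<lambda>x. indicator (- ball 0 r) x * W x) d"
    by (rule form_bdd_mono[OF r(2) m]) (use le in \<open>auto simp: abs_mult intro!: mult_left_mono\<close>)
  then show "\<exists>r>0. form_bdd s (\<lambda>x. indicator (- ball 0 r) x * W x) d" using r by blast
qed

lemma form_tail_add:
  fixes V W :: "'a::euclidean_space \<Rightarrow> real"
  assumes "form_tail s V" "form_tail s W"
  shows "form_tail s (\<lambda>x. V x + W x)"
proof -
  note [measurable] = form_tail_measurable[OF assms(1)] form_tail_measurable[OF assms(2)]
  have "form_tail s (\<lambda>x. \<bar>V x\<bar> + \<bar>W x\<bar>)"
    unfolding form_tail_def
  proof (intro conjI allI impI)
    obtain K L where "form_bdd s V K" "form_bdd s W L" using assms by (auto simp: form_tail_def)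
    then show "\<exists>K. form_bdd s (\<lambda>x. \<bar>V x\<bar> + \<bar>W x\<bar>) K" by (blast intro: form_bdd_add)
    fix d :: real assume d: "0 < d"
    obtain r where r: "0 < r" "form_bdd s (\<lambda>x. indicator (- ball 0 r) x * V x) (d / 2)"
      using assms(1) d by (auto simp: form_tail_def dest: spec[of _ "d / 2"])
    obtain t where t: "0 < t" "form_bdd s (\<lambda>x. indicator (- ball 0 t) x * W x) (d / 2)"
      using assms(2) d by (auto simp: form_tail_def dest: spec[of _ "d / 2"])
    let ?m = "max r t"
    have m: "(\<lambda>x. indicator (- ball 0 ?m) x * (\<bar>V x\<bar> + \<bar>W x\<bar>)) \<in> borel_measurable borel"
      using borel_open[OF open_ball[of "0::'a" ?m]] by measurable
    have "form_bdd s (\<lambda>x. indicator (- ball 0 ?m) x * (\<bar>V x\<bar> + \<bar>W x\<bar>)) d"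
      by (rule form_bdd_mono[OF form_bdd_add[OF r(2) t(2)] m]) (auto simp: indicator_def)
    then show "\<exists>r>0. form_bdd s (\<lambda>x. indicator (- ball 0 r) x * (\<bar>V x\<bar> + \<bar>W x\<bar>)) d"
      using r(1) by (intro exI[of _ ?m]) auto
  qed
  moreover have "(\<lambda>x. V x + W x) \<in> borel_measurable borel" by measurable
  moreover have "\<bar>V x + W x\<bar> \<le> \<bar>\<bar>V x\<bar> + \<bar>W x\<bar>\<bar>" for x by linarith
  ultimately show ?thesis by (rule form_tail_mono)
qed

text \<open>The tail vanishes identically outside the support. This disposes of the finitely many
  poles, however strong their singularities are relative to the energy.\<close>

lemma form_tail_compact_support:
  fixes V :: "'a::euclidean_space \<Rightarrow> real"
  assumes "form_bdd s V K" "\<And>x. r \<le> norm x \<Longrightarrow> V x = 0"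
  shows "form_tail s V"
  unfolding form_tail_def
proof (intro conjI allI impI)
  show "\<exists>K. form_bdd s V K" using assms by blast
  fix d :: real assume "0 < d"
  have "(\<lambda>x. indicator (- ball 0 (max 1 r)) x * V x) = (\<lambda>x. 0)"
  proof
    fix x
    show "indicator (- ball 0 (max 1 r)) x * V x = 0"
      using assms(2)[of x] by (cases "norm x < max 1 r") auto
  qed
  then have "form_bdd s (\<lambda>x. indicator (- ball 0 (max 1 r)) x * V x) d"
    using \<open>0 < d\<close> by (simp add: form_bdd_def)
  then show "\<exists>r>0. form_bdd s (\<lambda>x. indicator (- ball 0 r) x * V x) d" by (intro exI[of _ "max 1 r"]) auto
qed

lemma form_tail_sum:
  fixes V :: "'i \<Rightarrow> 'a::euclidean_space \<Rightarrow> real"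
  assumes "finite I" "\<And>i. i \<in> I \<Longrightarrow> form_tail s (V i)"
  shows "form_tail s (\<lambda>x. \<Sum>i\<in>I. V i x)"
  using assms
proof (induction I rule: finite_induct)
  case empty
  show ?case by (rule form_tail_compact_support[of _ _ 0 0]) (auto simp: form_bdd_def)
next
  case (insert i I)
  then show ?case by (simp add: form_tail_add)
qed

text \<open>By dominated convergence the \<open>L\<^sup>p\<close> norm outside large balls tends to
  0, and \<open>form_bdd_Lp\<close> converts it into a form bound with one constant \<open>K\<close>
  for all tails.\<close>

lemma form_tail_Lp:
  fixes W :: "'a::euclidean_space \<Rightarrow> real"
  assumes s: "0 < s" and N: "2 * s < real DIM('a)" and W[measurable]: "W \<in> borel_measurable borel"
    and fin: "(\<integral>\<^sup>+x. ennreal (\<bar>W x\<bar> powr (real DIM('a) / (2 * s))) \<partial>lborel) < \<infinity>"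
  shows "form_tail s W"
proof -
  let ?p = "real DIM('a) / (2 * s)" and ?q = "2 * s / real DIM('a)"
  have q: "0 < ?q" using s by simp
  obtain K where K: "0 < K" and bdd: "\<And>(V :: 'a \<Rightarrow> real) w. V \<in> borel_measurable borel \<Longrightarrow> 0 \<le> w \<Longrightarrow>
      (\<integral>\<^sup>+x. ennreal (\<bar>V x\<bar> powr ?p) \<partial>lborel) = ennreal w \<Longrightarrow> form_bdd s V (K * w powr ?q)"
    using form_bdd_Lp[OF s N] by blast
  obtain w where w: "(\<integral>\<^sup>+x. ennreal (\<bar>W x\<bar> powr ?p) \<partial>lborel) = ennreal w" "0 \<le> w"
    using fin by (cases "\<integral>\<^sup>+x. ennreal (\<bar>W x\<bar> powr ?p) \<partial>lborel") auto
  have lim: "(\<lambda>n. \<integral>\<^sup>+x. ennreal (\<bar>indicator (- ball 0 (real n)) x * W x\<bar> powr ?p) \<partial>lborel) \<longlonglongrightarrow> (\<integral>\<^sup>+(x::'a). 0 \<partial>lborel)"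
  proof (rule nn_integral_dominated_convergence[where w="\<lambda>x. ennreal (\<bar>W x\<bar> powr ?p)"])
    show "(\<lambda>x. ennreal (\<bar>indicator (- ball 0 (real n)) x * W x\<bar> powr ?p)) \<in> borel_measurable lborel" for n
      using borel_open[OF open_ball[of "0::'a" "real n"]] by measurable
    show "AE x in lborel. ennreal (\<bar>indicator (- ball 0 (real n)) x * W x\<bar> powr ?p) \<le> ennreal (\<bar>W x\<bar> powr ?p)" for n
      by (rule AE_I2) (simp add: indicator_def)
    show "AE x in lborel. (\<lambda>n. ennreal (\<bar>indicator (- ball 0 (real n)) x * W x\<bar> powr ?p)) \<longlonglongrightarrow> 0"
    proof (rule AE_I2, rule tendsto_eventually)
      fix x :: 'a
      obtain m where "norm x < real m" using reals_Archimedean2 by blast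
      then show "eventually (\<lambda>n. ennreal (\<bar>indicator (- ball 0 (real n)) x * W x\<bar> powr ?p) = 0) sequentially"
        by (intro eventually_sequentiallyI[of m]) (auto simp: indicator_def)
    qed
  qed (use fin in auto)
  show ?thesis
    unfolding form_tail_def
  proof (intro conjI allI impI)
    show "\<exists>K. form_bdd s W K" using bdd[OF W w(2,1)] by blast
    fix d :: real assume d: "0 < d"
    \<comment> \<open>Solves \<open>K * e powr (2 s / N) = d\<close>.\<close>
    define e where "e = (d / K) powr (1 / ?q)"
    have e: "0 < e" using d K by (simp add: e_def)
    have "eventually (\<lambda>n. (\<integral>\<^sup>+x. ennreal (\<bar>indicator (- ball (0::'a) (real n)) x * W x\<bar> powr ?p) \<partial>lborel) < ennreal e) sequentially"
      by (rule order_tendstoD(2)[OF lim]) (use e in simp)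
    then have "eventually (\<lambda>n. (\<integral>\<^sup>+x. ennreal (\<bar>indicator (- ball (0::'a) (real n)) x * W x\<bar> powr ?p) \<partial>lborel) < ennreal e \<and> 0 < n) sequentially"
      by (intro eventually_conj eventually_gt_at_top)
    then obtain n where n: "(\<integral>\<^sup>+x. ennreal (\<bar>indicator (- ball (0::'a) (real n)) x * W x\<bar> powr ?p) \<partial>lborel) < ennreal e" "0 < n"
      by (auto simp: eventually_sequentially)
    then obtain v where v: "(\<integral>\<^sup>+x. ennreal (\<bar>indicator (- ball (0::'a) (real n)) x * W x\<bar> powr ?p) \<partial>lborel) = ennreal v" "0 \<le> v"
      by (cases "\<integral>\<^sup>+x. ennreal (\<bar>indicator (- ball (0::'a) (real n)) x * W x\<bar> powr ?p) \<partial>lborel") auto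
    have ve: "v \<le> e" using n(1) v e by (simp add: ennreal_less_iff)
    have m: "(\<lambda>x. indicator (- ball 0 (real n)) x * W x) \<in> borel_measurable borel"
      using borel_open[OF open_ball[of "0::'a" "real n"]] by measurable
    have "K * v powr ?q \<le> K * e powr ?q"
      using K v ve q by (intro mult_left_mono powr_mono2) auto
    also have "e powr ?q = d / K" using d K s by (simp add: e_def powr_powr)
    finally have "K * v powr ?q \<le> d" using K by simp
    then have "form_bdd s (\<lambda>x. indicator (- ball 0 (real n)) x * W x) d"
      using form_bdd_mono[OF bdd[OF m v(2,1)] m] by auto
    then show "\<exists>r>0. form_bdd s (\<lambda>x. indicator (- ball 0 r) x * W x) d"
      using n(2) by (intro exI[of _ "real n"]) auto
  qed
qed

section \<open>Form bounds for products of potentials and cut-offs\<close>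

lemma cut_near_le1: "(cut_near e x)\<^sup>2 \<le> 1"
  using cut_sum_squares[of e x] zero_le_power2[of "cut_far e x"] by linarith

lemma cut_far_le1: "(cut_far e x)\<^sup>2 \<le> 1"
  using cut_sum_squares[of e x] zero_le_power2[of "cut_near e x"] by linarith

lemma cut_far_le: "(cut_far e x)\<^sup>2 \<le> e\<^sup>2 * (log_radius x)\<^sup>2"
proof -
  have "1 \<le> 1 + (e * log_radius x)\<^sup>2" by simp
  then have "(e * log_radius x)\<^sup>2 / (1 + (e * log_radius x)\<^sup>2) \<le> (e * log_radius x)\<^sup>2 / 1"
    by (intro divide_left_mono) (auto simp: add_pos_nonneg)
  then show ?thesis by (simp add: cut_far_def power_divide power_mult_distrib)
qed

lemma cut_near_small:
  assumes e: "0 < e" and d: "0 < d"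
  shows "\<exists>r>0. \<forall>x::'a::euclidean_space. r \<le> norm x \<longrightarrow> (cut_near e x)\<^sup>2 \<le> d"
proof -
  \<comment> \<open>Beyond this radius \<open>e * log_radius x\<close> is at least
    \<open>1 / sqrt d\<close>, which pushes the square of the cut-off below
    \<open>d\<close>.\<close>
  define r where "r = exp (1 / (e * sqrt d))"
  have r: "0 < r" by (simp add: r_def)
  have "(cut_near e x)\<^sup>2 \<le> d" if x: "r \<le> norm x" for x :: 'a
  proof -
    have "1 < r" using e d by (simp add: r_def)
    then have "r\<^sup>2 \<le> (norm x)\<^sup>2" using x by (intro power_mono) auto
    moreover have "r \<le> r\<^sup>2" using \<open>1 < r\<close> by (simp add: power2_eq_square)
    ultimately have "r \<le> 1 + (norm x)\<^sup>2" by linarith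
    then have "ln r \<le> log_radius x"
      unfolding log_radius_def using r by (subst ln_le_cancel_iff) linarith+
    then have "1 / (e * sqrt d) \<le> log_radius x" by (simp add: r_def)
    then have "e * (1 / (e * sqrt d)) \<le> e * log_radius x" using e by (intro mult_left_mono) auto
    then have "1 / sqrt d \<le> e * log_radius x" using e by simp
    then have "(1 / sqrt d)\<^sup>2 \<le> (e * log_radius x)\<^sup>2" using d by (intro power_mono) auto
    then have "1 / d \<le> 1 + (e * log_radius x)\<^sup>2" using d by (simp add: power_divide)
    then have "1 \<le> d * (1 + (e * log_radius x)\<^sup>2)" using d by (simp only: divide_le_eq mult.commute if_True)
    moreover have "0 < 1 + (e * log_radius x)\<^sup>2" by (simp add: add_pos_nonneg)
    ultimately have "1 / (1 + (e * log_radius x)\<^sup>2) \<le> d" by (simp only: divide_le_eq if_True)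
    then show ?thesis by (simp add: cut_near_def power_divide)
  qed
  with r show ?thesis by blast
qed

text \<open>Inside a fixed ball the cut-off is of order \<open>e\<close>, outside it the potential
  has a small form. The ball is chosen first, so a small \<open>e\<close> makes both contributions
  small.\<close>

lemma form_bdd_cut_far:
  fixes T :: "'a::euclidean_space \<Rightarrow> real"
  assumes T: "form_tail s T" and d: "0 < d"
  shows "\<exists>e0>0. \<forall>e. 0 < e \<longrightarrow> e \<le> e0 \<longrightarrow> form_bdd s (\<lambda>x. (cut_far e x)\<^sup>2 * T x) d"
proof -
  note [measurable] = form_tail_measurable[OF T]
  obtain K where K: "form_bdd s T K" using T by (auto simp: form_tail_def)
  obtain r where r: "0 < r" "form_bdd s (\<lambda>x. indicator (- ball 0 r) x * T x) (d / 2)"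
    using T d by (auto simp: form_tail_def dest: spec[of _ "d / 2"])
  define L where "L = (ln (1 + r\<^sup>2))\<^sup>2"
  have K0: "0 \<le> K" using K by (simp add: form_bdd_def)
  have LK: "0 < L * K + 1" using K0 by (simp add: L_def add_nonneg_pos)
  \<comment> \<open>Chosen so that the part inside the ball has bound at most \<open>d / 2\<close>;
    the added 1 keeps the denominator positive when \<open>L * K = 0\<close>.\<close>
  define e0 where "e0 = sqrt (d / 2 / (L * K + 1))"
  have e0: "0 < e0" using d LK by (simp add: e0_def)
  have "form_bdd s (\<lambda>x. (cut_far e x)\<^sup>2 * T x) d" if e: "0 < e" "e \<le> e0" for e
  proof (rule form_bdd_mono[OF form_bdd_add[OF form_bdd_cmult[OF K, of "e\<^sup>2 * L"] r(2)]])
    show "(\<lambda>x. (cut_far e x)\<^sup>2 * T x) \<in> borel_measurable borel" by measurable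
    have "\<bar>(cut_far e x)\<^sup>2 * T x\<bar> \<le> \<bar>\<bar>e\<^sup>2 * L * T x\<bar> + \<bar>indicator (- ball 0 r) x * T x\<bar>\<bar>" for x
    proof (cases "norm x < r")
      case True
      then have "(norm x)\<^sup>2 \<le> r\<^sup>2" by (intro power_mono) auto
      then have "log_radius x \<le> ln (1 + r\<^sup>2)" by (simp add: log_radius_def add_pos_nonneg)
      then have "(log_radius x)\<^sup>2 \<le> L" unfolding L_def by (intro power_mono) auto
      then have "(cut_far e x)\<^sup>2 \<le> e\<^sup>2 * L" using cut_far_le[of e x] by (meson mult_left_mono order_trans zero_le_power2)
      then have "(cut_far e x)\<^sup>2 * \<bar>T x\<bar> \<le> (e\<^sup>2 * L) * \<bar>T x\<bar>" by (rule mult_right_mono) simp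
      then show ?thesis by (simp add: abs_mult L_def add_increasing2)
    next
      case False
      have "(cut_far e x)\<^sup>2 * \<bar>T x\<bar> \<le> 1 * \<bar>T x\<bar>" by (rule mult_right_mono[OF cut_far_le1]) simp
      then show ?thesis using False by (simp add: abs_mult add_increasing)
    qed
    then show "AE x in lborel. \<bar>(cut_far e x)\<^sup>2 * T x\<bar> \<le> \<bar>\<bar>e\<^sup>2 * L * T x\<bar> + \<bar>indicator (- ball 0 r) x * T x\<bar>\<bar>" by simp
    have "e\<^sup>2 \<le> e0\<^sup>2" using e by (intro power_mono) auto
    also have "e0\<^sup>2 = d / 2 / (L * K + 1)" using d LK by (simp add: e0_def)
    finally have "e\<^sup>2 * (L * K + 1) \<le> d / 2" using LK by (simp add: field_simps)
    moreover have "e\<^sup>2 * (L * K + 1) = e\<^sup>2 * L * K + e\<^sup>2" by (simp add: algebra_simps)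
    ultimately have "e\<^sup>2 * L * K \<le> d / 2" using zero_le_power2[of e] by linarith
    then show "\<bar>e\<^sup>2 * L\<bar> * K + d / 2 \<le> d" by (simp add: L_def)
  qed
  with e0 show ?thesis by blast
qed

text \<open>The translate of \<open>T\<close> is large only near \<open>y\<close>; when
  \<open>y\<close> is far away, that region lies where the cut-off around the origin is already
  small.\<close>

lemma form_bdd_cut_near_shift:
  fixes T :: "'a::euclidean_space \<Rightarrow> real"
  assumes T: "form_tail s T" and e: "0 < e" and d: "0 < d"
  shows "\<exists>Y>0. \<forall>y. Y \<le> norm y \<longrightarrow> form_bdd s (\<lambda>x. (cut_near e x)\<^sup>2 * T (x - y)) d"
proof -
  note [measurable] = form_tail_measurable[OF T]
  obtain K where K: "form_bdd s T K" using T by (auto simp: form_tail_def)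
  obtain r where r: "0 < r" "form_bdd s (\<lambda>x. indicator (- ball 0 r) x * T x) (d / 2)"
    using T d by (auto simp: form_tail_def dest: spec[of _ "d / 2"])
  have K0: "0 \<le> K" using K by (simp add: form_bdd_def)
  define c where "c = d / 2 / (K + 1)"
  have c: "0 < c" using d K0 by (simp add: c_def)
  obtain t where t: "0 < t" "\<And>x::'a. t \<le> norm x \<Longrightarrow> (cut_near e x)\<^sup>2 \<le> c" using cut_near_small[OF e c] by blast
  have "form_bdd s (\<lambda>x. (cut_near e x)\<^sup>2 * T (x - y)) d" if y: "r + t \<le> norm y" for y
  proof (rule form_bdd_mono[OF form_bdd_add[OF form_bdd_cmult[OF form_bdd_shift[OF K], of c y] form_bdd_shift[OF r(2), of y]]])
    show "(\<lambda>x. (cut_near e x)\<^sup>2 * T (x - y)) \<in> borel_measurable borel" by measurable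
    have "\<bar>(cut_near e x)\<^sup>2 * T (x - y)\<bar> \<le> \<bar>\<bar>c * T (x - y)\<bar> + \<bar>indicator (- ball 0 r) (x - y) * T (x - y)\<bar>\<bar>" for x
    proof (cases "norm (x - y) < r")
      case True
      have "norm y \<le> norm x + norm (x - y)" by (metis add.commute norm_minus_commute norm_triangle_sub)
      then have "t \<le> norm x" using True y by linarith
      then have "(cut_near e x)\<^sup>2 * \<bar>T (x - y)\<bar> \<le> c * \<bar>T (x - y)\<bar>" by (intro mult_right_mono t) auto
      then show ?thesis using c by (simp add: abs_mult add_increasing2)
    next
      case False
      have "(cut_near e x)\<^sup>2 * \<bar>T (x - y)\<bar> \<le> 1 * \<bar>T (x - y)\<bar>" by (rule mult_right_mono[OF cut_near_le1]) simp
      then show ?thesis using False by (simp add: abs_mult add_increasing)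
    qed
    then show "AE x in lborel. \<bar>(cut_near e x)\<^sup>2 * T (x - y)\<bar> \<le> \<bar>\<bar>c * T (x - y)\<bar> + \<bar>indicator (- ball 0 r) (x - y) * T (x - y)\<bar>\<bar>" by simp
    have "c * K \<le> c * (K + 1)" using c by simp
    also have "\<dots> = d / 2"
    proof -
      have "K + 1 \<noteq> 0" using K0 by simp
      then show ?thesis unfolding c_def by (metis nonzero_eq_divide_eq)
    qed
    finally show "\<bar>c\<bar> * K + d / 2 \<le> d" using c by simp
  qed
  then show ?thesis using r(1) t(1) by (intro exI[of _ "r + t"]) auto
qed

text \<open>The Hardy weight is no \<open>form_tail\<close>: by scale invariance its form does not
  decay far out. Instead, either \<open>x\<close> is much closer to \<open>0\<close> than to
  \<open>y\<close>, and the weight at \<open>y\<close> is a small multiple of the weight at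
  \<open>0\<close>, or \<open>norm x\<close> is comparable to \<open>norm y\<close>, or larger, and
  the cut-off is small.\<close>

lemma form_bdd_cut_near_hardy:
  assumes s: "0 < s" "s < 1" and N: "2 * s < real DIM('a::euclidean_space)" and e: "0 < e" and d: "0 < d"
  shows "\<exists>Y>0. \<forall>y::'a. Y \<le> norm y \<longrightarrow> form_bdd s (\<lambda>x. (cut_near e x)\<^sup>2 * (1 / norm (x - y) powr (2 * s))) d"
proof -
  define H where "H = C_const DIM('a) s / 2 / gamma_H DIM('a) s"
  have hardy: "form_bdd s (\<lambda>x::'a. 1 / norm x powr (2 * s)) H"
    unfolding H_def by (rule form_bdd_hardy[OF s N])
  have H0: "0 \<le> H" using hardy by (simp add: form_bdd_def)
  define c where "c = d / 2 / (H + 1)"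
  have c: "0 < c" using d H0 by (simp add: c_def)
  \<comment> \<open>The distance ratio for which the weight at \<open>y\<close> is \<open>c\<close>
    times the weight at the origin.\<close>
  define k where "k = c powr (1 / (2 * s))"
  have k: "0 < k" using c by (simp add: k_def)
  have kc: "k powr (2 * s) = c" using c s by (simp add: k_def powr_powr)
  obtain t where t: "0 < t" "\<And>x::'a. t \<le> norm x \<Longrightarrow> (cut_near e x)\<^sup>2 \<le> c" using cut_near_small[OF e c] by blast
  \<comment> \<open>If \<open>norm (x - y) \<le> norm x / k\<close>, then
    \<open>norm y \<le> norm x * (1 + 1 / k)\<close>, so this threshold forces
    \<open>t \<le> norm x\<close>.\<close>
  define Y where "Y = t * (1 + 1 / k)"
  have Y: "0 < Y" using t k by (simp add: Y_def add_pos_pos)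
  have "form_bdd s (\<lambda>x. (cut_near e x)\<^sup>2 * (1 / norm (x - y) powr (2 * s))) d" if y: "Y \<le> norm y" for y :: 'a
  proof (rule form_bdd_mono[OF form_bdd_add[OF form_bdd_cmult[OF hardy, of c] form_bdd_cmult[OF form_bdd_shift[OF hardy], of c y]]])
    show "(\<lambda>x. (cut_near e x)\<^sup>2 * (1 / norm (x - y) powr (2 * s))) \<in> borel_measurable borel" by measurable
    have pt: "\<bar>(cut_near e x)\<^sup>2 * (1 / norm (x - y) powr (2 * s))\<bar> \<le> \<bar>\<bar>c * (1 / norm x powr (2 * s))\<bar> + \<bar>c * (1 / norm (x - y) powr (2 * s))\<bar>\<bar>" if x: "x \<noteq> 0" for x
    proof (cases "norm x \<le> k * norm (x - y)")
      case True
      then have pos: "0 < k * norm (x - y)" using x by (metis norm_le_zero_iff not_le order_trans)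
      have "norm x powr (2 * s) \<le> (k * norm (x - y)) powr (2 * s)" using True s by (intro powr_mono2) auto
      also have "\<dots> = c * norm (x - y) powr (2 * s)" by (simp add: powr_mult kc)
      finally have "norm x powr (2 * s) \<le> c * norm (x - y) powr (2 * s)" .
      moreover have "0 < norm x powr (2 * s)" "0 < norm (x - y) powr (2 * s)" using x pos k by (auto simp: zero_less_mult_iff)
      ultimately have "1 / norm (x - y) powr (2 * s) \<le> c * (1 / norm x powr (2 * s))"
        by (simp add: field_simps)
      moreover have "(cut_near e x)\<^sup>2 * (1 / norm (x - y) powr (2 * s)) \<le> 1 * (1 / norm (x - y) powr (2 * s))"
        by (rule mult_right_mono[OF cut_near_le1]) simp
      moreover have "0 \<le> c * (1 / norm (x - y) powr (2 * s))" using c by simp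
      ultimately have "(cut_near e x)\<^sup>2 * (1 / norm (x - y) powr (2 * s)) \<le> c * (1 / norm x powr (2 * s)) + c * (1 / norm (x - y) powr (2 * s))"
        by linarith
      then show ?thesis using c by simp
    next
      case False
      then have "norm (x - y) \<le> norm x / k" using k by (simp add: field_simps)
      moreover have "norm y \<le> norm x + norm (x - y)" by (metis add.commute norm_minus_commute norm_triangle_sub)
      ultimately have "Y \<le> norm x * (1 + 1 / k)" using y by (simp add: algebra_simps)
      then have "t \<le> norm x" unfolding Y_def using k by (simp only: mult_le_cancel_right_pos add_pos_pos zero_less_one zero_less_divide_1_iff)
      then have "(cut_near e x)\<^sup>2 * (1 / norm (x - y) powr (2 * s)) \<le> c * (1 / norm (x - y) powr (2 * s))"
        by (intro mult_right_mono t) auto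
      moreover have "0 \<le> c * (1 / norm x powr (2 * s))" using c by simp
      ultimately have "(cut_near e x)\<^sup>2 * (1 / norm (x - y) powr (2 * s)) \<le> c * (1 / norm x powr (2 * s)) + c * (1 / norm (x - y) powr (2 * s))"
        by linarith
      then show ?thesis using c by simp
    qed
    show "AE x in lborel. \<bar>(cut_near e x)\<^sup>2 * (1 / norm (x - y) powr (2 * s))\<bar> \<le> \<bar>\<bar>c * (1 / norm x powr (2 * s))\<bar> + \<bar>c * (1 / norm (x - y) powr (2 * s))\<bar>\<bar>"
      by (rule AE_mp[OF AE_lborel_singleton[of 0]], rule AE_I2, rule impI, rule pt)
    have "c * H \<le> c * (H + 1)" using c by simp
    also have "\<dots> = d / 2"
    proof -
      have "H + 1 \<noteq> 0" using H0 by simp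
      then show ?thesis unfolding c_def by (metis nonzero_eq_divide_eq)
    qed
    finally show "\<bar>c\<bar> * H + \<bar>c\<bar> * H \<le> d" unfolding abs_of_pos[OF c] by linarith
  qed
  with Y show ?thesis by blast
qed

lemma form_bdd_cut_near_center_hardy:
  assumes s: "0 < s" "s < 1" and N: "2 * s < real DIM('a::euclidean_space)" and e: "0 < e" and d: "0 < d"
  shows "\<exists>Y>0. \<forall>y::'a. Y \<le> norm y \<longrightarrow> form_bdd s (\<lambda>x. (cut_near e (x - y))\<^sup>2 * (1 / norm x powr (2 * s))) d"
proof -
  obtain Y where Y: "0 < Y" "\<And>y::'a. Y \<le> norm y \<Longrightarrow> form_bdd s (\<lambda>x. (cut_near e x)\<^sup>2 * (1 / norm (x - y) powr (2 * s))) d"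
    using form_bdd_cut_near_hardy[OF s N e d] by blast
  \<comment> \<open>Translate by \<open>y\<close> the bound with the singularity at
    \<open>- y\<close>.\<close>
  have "form_bdd s (\<lambda>x. (cut_near e (x - y))\<^sup>2 * (1 / norm x powr (2 * s))) d" if "Y \<le> norm y" for y :: 'a
    using form_bdd_shift[OF Y(2)[of "- y"], of y] that by simp
  with Y(1) show ?thesis by blast
qed

section \<open>Coercivity of the sum on test functions\<close>

definition energy :: "real \<Rightarrow> ('a::euclidean_space \<Rightarrow> real) \<Rightarrow> real" where
  "energy s u = enn2real (gagliardo s u)"

lemma energy_nonneg [simp]: "0 \<le> energy s u"
  by (simp add: energy_def)

lemma gagliardo_energy:
  assumes "0 < s" "s < 1" "u \<in> Cc_infty"
  shows "gagliardo s u = ennreal (energy s u)"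
  using gagliardo_Cc_infty_finite[OF assms] by (simp add: energy_def)

lemma energy_shift: "u \<in> borel_measurable borel \<Longrightarrow> energy s (\<lambda>x. u (x - a)) = energy s u"
  by (simp add: energy_def gagliardo_shift)

lemma form_bdd_plus:
  assumes "form_bdd s V K" "form_bdd s W L"
  shows "form_bdd s (\<lambda>x. V x + W x) (K + L)"
proof -
  note [measurable] = form_bdd_measurable[OF assms(1)] form_bdd_measurable[OF assms(2)]
  show ?thesis by (rule form_bdd_mono[OF form_bdd_add[OF assms]]) auto
qed

lemma form_bdd_integral:
  fixes V :: "'a::euclidean_space \<Rightarrow> real"
  assumes s: "0 < s" "s < 1" and V: "form_bdd s V K" and u: "u \<in> Cc_infty"
  shows "integrable lborel (\<lambda>x. V x * (u x)\<^sup>2)" "\<bar>LINT x|lborel. V x * (u x)\<^sup>2\<bar> \<le> K * energy s u"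
proof -
  note [measurable] = form_bdd_measurable[OF V] Cc_infty_borel_measurable[OF u]
  have K0: "0 \<le> K" using V by (simp add: form_bdd_def)
  have le: "(\<integral>\<^sup>+x. ennreal (norm (V x * (u x)\<^sup>2)) \<partial>lborel) \<le> ennreal (K * energy s u)"
    using V u K0 by (simp add: form_bdd_def abs_mult gagliardo_energy[OF s] ennreal_mult)
  show int: "integrable lborel (\<lambda>x. V x * (u x)\<^sup>2)"
    by (rule integrableI_bounded) (measurable, use le in \<open>auto intro: le_less_trans\<close>)
  have "ennreal (norm (LINT x|lborel. V x * (u x)\<^sup>2)) \<le> (\<integral>\<^sup>+x. ennreal (norm (V x * (u x)\<^sup>2)) \<partial>lborel)"
    by (rule integral_norm_bound_ennreal[OF int])
  also note le
  finally show "\<bar>LINT x|lborel. V x * (u x)\<^sup>2\<bar> \<le> K * energy s u" using K0 by simp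
qed

text \<open>The Hardy inequality turns the localisation error into a fraction of the energy, and
  translation moves the cut-offs to any centre with the same constant.\<close>

lemma energy_ims:
  assumes s: "0 < s" "s < 1" and N: "2 * s < real DIM('a::euclidean_space)"
  shows "\<exists>C\<ge>0. \<forall>e y. \<forall>u :: 'a \<Rightarrow> real. u \<in> Cc_infty \<longrightarrow>
    \<bar>energy s (\<lambda>x. cut_near e (x - y) * u x) + energy s (\<lambda>x. cut_far e (x - y) * u x) - energy s u\<bar> \<le> e\<^sup>2 * C * energy s u"
proof -
  define H where "H = C_const DIM('a) s / 2 / gamma_H DIM('a) s"
  have hardy: "form_bdd s (\<lambda>x::'a. 1 / norm x powr (2 * s)) H"
    unfolding H_def by (rule form_bdd_hardy[OF s N])
  then have H0: "0 \<le> H" by (simp add: form_bdd_def)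
  from gagliardo_ims_zero[where 'a='a, OF s] obtain C where C: "0 \<le> C" and ims: "\<And>e u. u \<in> borel_measurable borel \<Longrightarrow>
    gagliardo s (\<lambda>x. cut_near e x * u x) + gagliardo s (\<lambda>x. cut_far e x * u x)
      \<le> gagliardo s u + ennreal (e\<^sup>2 * C) * (\<integral>\<^sup>+(x::'a). ennreal ((u x)\<^sup>2 / norm x powr (2 * s)) \<partial>lborel) \<and>
    gagliardo s u \<le> gagliardo s (\<lambda>x. cut_near e x * u x) + gagliardo s (\<lambda>x. cut_far e x * u x)
      + ennreal (e\<^sup>2 * C) * (\<integral>\<^sup>+(x::'a). ennreal ((u x)\<^sup>2 / norm x powr (2 * s)) \<partial>lborel)"
    by (elim exE conjE) blast
  have zero: "\<bar>energy s (\<lambda>x. cut_near e x * u x) + energy s (\<lambda>x. cut_far e x * u x) - energy s u\<bar> \<le> e\<^sup>2 * (C * H) * energy s u"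
    if u: "u \<in> Cc_infty" for e and u :: "'a \<Rightarrow> real"
  proof -
    have nu: "(\<lambda>x. cut_near e x * u x) \<in> Cc_infty" by (rule Cc_infty_mult[OF C_k_cut_near u])
    have fu: "(\<lambda>x. cut_far e x * u x) \<in> Cc_infty" by (rule Cc_infty_mult[OF C_k_cut_far u])
    note g = gagliardo_energy[OF s nu] gagliardo_energy[OF s fu] gagliardo_energy[OF s u]
    let ?X = "\<integral>\<^sup>+x. ennreal ((u x)\<^sup>2 / norm x powr (2 * s)) \<partial>lborel"
    have "?X \<le> ennreal H * gagliardo s u" using hardy u by (simp add: form_bdd_def)
    then have "ennreal (e\<^sup>2 * C) * ?X \<le> ennreal (e\<^sup>2 * C) * (ennreal H * gagliardo s u)"
      by (rule mult_left_mono) simp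
    also have "\<dots> = ennreal (e\<^sup>2 * (C * H) * energy s u)"
      using C H0 by (simp add: g ennreal_mult mult.assoc)
    finally have R: "ennreal (e\<^sup>2 * C) * ?X \<le> ennreal (e\<^sup>2 * (C * H) * energy s u)" .
    have R0: "0 \<le> e\<^sup>2 * (C * H) * energy s u" using C H0 by simp
    note i = ims[OF Cc_infty_borel_measurable[OF u], of e]
    have "ennreal (energy s (\<lambda>x. cut_near e x * u x) + energy s (\<lambda>x. cut_far e x * u x)) \<le> ennreal (energy s u + e\<^sup>2 * (C * H) * energy s u)"
      using order_trans[OF conjunct1[OF i] add_left_mono[OF R]] R0 by (simp add: g ennreal_plus)
    moreover have "ennreal (energy s u) \<le> ennreal (energy s (\<lambda>x. cut_near e x * u x) + energy s (\<lambda>x. cut_far e x * u x) + e\<^sup>2 * (C * H) * energy s u)"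
      using order_trans[OF conjunct2[OF i] add_left_mono[OF R]] R0 by (simp add: g ennreal_plus)
    ultimately show ?thesis
      using R0 by (subst (asm) ennreal_le_iff, simp, subst (asm) ennreal_le_iff, simp) linarith
  qed
  have "\<bar>energy s (\<lambda>x. cut_near e (x - y) * u x) + energy s (\<lambda>x. cut_far e (x - y) * u x) - energy s u\<bar> \<le> e\<^sup>2 * (C * H) * energy s u"
    if u: "u \<in> Cc_infty" for e y and u :: "'a \<Rightarrow> real"
  proof -
    define v where "v x = u (x - (- y))" for x
    have v: "v \<in> Cc_infty" unfolding v_def[abs_def] by (rule Cc_infty_shift[OF u])
    have [measurable]: "v \<in> borel_measurable borel" by (rule Cc_infty_borel_measurable[OF v])
    have uv: "u = (\<lambda>x. v (x - y))" by (simp add: v_def)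
    have e: "energy s (\<lambda>x. cut_near e (x - y) * v (x - y)) = energy s (\<lambda>x. cut_near e x * v x)"
      "energy s (\<lambda>x. cut_far e (x - y) * v (x - y)) = energy s (\<lambda>x. cut_far e x * v x)"
      "energy s (\<lambda>x. v (x - y)) = energy s v"
      by (rule energy_shift, measurable)+
    show ?thesis unfolding uv e by (rule zero[OF v])
  qed
  then show ?thesis using C H0 by (intro exI[of _ "C * H"]) simp
qed

lemma lborel_integral_shift:
  fixes f :: "'a::euclidean_space \<Rightarrow> real"
  assumes [measurable]: "f \<in> borel_measurable borel"
  shows "(LINT x|lborel. f (t + x)) = (LINT x|lborel. f x)"
  by (subst (2) lborel_distr_plus[of t, symmetric]) (simp add: integral_distr)

text \<open>The three pieces have coercivity margins \<open>m1\<close>, \<open>m2\<close>,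
  \<open>m3\<close>. Of their minimum \<open>m\<close>, a quarter pays for the cross terms and a
  quarter for the two localisations; \<open>m / 2\<close> survives.\<close>

lemma form_coercive_sum:
  fixes T1 T2 V1 V2 :: "'a::euclidean_space \<Rightarrow> real"
  assumes s: "0 < s" "s < 1" and N: "2 * s < real DIM('a)"
    and T: "form_tail s T1" "form_tail s T2"
    and V1: "\<And>x. V1 x = l1 * (1 / norm x powr (2 * s)) + T1 x"
    and V2: "\<And>x. V2 x = l2 * (1 / norm x powr (2 * s)) + T2 x"
    and l: "l1 < gamma_H DIM('a) s" "l2 < gamma_H DIM('a) s" "l1 + l2 < gamma_H DIM('a) s"
    and c: "c = C_const DIM('a) s / 2"
    and m1: "0 < m1" "\<And>u. u \<in> Cc_infty \<Longrightarrow> m1 * energy s u \<le> c * energy s u - (LINT x|lborel. V1 x * (u x)\<^sup>2)"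
    and m2: "0 < m2" "\<And>u. u \<in> Cc_infty \<Longrightarrow> m2 * energy s u \<le> c * energy s u - (LINT x|lborel. V2 x * (u x)\<^sup>2)"
  shows "\<exists>Y>0. \<exists>m>0. \<forall>y. Y \<le> norm y \<longrightarrow> (\<forall>u\<in>Cc_infty.
     m * energy s u \<le> c * energy s u - (LINT x|lborel. (V1 x + V2 (x - y)) * (u x)\<^sup>2))"
proof -
  let ?g = "gamma_H DIM('a) s"
  define h where "h x = 1 / norm x powr (2 * s)" for x :: 'a
  have g0: "0 < ?g" by (rule gamma_H_pos[OF s(1) N])
  have c0: "0 < c" using C_const_pos[OF s] by (simp add: c)
  have hardy: "form_bdd s h (c / ?g)" unfolding h_def[abs_def] c by (rule form_bdd_hardy[OF s N])
  have hm[measurable]: "h \<in> borel_measurable borel" by (rule form_bdd_measurable[OF hardy])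
  note Tm[measurable] = form_tail_measurable[OF T(1)] form_tail_measurable[OF T(2)]
  define m3 where "m3 = c * (1 - (max 0 l1 + max 0 l2) / ?g)"
  \<comment> \<open>If one coefficient is negative, the sum of the positive parts reduces to at most
    the other; this is where the separate bounds on \<open>l1\<close> and \<open>l2\<close>
    enter.\<close>
  have "max 0 l1 + max 0 l2 < ?g" using l g0 by (auto simp: max_def)
  then have m3: "0 < m3" using c0 g0 by (simp add: m3_def)
  define m where "m = min m1 (min m2 m3)"
  have m: "0 < m" "m \<le> m1" "m \<le> m2" "m \<le> m3" using m1(1) m2(1) m3 by (auto simp: m_def)
  \<comment> \<open>The five cross terms in \<open>R\<close> have coefficients \<open>l2\<close>, 1,
    \<open>l1\<close>, 1, 1; with bound \<open>d\<close> for each factor the total is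
    \<open>d * L = m / 4\<close>.\<close>
  define L where "L = \<bar>l1\<bar> + \<bar>l2\<bar> + 3"
  have L: "0 < L" by (simp add: L_def)
  define d where "d = m / (4 * L)"
  have d: "0 < d" using m L by (simp add: d_def)
  have dL: "d * L = m / 4" using L by (simp add: d_def)
  \<comment> \<open>Three times this relative error, multiplied by \<open>c + m\<close>, is
    \<open>m / 4\<close>.\<close>
  define \<eta> where "\<eta> = m / (12 * (m + c))"
  have eta: "0 < \<eta>" using m c0 by (simp add: \<eta>_def)
  have eta1: "\<eta> * (12 * (m + c)) = m"
  proof -
    have "12 * (m + c) \<noteq> 0" using m(1) c0 by simp
    then show ?thesis unfolding \<eta>_def by (metis nonzero_eq_divide_eq)
  qed
  have eta2: "\<eta> \<le> 1"
  proof -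
    have "m \<le> 12 * (m + c)" using m(1) c0 by simp
    then show ?thesis using m(1) c0 by (simp add: \<eta>_def divide_le_eq)
  qed
  obtain C where C: "0 \<le> C" and ims: "\<And>e y. \<And>u :: 'a \<Rightarrow> real. u \<in> Cc_infty \<Longrightarrow>
    \<bar>energy s (\<lambda>x. cut_near e (x - y) * u x) + energy s (\<lambda>x. cut_far e (x - y) * u x) - energy s u\<bar> \<le> e\<^sup>2 * C * energy s u"
    using energy_ims[OF s N] by blast
  obtain e1 where e1: "0 < e1" "\<And>e. 0 < e \<Longrightarrow> e \<le> e1 \<Longrightarrow> form_bdd s (\<lambda>x. (cut_far e x)\<^sup>2 * T1 x) d"
    using form_bdd_cut_far[OF T(1) d] by blast
  obtain e2 where e2: "0 < e2" "\<And>e. 0 < e \<Longrightarrow> e \<le> e2 \<Longrightarrow> form_bdd s (\<lambda>x. (cut_far e x)\<^sup>2 * T2 x) d"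
    using form_bdd_cut_far[OF T(2) d] by blast
  \<comment> \<open>The speed is fixed before any distance: the thresholds for \<open>norm y\<close>
    below depend on it. The added 1 covers \<open>C = 0\<close>.\<close>
  define e where "e = min (min e1 e2) (sqrt (\<eta> / (C + 1)))"
  have e: "0 < e" "e \<le> e1" "e \<le> e2" "e \<le> sqrt (\<eta> / (C + 1))"
    using e1(1) e2(1) eta C by (auto simp: e_def)
  have eC: "e\<^sup>2 * C \<le> \<eta>"
  proof -
    have "e\<^sup>2 \<le> (sqrt (\<eta> / (C + 1)))\<^sup>2" using e by (intro power_mono) auto
    also have "\<dots> = \<eta> / (C + 1)" using eta C by simp
    finally have "e\<^sup>2 * C \<le> \<eta> / (C + 1) * C" using C by (rule mult_right_mono)
    also have "\<dots> \<le> \<eta>" using eta C by (simp add: divide_le_eq)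
    finally show ?thesis .
  qed
  obtain Y1 where Y1: "0 < Y1" "\<And>y. Y1 \<le> norm y \<Longrightarrow> form_bdd s (\<lambda>x. (cut_near e x)\<^sup>2 * T2 (x - y)) d"
    using form_bdd_cut_near_shift[OF T(2) e(1) d] by blast
  obtain Y2 where Y2: "0 < Y2" "\<And>y::'a. Y2 \<le> norm y \<Longrightarrow> form_bdd s (\<lambda>x. (cut_near e x)\<^sup>2 * h (x - y)) d"
    using form_bdd_cut_near_hardy[OF s N e(1) d] unfolding h_def by blast
  obtain Y3 where Y3: "0 < Y3" "\<And>y::'a. Y3 \<le> norm y \<Longrightarrow> form_bdd s (\<lambda>x. (cut_near e (x - y))\<^sup>2 * h x) d"
    using form_bdd_cut_near_center_hardy[OF s N e(1) d] unfolding h_def by blast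
  obtain K1 K2 where K: "form_bdd s T1 K1" "form_bdd s T2 K2" using T by (auto simp: form_tail_def)
  have "m / 2 * energy s u \<le> c * energy s u - (LINT x|lborel. (V1 x + V2 (x - y)) * (u x)\<^sup>2)"
    if y: "max Y1 (max Y2 Y3) \<le> norm y" and u: "u \<in> Cc_infty" for y and u :: "'a \<Rightarrow> real"
  proof -
    define A where "A x = cut_near e x * u x" for x
    define v where "v x = cut_far e x * u x" for x
    define B where "B x = cut_near e (x - y) * v x" for x
    define D where "D x = cut_far e (x - y) * v x" for x
    have A: "A \<in> Cc_infty" unfolding A_def[abs_def] by (rule Cc_infty_mult[OF C_k_cut_near u])
    have v: "v \<in> Cc_infty" unfolding v_def[abs_def] by (rule Cc_infty_mult[OF C_k_cut_far u])
    have B: "B \<in> Cc_infty" unfolding B_def[abs_def] by (rule Cc_infty_mult[OF C_k_shift[OF C_k_cut_near] v])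
    have D: "D \<in> Cc_infty" unfolding D_def[abs_def] by (rule Cc_infty_mult[OF C_k_shift[OF C_k_cut_far] v])
    let ?E = "energy s"
    have i1: "\<bar>?E A + ?E v - ?E u\<bar> \<le> \<eta> * ?E u"
      using ims[OF u, of e 0] mult_right_mono[OF eC, of "?E u"] by (simp add: A_def[abs_def] v_def[abs_def])
    have i2: "\<bar>?E B + ?E D - ?E v\<bar> \<le> \<eta> * ?E v"
      using ims[OF v, of e y] mult_right_mono[OF eC, of "?E v"] by (simp add: B_def[abs_def] D_def[abs_def])
    \<comment> \<open>The second localisation error is relative to the energy of \<open>v\<close>;
      since \<open>\<eta> \<le> 1\<close> it is at most \<open>2 * \<eta>\<close> times that of
      \<open>u\<close>, for a total of \<open>3 * \<eta>\<close>.\<close>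
    have "?E v \<le> 2 * ?E u"
      using i1 mult_right_mono[OF eta2 energy_nonneg[of s u]] energy_nonneg[of s A] by linarith
    then have "\<eta> * ?E v \<le> \<eta> * (2 * ?E u)" using eta by (intro mult_left_mono) auto
    with i1 i2 have split: "\<bar>?E A + ?E B + ?E D - ?E u\<bar> \<le> 3 * \<eta> * ?E u" by linarith
    \<comment> \<open>all cross terms: each pairs a potential with a cut-off that is small where it is large\<close>
    define R where "R x = l2 * ((cut_near e x)\<^sup>2 * h (x - y)) + (cut_near e x)\<^sup>2 * T2 (x - y)
        + l1 * ((cut_far e x)\<^sup>2 * ((cut_near e (x - y))\<^sup>2 * h x)) + (cut_far e x)\<^sup>2 * T1 x
        + (cut_far e x)\<^sup>2 * ((cut_far e (x - y))\<^sup>2 * T2 (x - y))" for x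
    have R: "form_bdd s R (\<bar>l2\<bar> * d + d + \<bar>l1\<bar> * d + d + d)"
      unfolding R_def[abs_def]
    proof (intro form_bdd_plus form_bdd_cmult)
      show "form_bdd s (\<lambda>x. (cut_near e x)\<^sup>2 * h (x - y)) d" "form_bdd s (\<lambda>x. (cut_near e x)\<^sup>2 * T2 (x - y)) d"
        using Y1(2) Y2(2) y by auto
      show "form_bdd s (\<lambda>x. (cut_far e x)\<^sup>2 * T1 x) d" using e1(2) e by auto
      have "form_bdd s (\<lambda>x. (cut_near e (x - y))\<^sup>2 * h x) d" using Y3(2) y by auto
      then show "form_bdd s (\<lambda>x. (cut_far e x)\<^sup>2 * ((cut_near e (x - y))\<^sup>2 * h x)) d"
        by (rule form_bdd_mono) (measurable, auto simp: abs_mult intro!: mult_left_le_one_le cut_far_le1)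
      have "form_bdd s (\<lambda>x. (cut_far e (x - y))\<^sup>2 * T2 (x - y)) d"
        using form_bdd_shift[OF e2(2)[OF e(1,3)], of y] .
      then show "form_bdd s (\<lambda>x. (cut_far e x)\<^sup>2 * ((cut_far e (x - y))\<^sup>2 * T2 (x - y))) d"
        by (rule form_bdd_mono) (measurable, auto simp: abs_mult intro!: mult_left_le_one_le cut_far_le1)
    qed
    have V1b: "form_bdd s V1 (\<bar>l1\<bar> * (c / ?g) + K1)"
      using form_bdd_plus[OF form_bdd_cmult[OF hardy, of l1] K(1)] by (simp add: V1[abs_def] h_def)
    have V2b: "form_bdd s V2 (\<bar>l2\<bar> * (c / ?g) + K2)"
      using form_bdd_plus[OF form_bdd_cmult[OF hardy, of l2] K(2)] by (simp add: V2[abs_def] h_def)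
    note V2s = form_bdd_shift[OF V2b, of y]
    note hs = form_bdd_shift[OF hardy, of y]
    note I = form_bdd_integral[OF s]
    \<comment> \<open>\<open>A\<close> keeps all of \<open>V1\<close>, \<open>B\<close> all of the
      translated \<open>V2\<close>, and \<open>D\<close> only the Hardy parts; \<open>R\<close>
      collects what \<open>A\<close> misses of \<open>V2\<close>, what \<open>B\<close> misses of
      \<open>V1\<close>, and the tails on \<open>D\<close>.\<close>
    have eq: "(V1 x + V2 (x - y)) * (u x)\<^sup>2 = V1 x * (A x)\<^sup>2 + (V2 (x - y) * (B x)\<^sup>2 + (l1 * (h x * (D x)\<^sup>2) + (l2 * (h (x - y) * (D x)\<^sup>2) + R x * (u x)\<^sup>2)))" for x
    proof -
      define a b p q where "a = (cut_near e x)\<^sup>2" and "b = (cut_far e x)\<^sup>2" and "p = (cut_near e (x - y))\<^sup>2" and "q = (cut_far e (x - y))\<^sup>2"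
      have "a + b = 1" "p + q = 1" unfolding a_def b_def p_def q_def by (rule cut_sum_squares)+
      then have ab: "a = 1 - b" "p = 1 - q" by simp_all
      have f1: "(A x)\<^sup>2 = a * (u x)\<^sup>2" "(B x)\<^sup>2 = p * (b * (u x)\<^sup>2)" "(D x)\<^sup>2 = q * (b * (u x)\<^sup>2)"
        by (simp_all add: A_def B_def D_def v_def a_def b_def p_def q_def power_mult_distrib)
      have f2: "R x = l2 * (a * h (x - y)) + a * T2 (x - y) + l1 * (b * (p * h x)) + b * T1 x + b * (q * T2 (x - y))"
        by (simp add: R_def a_def b_def p_def q_def)
      have f3: "V1 x = l1 * h x + T1 x" "V2 (x - y) = l2 * h (x - y) + T2 (x - y)"
        by (simp_all add: V1 V2 h_def)
      show ?thesis unfolding f1 f2 f3 ab by (simp add: algebra_simps)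
    qed
    have "(LINT x|lborel. (V1 x + V2 (x - y)) * (u x)\<^sup>2)
       = (LINT x|lborel. V1 x * (A x)\<^sup>2) + ((LINT x|lborel. V2 (x - y) * (B x)\<^sup>2) + (l1 * (LINT x|lborel. h x * (D x)\<^sup>2) + (l2 * (LINT x|lborel. h (x - y) * (D x)\<^sup>2) + (LINT x|lborel. R x * (u x)\<^sup>2))))"
      unfolding eq
      by (simp add: I(1)[OF V1b A] I(1)[OF V2s B] I(1)[OF hardy D] I(1)[OF hs D] I(1)[OF R u])
    moreover have "(LINT x|lborel. V1 x * (A x)\<^sup>2) \<le> c * ?E A - m * ?E A"
      using m1(2)[OF A] mult_right_mono[OF m(2), of "?E A"] by simp
    moreover have "(LINT x|lborel. V2 (x - y) * (B x)\<^sup>2) \<le> c * ?E B - m * ?E B"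
    proof -
      define B' where "B' x = B (x - (- y))" for x
      have B': "B' \<in> Cc_infty" unfolding B'_def[abs_def] by (rule Cc_infty_shift[OF B])
      have EB: "?E B' = ?E B" unfolding B'_def[abs_def] by (rule energy_shift[OF Cc_infty_borel_measurable[OF B]])
      have "(LINT x|lborel. V2 (x - y) * (B x)\<^sup>2) = (LINT x|lborel. V2 x * (B' x)\<^sup>2)"
      proof -
        note [measurable] = form_bdd_measurable[OF V2b] Cc_infty_borel_measurable[OF B]
        have "(LINT x|lborel. V2 (y + x - y) * (B (y + x))\<^sup>2) = (LINT x|lborel. V2 (x - y) * (B x)\<^sup>2)"
          by (rule lborel_integral_shift[where f="\<lambda>x. V2 (x - y) * (B x)\<^sup>2"]) measurable
        then show ?thesis by (simp add: B'_def add.commute)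
      qed
      then show ?thesis
        using m2(2)[OF B'] mult_right_mono[OF m(3), of "?E B'"] by (simp add: EB)
    qed
    moreover have "l1 * (LINT x|lborel. h x * (D x)\<^sup>2) + l2 * (LINT x|lborel. h (x - y) * (D x)\<^sup>2) \<le> c * ?E D - m * ?E D"
    proof -
      \<comment> \<open>A negative coefficient is simply dropped, a positive one is charged at the
        sharp Hardy rate.\<close>
      have le: "l * z \<le> max 0 l * (c / ?g * ?E D)" if "0 \<le> z" "\<bar>z\<bar> \<le> c / ?g * ?E D" for l z :: real
      proof -
        have "l * z \<le> max 0 l * z" using that by (intro mult_right_mono) auto
        also have "\<dots> \<le> max 0 l * (c / ?g * ?E D)" using that by (intro mult_left_mono) auto
        finally show ?thesis .
      qed
      have "l1 * (LINT x|lborel. h x * (D x)\<^sup>2) \<le> max 0 l1 * (c / ?g * ?E D)"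
        by (rule le[OF _ I(2)[OF hardy D]]) (simp add: h_def)
      moreover have "l2 * (LINT x|lborel. h (x - y) * (D x)\<^sup>2) \<le> max 0 l2 * (c / ?g * ?E D)"
        by (rule le[OF _ I(2)[OF hs D]]) (simp add: h_def)
      moreover have "max 0 l1 * (c / ?g * ?E D) + max 0 l2 * (c / ?g * ?E D) = c * ?E D - m3 * ?E D"
        by (simp add: m3_def algebra_simps add_divide_distrib)
      ultimately show ?thesis using mult_right_mono[OF m(4), of "?E D"] by simp
    qed
    moreover have "(LINT x|lborel. R x * (u x)\<^sup>2) \<le> m / 4 * ?E u"
    proof -
      have "\<bar>l2\<bar> * d + d + \<bar>l1\<bar> * d + d + d = m / 4" unfolding dL[symmetric] L_def by (simp add: algebra_simps)
      with I(2)[OF R u] have "\<bar>LINT x|lborel. R x * (u x)\<^sup>2\<bar> \<le> m / 4 * ?E u" by (simp only:)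
      then show ?thesis by linarith
    qed
    ultimately have "(LINT x|lborel. (V1 x + V2 (x - y)) * (u x)\<^sup>2)
        \<le> (c - m) * (?E A + ?E B + ?E D) + m / 4 * ?E u"
      by (simp add: algebra_simps)
    moreover have "(c - m) * (?E A + ?E B + ?E D) \<le> (c - m) * ?E u + (c + m) * (3 * \<eta> * ?E u)"
    proof -
      have "(c - m) * (?E A + ?E B + ?E D - ?E u) \<le> \<bar>c - m\<bar> * \<bar>?E A + ?E B + ?E D - ?E u\<bar>"
        by (metis abs_ge_self abs_mult)
      also have "\<dots> \<le> (c + m) * (3 * \<eta> * ?E u)"
        using c0 m(1) split by (intro mult_mono) auto
      finally show ?thesis by (simp add: algebra_simps)
    qed
    moreover have "(c + m) * (3 * \<eta> * ?E u) = m / 4 * ?E u"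
    proof -
      have "(c + m) * (3 * \<eta> * ?E u) = (\<eta> * (12 * (m + c))) / 4 * ?E u" by (simp add: algebra_simps)
      then show ?thesis by (simp only: eta1)
    qed
    ultimately show ?thesis by (simp add: algebra_simps)
  qed
  moreover have "0 < max Y1 (max Y2 Y3)" using Y1(1) by simp
  moreover have "0 < m / 2" using m(1) by simp
  ultimately show ?thesis by blast
qed

section \<open>Passage to the energy space\<close>

text \<open>The bridge from the definitions, which integrate against \<open>lebesgue\<close>, to the
  estimates, which concern Borel functions and \<open>lborel\<close>; completeness supplies the
  measurability of \<open>f\<close>.\<close>

lemma integral_lebesgue_AE_borel:
  fixes f g :: "'a::euclidean_space \<Rightarrow> real"
  assumes g: "g \<in> borel_measurable borel" and ae: "AE x in lborel. f x = g x"
  shows "(LINT x|lebesgue. f x) = (LINT x|lborel. g x)"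
proof -
  have gl: "g \<in> borel_measurable lebesgue" using g by (simp add: measurable_completion)
  have ael: "AE x in lebesgue. g x = f x"
    using AE_completion[OF ae] by (rule AE_mp) (auto intro: AE_I2)
  have fl: "f \<in> borel_measurable lebesgue" by (rule borel_measurable_AE[OF gl ael])
  have "(LINT x|lebesgue. f x) = (LINT x|lebesgue. g x)"
    by (rule integral_cong_AE[OF fl gl]) (rule AE_completion[OF ae])
  also have "\<dots> = (LINT x|lborel. g x)" using g by (intro integral_completion) simp
  finally show ?thesis .
qed

lemma AE_lborel_prod_fst_snd:
  assumes "AE x in (lborel :: 'a::euclidean_space measure). P x"
  shows "AE p in (lborel :: ('a \<times> 'a) measure). P (fst p) \<and> P (snd p)"
proof -
  obtain N where N: "N \<in> null_sets lborel" "{x. \<not> P x} \<subseteq> N" using assms unfolding eventually_ae_filter by auto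
  have "N \<times> UNIV \<in> null_sets (lborel \<Otimes>\<^sub>M lborel)" "UNIV \<times> N \<in> null_sets (lborel \<Otimes>\<^sub>M lborel)"
    using N(1) by (auto simp: null_sets_def lborel.emeasure_pair_measure_Times)
  then have "N \<times> UNIV \<union> UNIV \<times> N \<in> null_sets (lborel :: ('a \<times> 'a) measure)"
    unfolding lborel_prod by (rule null_sets.Un)
  then show ?thesis by (rule AE_I') (use N(2) in auto)
qed

lemma gagliardo_prod:
  fixes u :: "'a::euclidean_space \<Rightarrow> real"
  assumes [measurable]: "u \<in> borel_measurable borel"
  shows "gagliardo s u = (\<integral>\<^sup>+p. ennreal ((u (fst p) - u (snd p))\<^sup>2 / norm (fst p - snd p) powr (real DIM('a) + 2 * s)) \<partial>(lborel \<Otimes>\<^sub>M lborel))"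
proof -
  let ?F = "\<lambda>p. ennreal ((u (fst p) - u (snd p))\<^sup>2 / norm (fst p - snd p) powr (real DIM('a) + 2 * s))"
  have "(\<integral>\<^sup>+x. \<integral>\<^sup>+y. ?F (x, y) \<partial>lborel \<partial>lborel) = integral\<^sup>N (lborel \<Otimes>\<^sub>M lborel) ?F"
    by (rule lborel.nn_integral_fst) measurable
  then show ?thesis by (simp add: gagliardo_def)
qed

lemma C_const_nonneg: "0 < s \<Longrightarrow> s < 1 \<Longrightarrow> 0 \<le> C_const N s"
  using C_const_pos[of s N] by simp

lemma Ds2_norm_sq:
  fixes u v :: "'a::euclidean_space \<Rightarrow> real"
  assumes s: "0 < s" "s < 1" and v[measurable]: "v \<in> borel_measurable borel" and ae: "AE x in lborel. u x = v x"
  shows "(Ds2_norm s u)\<^sup>2 = C_const DIM('a) s / 2 * energy s v"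
proof -
  let ?F = "\<lambda>u (p::'a \<times> 'a). \<bar>u (fst p) - u (snd p)\<bar>\<^sup>2 / norm (fst p - snd p) powr (real DIM('a) + 2 * s)"
  have m: "?F v \<in> borel_measurable (lborel \<Otimes>\<^sub>M lborel)" by measurable
  then have m': "?F v \<in> borel_measurable borel" by (simp add: lborel_prod)
  have "(LINT p|lebesgue. ?F u p) = (LINT p|lborel. ?F v p)"
    by (rule integral_lebesgue_AE_borel[OF m'], rule AE_mp[OF AE_lborel_prod_fst_snd[OF ae]]) (auto intro: AE_I2)
  \<comment> \<open>Valid for infinite energy too: both the integral and \<open>enn2real\<close>
    then take the default value 0.\<close>
  also have "\<dots> = enn2real (\<integral>\<^sup>+p. ennreal (?F v p) \<partial>lborel)"
    by (rule integral_eq_nn_integral) (use m' in auto)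
  also have "\<dots> = energy s v"
    unfolding energy_def gagliardo_prod[OF v] by (simp add: lborel_prod)
  finally have "(LINT p|lebesgue. ?F u p) = energy s v" .
  then show ?thesis unfolding Ds2_norm_def using C_const_nonneg[OF s] by simp
qed

lemma Cc_infty_Ds2:
  assumes "u \<in> Cc_infty"
  shows "u \<in> Ds2 s"
  unfolding Ds2_def
proof (intro CollectI conjI exI[of _ "\<lambda>_. u"])
  have "u \<in> borel_measurable lborel" using Cc_infty_borel_measurable[OF assms] by simp
  then show "u \<in> borel_measurable lebesgue" by (rule measurable_completion)
  show "\<forall>e>0. \<exists>M. \<forall>m\<ge>M. \<forall>n\<ge>M. Ds2_norm s (\<lambda>x. u x - u x) < e" by (simp add: Ds2_norm_def)
qed (use assms in auto)

section \<open>Quadratic forms under approximation\<close>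

lemma weighted_square_le:
  fixes f g w \<eta> :: real
  assumes "0 < \<eta>"
  shows "\<bar>w * f\<^sup>2 - w * g\<^sup>2\<bar> \<le> (1 + 1 / \<eta>) * (\<bar>w\<bar> * (f - g)\<^sup>2) + \<eta> * (\<bar>w\<bar> * g\<^sup>2)"
proof -
  have "0 \<le> (\<bar>f - g\<bar> - \<eta> * \<bar>g\<bar>)\<^sup>2 / \<eta>" using assms by simp
  also have "\<dots> = 1 / \<eta> * (f - g)\<^sup>2 + \<eta> * g\<^sup>2 - 2 * \<bar>g\<bar> * \<bar>f - g\<bar>"
    using assms by (simp add: power2_diff[of "\<bar>f - g\<bar>"] power_mult_distrib field_simps) (simp add: power2_eq_square)
  finally have 1: "2 * \<bar>g\<bar> * \<bar>f - g\<bar> \<le> 1 / \<eta> * (f - g)\<^sup>2 + \<eta> * g\<^sup>2" by simp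
  have "f\<^sup>2 - g\<^sup>2 = (f - g)\<^sup>2 + 2 * g * (f - g)" by (simp add: power2_eq_square algebra_simps)
  then have "\<bar>f\<^sup>2 - g\<^sup>2\<bar> \<le> \<bar>(f - g)\<^sup>2\<bar> + \<bar>2 * g * (f - g)\<bar>" by (simp only: abs_triangle_ineq)
  then have "\<bar>f\<^sup>2 - g\<^sup>2\<bar> \<le> (f - g)\<^sup>2 + 2 * \<bar>g\<bar> * \<bar>f - g\<bar>" by (simp add: abs_mult)
  with 1 have "\<bar>f\<^sup>2 - g\<^sup>2\<bar> \<le> (1 + 1 / \<eta>) * (f - g)\<^sup>2 + \<eta> * g\<^sup>2" by (simp add: algebra_simps)
  then have "\<bar>w\<bar> * \<bar>f\<^sup>2 - g\<^sup>2\<bar> \<le> \<bar>w\<bar> * ((1 + 1 / \<eta>) * (f - g)\<^sup>2 + \<eta> * g\<^sup>2)" by (rule mult_left_mono) simp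
  then show ?thesis by (simp add: abs_mult[symmetric] right_diff_distrib) (simp add: algebra_simps)
qed

text \<open>Applied twice: to differences over pairs of points weighted by the jump kernel, which
  gives convergence of the energies, and to the functions themselves weighted by a potential, whose
  sign may change. In the error \<open>(1 + 1 / \<eta>) * d n + \<eta> * G\<close> first
  \<open>\<eta>\<close> is fixed, then \<open>n\<close>.\<close>

lemma weighted_square_tendsto:
  fixes w g :: "'b \<Rightarrow> real" and f :: "nat \<Rightarrow> 'b \<Rightarrow> real"
  assumes [measurable]: "w \<in> borel_measurable M" "g \<in> borel_measurable M" "\<And>n. f n \<in> borel_measurable M"
    and f: "\<And>n. integrable M (\<lambda>x. w x * (f n x)\<^sup>2)"
    and le: "\<And>n. (\<integral>\<^sup>+x. ennreal (\<bar>w x\<bar> * (f n x - g x)\<^sup>2) \<partial>M) \<le> ennreal (d n)" and d: "d \<longlonglongrightarrow> 0" "\<And>n. 0 \<le> d n"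
  shows "integrable M (\<lambda>x. w x * (g x)\<^sup>2)"
    and "(\<lambda>n. LINT x|M. w x * (f n x)\<^sup>2) \<longlonglongrightarrow> (LINT x|M. w x * (g x)\<^sup>2)"
proof -
  have di: "integrable M (\<lambda>x. \<bar>w x\<bar> * (f n x - g x)\<^sup>2)" for n
    by (rule integrableI_bounded) (measurable, use le[of n] in \<open>auto intro: le_less_trans\<close>)
  have dle: "(LINT x|M. \<bar>w x\<bar> * (f n x - g x)\<^sup>2) \<le> d n" for n
    using le[of n] d(2)[of n] by (subst integral_eq_nn_integral) (auto intro: enn2real_leI)
  have fa: "integrable M (\<lambda>x. \<bar>w x\<bar> * (f n x)\<^sup>2)" for n
    using integrable_abs[OF f[of n]] by (simp add: abs_mult)
  have bound: "\<bar>w x * (g x)\<^sup>2\<bar> \<le> 2 * (\<bar>w x\<bar> * (f 0 x)\<^sup>2) + 2 * (\<bar>w x\<bar> * (f 0 x - g x)\<^sup>2)" for x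
    using weighted_square_le[of 1 "\<bar>w x\<bar>" "g x" "f 0 x"] by (simp add: abs_mult power2_commute[of "g x"])
  show gi: "integrable M (\<lambda>x. w x * (g x)\<^sup>2)"
  proof (rule Bochner_Integration.integrable_bound)
    show "integrable M (\<lambda>x. 2 * (\<bar>w x\<bar> * (f 0 x)\<^sup>2) + 2 * (\<bar>w x\<bar> * (f 0 x - g x)\<^sup>2))"
      using fa di by (intro Bochner_Integration.integrable_add integrable_mult_right) auto
    show "AE x in M. norm (w x * (g x)\<^sup>2) \<le> norm (2 * (\<bar>w x\<bar> * (f 0 x)\<^sup>2) + 2 * (\<bar>w x\<bar> * (f 0 x - g x)\<^sup>2))"
      using bound by (intro AE_I2) (auto intro: order_trans)
  qed measurable
  have ga: "integrable M (\<lambda>x. \<bar>w x\<bar> * (g x)\<^sup>2)"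
    using integrable_abs[OF gi] by (simp add: abs_mult)
  define G where "G = (LINT x|M. \<bar>w x\<bar> * (g x)\<^sup>2)"
  have G0: "0 \<le> G" unfolding G_def by (rule integral_nonneg_AE) simp
  have diff: "\<bar>(LINT x|M. w x * (f n x)\<^sup>2) - (LINT x|M. w x * (g x)\<^sup>2)\<bar> \<le> (1 + 1 / \<eta>) * d n + \<eta> * G" if \<eta>: "0 < \<eta>" for \<eta> n
  proof -
    have "\<bar>(LINT x|M. w x * (f n x)\<^sup>2) - (LINT x|M. w x * (g x)\<^sup>2)\<bar> = \<bar>LINT x|M. w x * (f n x)\<^sup>2 - w x * (g x)\<^sup>2\<bar>"
      by (simp add: Bochner_Integration.integral_diff[OF f gi])
    also have "\<dots> \<le> (LINT x|M. \<bar>w x * (f n x)\<^sup>2 - w x * (g x)\<^sup>2\<bar>)" by (rule integral_abs_bound)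
    also have "\<dots> \<le> (LINT x|M. (1 + 1 / \<eta>) * (\<bar>w x\<bar> * (f n x - g x)\<^sup>2) + \<eta> * (\<bar>w x\<bar> * (g x)\<^sup>2))"
      using f gi di ga by (intro integral_mono weighted_square_le \<eta> integrable_abs Bochner_Integration.integrable_diff Bochner_Integration.integrable_add integrable_mult_right) auto
    also have "\<dots> = (1 + 1 / \<eta>) * (LINT x|M. \<bar>w x\<bar> * (f n x - g x)\<^sup>2) + \<eta> * G"
      using di ga by (simp add: G_def)
    also have "\<dots> \<le> (1 + 1 / \<eta>) * d n + \<eta> * G"
      using \<eta> dle by (intro add_right_mono mult_left_mono) (auto simp: add_nonneg_nonneg)
    finally show ?thesis .
  qed
  show "(\<lambda>n. LINT x|M. w x * (f n x)\<^sup>2) \<longlonglongrightarrow> (LINT x|M. w x * (g x)\<^sup>2)"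
  proof (rule LIMSEQ_I)
    fix r :: real assume r: "0 < r"
    \<comment> \<open>The added 1 covers the case \<open>G = 0\<close>.\<close>
    define \<eta> where "\<eta> = r / (2 * (G + 1))"
    have eta: "0 < \<eta>" using r G0 by (simp add: \<eta>_def)
    have "\<eta> * G < r / 2"
    proof -
      have "\<eta> * G < \<eta> * (G + 1)" using eta by simp
      also have "\<dots> = r / 2" using G0 by (simp add: \<eta>_def field_simps)
      finally show ?thesis .
    qed
    moreover have "(\<lambda>n. (1 + 1 / \<eta>) * d n) \<longlonglongrightarrow> (1 + 1 / \<eta>) * 0" by (intro tendsto_intros d)
    then obtain N where N: "\<And>n. N \<le> n \<Longrightarrow> norm ((1 + 1 / \<eta>) * d n - (1 + 1 / \<eta>) * 0) < r / 2"
      using LIMSEQ_D[of _ _ "r / 2"] r by (metis half_gt_zero)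
    have "norm ((LINT x|M. w x * (f n x)\<^sup>2) - (LINT x|M. w x * (g x)\<^sup>2)) < r" if "N \<le> n" for n
      using diff[OF eta, of n] N[OF that] calculation abs_ge_self[of "(1 + 1 / \<eta>) * d n"] unfolding real_norm_def by linarith
    then show "\<exists>no. \<forall>n\<ge>no. norm ((LINT x|M. w x * (f n x)\<^sup>2) - (LINT x|M. w x * (g x)\<^sup>2)) < r" by blast
  qed
qed

text \<open>
  The rate is obtained by passing to a subsequence of the Cauchy sequence; Fatou's lemma transfers
  the bounds on differences of test functions to the limit.
\<close>

lemma Ds2_approximation:
  fixes u :: "'a::euclidean_space \<Rightarrow> real"
  assumes s: "0 < s" "s < 1" and u: "u \<in> Ds2 s"
  shows "\<exists>v \<psi>. v \<in> borel_measurable borel \<and> (AE x in lborel. u x = v x) \<and> (\<forall>k. \<psi> k \<in> Cc_infty) \<and>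
     (\<forall>k. gagliardo s (\<lambda>x. \<psi> k x - v x) \<le> ennreal (1 / real (Suc k))) \<and>
     (\<forall>P K k. form_bdd s P K \<longrightarrow> (\<integral>\<^sup>+x. ennreal (\<bar>P x\<bar> * (\<psi> k x - v x)\<^sup>2) \<partial>lborel) \<le> ennreal (K / real (Suc k)))"
proof -
  obtain \<phi> where \<phi>: "\<And>n. \<phi> n \<in> Cc_infty"
    and cauchy: "\<And>e. 0 < e \<Longrightarrow> \<exists>M. \<forall>m\<ge>M. \<forall>n\<ge>M. Ds2_norm s (\<lambda>x. \<phi> m x - \<phi> n x) < e"
    and lim: "AE x in lebesgue. (\<lambda>n. \<phi> n x) \<longlonglongrightarrow> u x"
    using u by (auto simp: Ds2_def)
  note \<phi>m[measurable] = Cc_infty_borel_measurable[OF \<phi>]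
  \<comment> \<open>A Borel representative of \<open>u\<close>: the operator \<open>lim\<close> on a
    sequence of Borel functions is Borel measurable, including the points without
    convergence.\<close>
  define v where "v x = lim (\<lambda>n. \<phi> n x)" for x
  have v[measurable]: "v \<in> borel_measurable borel" unfolding v_def[abs_def] by measurable
  have lim': "AE x in lborel. (\<lambda>n. \<phi> n x) \<longlonglongrightarrow> u x" using lim by (simp add: AE_completion_iff)
  have uv: "AE x in lborel. u x = v x"
    by (rule AE_mp[OF lim']) (auto simp: v_def limI intro!: AE_I2)
  have limv: "AE x in lborel. (\<lambda>n. \<phi> n x) \<longlonglongrightarrow> v x"
    by (rule AE_mp[OF lim']) (auto simp: v_def limI intro!: AE_I2)
  have c0: "0 < C_const DIM('a) s / 2" using C_const_pos[OF s] by simp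
  have "\<exists>M. \<forall>m\<ge>M. \<forall>n\<ge>M. gagliardo s (\<lambda>x. \<phi> m x - \<phi> n x) \<le> ennreal (1 / real (Suc k))" for k
  proof -
    let ?c = "C_const DIM('a) s / 2"
    have "0 < sqrt (?c / real (Suc k))" using c0 by simp
    from cauchy[OF this] obtain M where M: "\<And>m n. M \<le> m \<Longrightarrow> M \<le> n \<Longrightarrow> Ds2_norm s (\<lambda>x. \<phi> m x - \<phi> n x) < sqrt (?c / real (Suc k))" by blast
    have "gagliardo s (\<lambda>x. \<phi> m x - \<phi> n x) \<le> ennreal (1 / real (Suc k))" if "M \<le> m" "M \<le> n" for m n
    proof -
      have D: "(\<lambda>x. \<phi> m x - \<phi> n x) \<in> Cc_infty" by (rule Cc_infty_diff[OF \<phi> \<phi>])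
      have nn: "0 \<le> Ds2_norm s (\<lambda>x. \<phi> m x - \<phi> n x)"
        unfolding Ds2_norm_def using c0 by (intro real_sqrt_ge_zero mult_nonneg_nonneg integral_nonneg_AE) auto
      have "?c * energy s (\<lambda>x. \<phi> m x - \<phi> n x) = (Ds2_norm s (\<lambda>x. \<phi> m x - \<phi> n x))\<^sup>2"
        by (rule Ds2_norm_sq[OF s Cc_infty_borel_measurable[OF D], symmetric]) simp
      also have "\<dots> \<le> (sqrt (?c / real (Suc k)))\<^sup>2"
        using M[OF that] nn by (intro power_mono) auto
      also have "\<dots> = ?c * (1 / real (Suc k))" using c0 by simp
      finally have "energy s (\<lambda>x. \<phi> m x - \<phi> n x) \<le> 1 / real (Suc k)" using c0 by (simp only: mult_le_cancel_left_pos)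
      then show ?thesis unfolding gagliardo_energy[OF s D] by (rule ennreal_leI)
    qed
    then show ?thesis by blast
  qed
  then obtain M where M: "\<And>k m n. M k \<le> m \<Longrightarrow> M k \<le> n \<Longrightarrow> gagliardo s (\<lambda>x. \<phi> m x - \<phi> n x) \<le> ennreal (1 / real (Suc k))" by metis
  define \<psi> where "\<psi> k = \<phi> (M k)" for k
  have \<psi>: "\<psi> k \<in> Cc_infty" for k unfolding \<psi>_def by (rule \<phi>)
  note \<psi>m[measurable] = Cc_infty_borel_measurable[OF \<psi>]
  have G: "gagliardo s (\<lambda>x. \<psi> k x - \<phi> n x) \<le> ennreal (1 / real (Suc k))" if "M k \<le> n" for k n
    unfolding \<psi>_def using M[of k "M k" n] that by simp
  \<comment> \<open>The Cauchy bounds hold only from index \<open>M k\<close> on, which is enough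
    for a lower limit.\<close>
  have ev: "liminf (\<lambda>n. a n) \<le> b" if "\<And>n. M k \<le> n \<Longrightarrow> a n \<le> b" for a :: "nat \<Rightarrow> ennreal" and b k
  proof -
    have "liminf a \<le> liminf (\<lambda>n. b)"
      by (rule Liminf_mono) (use that in \<open>auto simp: eventually_sequentially\<close>)
    then show ?thesis by (simp add: Liminf_const)
  qed
  have A: "gagliardo s (\<lambda>x. \<psi> k x - v x) \<le> ennreal (1 / real (Suc k))" for k
  proof -
    let ?F = "\<lambda>w (x::'a) y. ennreal (((\<psi> k x - w x) - (\<psi> k y - w y))\<^sup>2 / norm (x - y) powr (real DIM('a) + 2 * s))"
    have t: "?F v x y = liminf (\<lambda>n. ?F (\<phi> n) x y)" if "(\<lambda>n. \<phi> n x) \<longlonglongrightarrow> v x" "(\<lambda>n. \<phi> n y) \<longlonglongrightarrow> v y" for x y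
    proof (rule lim_imp_Liminf[symmetric])
      have "(\<lambda>n. ((\<psi> k x - \<phi> n x) - (\<psi> k y - \<phi> n y))\<^sup>2 * inverse (norm (x - y) powr (real DIM('a) + 2 * s)))
        \<longlonglongrightarrow> ((\<psi> k x - v x) - (\<psi> k y - v y))\<^sup>2 * inverse (norm (x - y) powr (real DIM('a) + 2 * s))"
        by (intro tendsto_intros that)
      then show "(\<lambda>n. ?F (\<phi> n) x y) \<longlonglongrightarrow> ?F v x y" unfolding divide_inverse by (rule tendsto_ennrealI)
    qed simp
    have "gagliardo s (\<lambda>x. \<psi> k x - v x) = (\<integral>\<^sup>+x. \<integral>\<^sup>+y. liminf (\<lambda>n. ?F (\<phi> n) x y) \<partial>lborel \<partial>lborel)"
      unfolding gagliardo_def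
      by (rule nn_integral_cong_AE, rule AE_mp[OF limv], rule AE_I2, rule impI,
          rule nn_integral_cong_AE, rule AE_mp[OF limv], rule AE_I2, rule impI, rule t)
    also have "\<dots> \<le> (\<integral>\<^sup>+x. liminf (\<lambda>n. \<integral>\<^sup>+y. ?F (\<phi> n) x y \<partial>lborel) \<partial>lborel)"
      by (rule nn_integral_mono, rule nn_integral_liminf) measurable
    also have "\<dots> \<le> liminf (\<lambda>n. \<integral>\<^sup>+x. \<integral>\<^sup>+y. ?F (\<phi> n) x y \<partial>lborel \<partial>lborel)"
      by (rule nn_integral_liminf) measurable
    also have "\<dots> = liminf (\<lambda>n. gagliardo s (\<lambda>x. \<psi> k x - \<phi> n x))" by (simp only: gagliardo_def)
    also have "\<dots> \<le> ennreal (1 / real (Suc k))" by (rule ev[of k]) (rule G)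
    finally show ?thesis .
  qed
  have B: "(\<integral>\<^sup>+x. ennreal (\<bar>P x\<bar> * (\<psi> k x - v x)\<^sup>2) \<partial>lborel) \<le> ennreal (K / real (Suc k))" if P: "form_bdd s P K" for P K k
  proof -
    note [measurable] = form_bdd_measurable[OF P]
    have K0: "0 \<le> K" using P by (simp add: form_bdd_def)
    let ?F = "\<lambda>w (x::'a). ennreal (\<bar>P x\<bar> * (\<psi> k x - w x)\<^sup>2)"
    have t: "?F v x = liminf (\<lambda>n. ?F (\<phi> n) x)" if "(\<lambda>n. \<phi> n x) \<longlonglongrightarrow> v x" for x
      by (rule lim_imp_Liminf[symmetric], simp, intro tendsto_ennrealI tendsto_intros that)
    have "(\<integral>\<^sup>+x. ?F v x \<partial>lborel) = (\<integral>\<^sup>+x. liminf (\<lambda>n. ?F (\<phi> n) x) \<partial>lborel)"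
      by (rule nn_integral_cong_AE, rule AE_mp[OF limv], rule AE_I2, rule impI, rule t)
    also have "\<dots> \<le> liminf (\<lambda>n. \<integral>\<^sup>+x. ?F (\<phi> n) x \<partial>lborel)"
      by (rule nn_integral_liminf) measurable
    also have "\<dots> \<le> ennreal K * ennreal (1 / real (Suc k))"
    proof (rule ev[of k])
      fix n assume n: "M k \<le> n"
      have "(\<integral>\<^sup>+x. ?F (\<phi> n) x \<partial>lborel) \<le> ennreal K * gagliardo s (\<lambda>x. \<psi> k x - \<phi> n x)"
      proof -
        have "\<forall>u\<in>Cc_infty. (\<integral>\<^sup>+x. ennreal (\<bar>P x\<bar> * (u x)\<^sup>2) \<partial>lborel) \<le> ennreal K * gagliardo s u"
          using P by (simp add: form_bdd_def)
        from bspec[OF this Cc_infty_diff[OF \<psi> \<phi>]] show ?thesis .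
      qed
      also have "\<dots> \<le> ennreal K * ennreal (1 / real (Suc k))" by (rule mult_left_mono[OF G[OF n]]) simp
      finally show "(\<integral>\<^sup>+x. ?F (\<phi> n) x \<partial>lborel) \<le> ennreal K * ennreal (1 / real (Suc k))" .
    qed
    also have "\<dots> = ennreal (K / real (Suc k))" using K0 by (simp add: ennreal_mult[symmetric])
    finally show ?thesis .
  qed
  show ?thesis using v uv \<psi> A B by blast
qed

text \<open>The representative \<open>v\<close> is chosen before the potential, so the inequality
  for \<open>P\<close> and the Hardy inequality can be used for the same function.\<close>

lemma Ds2_form_limit:
  fixes u :: "'a::euclidean_space \<Rightarrow> real"
  assumes s: "0 < s" "s < 1" and u: "u \<in> Ds2 s"
  shows "\<exists>v. v \<in> borel_measurable borel \<and> (AE x in lborel. u x = v x) \<and>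
    (\<forall>P K c m. form_bdd s P K \<longrightarrow>
      (\<forall>w\<in>Cc_infty. m * energy s w \<le> c * energy s w - (LINT x|lborel. P x * (w x)\<^sup>2)) \<longrightarrow>
      integrable lborel (\<lambda>x. P x * (v x)\<^sup>2) \<and> m * energy s v \<le> c * energy s v - (LINT x|lborel. P x * (v x)\<^sup>2))"
proof -
  from Ds2_approximation[OF s u] obtain v \<psi> where v[measurable]: "v \<in> borel_measurable borel" and uv: "AE x in lborel. u x = v x"
    and \<psi>: "\<And>k. \<psi> k \<in> Cc_infty"
    and G: "\<And>k. gagliardo s (\<lambda>x. \<psi> k x - v x) \<le> ennreal (1 / real (Suc k))"
    and B: "\<And>P K k. form_bdd s P K \<Longrightarrow> (\<integral>\<^sup>+x. ennreal (\<bar>P x\<bar> * (\<psi> k x - v x)\<^sup>2) \<partial>lborel) \<le> ennreal (K / real (Suc k))"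
    by (elim exE conjE) blast
  note [measurable] = Cc_infty_borel_measurable[OF \<psi>]
  let ?M = "lborel \<Otimes>\<^sub>M (lborel :: 'a measure)"
  define k where "k p = 1 / norm (fst p - snd p) powr (real DIM('a) + 2 * s)" for p :: "'a \<times> 'a"
  have km[measurable]: "k \<in> borel_measurable ?M" unfolding k_def[abs_def] by measurable
  have k0: "0 \<le> k p" for p by (simp add: k_def)
  have gk: "gagliardo s w = (\<integral>\<^sup>+p. ennreal (k p * (w (fst p) - w (snd p))\<^sup>2) \<partial>?M)" if "w \<in> borel_measurable borel" for w :: "'a \<Rightarrow> real"
    unfolding gagliardo_prod[OF that] k_def by simp
  have ek: "energy s w = (LINT p|?M. k p * (w (fst p) - w (snd p))\<^sup>2)" if [measurable]: "w \<in> borel_measurable borel" for w :: "'a \<Rightarrow> real"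
    unfolding energy_def gk[OF that] by (subst integral_eq_nn_integral) (measurable, auto simp: k0)
  have d: "(\<lambda>n. K / real (Suc n)) \<longlonglongrightarrow> 0" for K :: real
    using tendsto_mult[OF tendsto_const[of K] LIMSEQ_inverse_real_of_nat] by (simp add: divide_inverse)
  have fint: "integrable ?M (\<lambda>p. k p * (\<psi> n (fst p) - \<psi> n (snd p))\<^sup>2)" for n
  proof (rule integrableI_bounded)
    have "(\<integral>\<^sup>+p. ennreal (norm (k p * (\<psi> n (fst p) - \<psi> n (snd p))\<^sup>2)) \<partial>?M) = gagliardo s (\<psi> n)"
      by (subst gk) (measurable, simp add: k0 abs_mult)
    also have "\<dots> < \<infinity>" by (rule gagliardo_Cc_infty_finite[OF s \<psi>])
    finally show "(\<integral>\<^sup>+p. ennreal (norm (k p * (\<psi> n (fst p) - \<psi> n (snd p))\<^sup>2)) \<partial>?M) < \<infinity>" .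
  qed measurable
  have fle: "(\<integral>\<^sup>+p. ennreal (\<bar>k p\<bar> * ((\<psi> n (fst p) - \<psi> n (snd p)) - (v (fst p) - v (snd p)))\<^sup>2) \<partial>?M) \<le> ennreal (1 / real (Suc n))" for n
  proof -
    have "(\<integral>\<^sup>+p. ennreal (\<bar>k p\<bar> * ((\<psi> n (fst p) - \<psi> n (snd p)) - (v (fst p) - v (snd p)))\<^sup>2) \<partial>?M) = gagliardo s (\<lambda>x. \<psi> n x - v x)"
      by (subst gk) (measurable, simp add: k0 algebra_simps)
    then show ?thesis using G[of n] by simp
  qed
  have conv: "(\<lambda>n. energy s (\<psi> n)) \<longlonglongrightarrow> energy s v"
  proof -
    have "(\<lambda>p. v (fst p) - v (snd p)) \<in> borel_measurable ?M" "\<And>n. (\<lambda>p. \<psi> n (fst p) - \<psi> n (snd p)) \<in> borel_measurable ?M"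
      by measurable
    from weighted_square_tendsto(2)[OF km this fint fle d] show ?thesis
      unfolding ek[OF v] ek[OF Cc_infty_borel_measurable[OF \<psi>]] by simp
  qed
  have "integrable lborel (\<lambda>x. P x * (v x)\<^sup>2) \<and> m * energy s v \<le> c * energy s v - (LINT x|lborel. P x * (v x)\<^sup>2)"
    if P: "form_bdd s P K" and co: "\<forall>w\<in>Cc_infty. m * energy s w \<le> c * energy s w - (LINT x|lborel. P x * (w x)\<^sup>2)" for P K c m
  proof
    have Pm: "P \<in> borel_measurable lborel" using form_bdd_measurable[OF P] by simp
    have vm: "v \<in> borel_measurable lborel" and \<psi>m: "\<And>n. \<psi> n \<in> borel_measurable lborel" by simp_all
    have K0: "0 \<le> K / real (Suc n)" for n using P by (simp add: form_bdd_def)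
    note W = weighted_square_tendsto[OF Pm vm \<psi>m form_bdd_integral(1)[OF s P \<psi>] B[OF P] d K0]
    show "integrable lborel (\<lambda>x. P x * (v x)\<^sup>2)" by (rule W(1))
    have c1: "(\<lambda>n. c * energy s (\<psi> n) - (LINT x|lborel. P x * (\<psi> n x)\<^sup>2)) \<longlonglongrightarrow> c * energy s v - (LINT x|lborel. P x * (v x)\<^sup>2)"
      by (intro tendsto_intros conv W(2))
    have c2: "(\<lambda>n. m * energy s (\<psi> n)) \<longlonglongrightarrow> m * energy s v" by (intro tendsto_intros conv)
    show "m * energy s v \<le> c * energy s v - (LINT x|lborel. P x * (v x)\<^sup>2)"
      by (rule LIMSEQ_le[OF c2 c1]) (use co \<psi> in blast)
  qed
  then show ?thesis using v uv by blast
qed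

section \<open>Positivity of \<open>mu\<close> as coercivity on test functions\<close>

lemma energy_AE_zero:
  fixes v :: "'a::euclidean_space \<Rightarrow> real"
  assumes "AE x in lborel. v x = 0"
  shows "energy s v = 0"
proof -
  have "gagliardo s v = (\<integral>\<^sup>+(x::'a). \<integral>\<^sup>+(y::'a). 0 \<partial>lborel \<partial>lborel)"
    unfolding gagliardo_def
    by (rule nn_integral_cong_AE, rule AE_mp[OF assms], rule AE_I2, rule impI,
        rule nn_integral_cong_AE, rule AE_mp[OF assms], rule AE_I2) simp
  then show ?thesis by (simp add: energy_def)
qed

lemma mu_pos_imp_coercive:
  fixes V P :: "'a::euclidean_space \<Rightarrow> real"
  assumes s: "0 < s" "s < 1" and VP: "AE x in lborel. V x = P x" and P: "form_bdd s P K" and mu: "0 < mu s V"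
  shows "\<exists>m>0. \<forall>u\<in>Cc_infty. m * energy s u \<le> C_const DIM('a) s / 2 * energy s u - (LINT x|lborel. P x * (u x)\<^sup>2)"
proof -
  let ?c = "C_const DIM('a) s / 2"
  have c0: "0 < ?c" using C_const_pos[OF s] by simp
  note [measurable] = form_bdd_measurable[OF P]
  \<comment> \<open>A real number strictly below \<open>mu\<close>, which is itself an extended
    real; strictness is used to exclude zero energy.\<close>
  obtain m where m: "0 < ereal m" "ereal m < mu s V" using ereal_dense2[OF mu] by auto
  have "m * ?c * energy s u \<le> ?c * energy s u - (LINT x|lborel. P x * (u x)\<^sup>2)" if u: "u \<in> Cc_infty" for u :: "'a \<Rightarrow> real"
  proof (cases "AE x in lborel. u x = 0")
    case True
    have "(LINT x|lborel. P x * (u x)\<^sup>2) = 0"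
      by (rule integral_eq_zero_AE, rule AE_mp[OF True]) auto
    then show ?thesis by (simp add: energy_AE_zero[OF True])
  next
    case False
    note [measurable] = Cc_infty_borel_measurable[OF u]
    have n: "(Ds2_norm s u)\<^sup>2 = ?c * energy s u"
      by (rule Ds2_norm_sq[OF s Cc_infty_borel_measurable[OF u]]) simp
    have i: "(LINT x|lebesgue. V x * (u x)\<^sup>2) = (LINT x|lborel. P x * (u x)\<^sup>2)"
      by (rule integral_lebesgue_AE_borel, measurable, rule AE_mp[OF VP]) auto
    have "\<not> (AE x in lebesgue. u x = 0)" using False by (simp add: AE_completion_iff)
    then have le: "mu s V \<le> ereal (((Ds2_norm s u)\<^sup>2 - (LINT x|lebesgue. V x * (u x)\<^sup>2)) / (Ds2_norm s u)\<^sup>2)"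
      unfolding mu_def using Cc_infty_Ds2[OF u] by (intro INF_lower) auto
    have q: "m < (?c * energy s u - (LINT x|lborel. P x * (u x)\<^sup>2)) / (?c * energy s u)"
      using order_less_le_trans[OF m(2) le] unfolding n i by (simp only: less_ereal.simps)
    \<comment> \<open>With zero energy the quotient would be 0 by the convention for division by
      zero, contradicting that it exceeds \<open>m > 0\<close>.\<close>
    have "0 < ?c * energy s u"
    proof (rule ccontr)
      assume "\<not> 0 < ?c * energy s u"
      then have z: "?c * energy s u = 0" using mult_nonneg_nonneg[OF less_imp_le[OF c0] energy_nonneg[of s u]] by linarith
      from q have "m < 0" unfolding z by (simp only: div_by_0)
      with m(1) show False by simp
    qed
    from q have "m * (?c * energy s u) < ?c * energy s u - (LINT x|lborel. P x * (u x)\<^sup>2)"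
      by (simp only: pos_less_divide_eq[OF \<open>0 < ?c * energy s u\<close>])
    then show ?thesis by (simp add: mult.assoc)
  qed
  then show ?thesis using m(1) c0 by (intro exI[of _ "m * ?c"]) auto
qed

lemma coercive_imp_mu_pos:
  fixes V P :: "'a::euclidean_space \<Rightarrow> real"
  assumes s: "0 < s" "s < 1" and N: "2 * s < real DIM('a)" and VP: "AE x in lborel. V x = P x" and P: "form_bdd s P K"
    and m: "0 < m" "\<forall>u\<in>Cc_infty. m * energy s u \<le> C_const DIM('a) s / 2 * energy s u - (LINT x|lborel. P x * (u x)\<^sup>2)"
  shows "0 < mu s V"
proof -
  let ?c = "C_const DIM('a) s / 2" and ?H = "C_const DIM('a) s / 2 / gamma_H DIM('a) s"
  let ?h = "\<lambda>x::'a. 1 / norm x powr (2 * s)"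
  have c0: "0 < ?c" using C_const_pos[OF s] by simp
  note Pm[measurable] = form_bdd_measurable[OF P]
  have hardy: "form_bdd s ?h ?H" by (rule form_bdd_hardy[OF s N])
  have "ereal (m / ?c) \<le> ereal (((Ds2_norm s u)\<^sup>2 - (LINT x|lebesgue. V x * (u x)\<^sup>2)) / (Ds2_norm s u)\<^sup>2)"
    if u: "u \<in> Ds2 s" "\<not> (AE x in lebesgue. u x = 0)" for u :: "'a \<Rightarrow> real"
  proof -
    from Ds2_form_limit[OF s u(1)] obtain v where v[measurable]: "v \<in> borel_measurable borel" and uv: "AE x in lborel. u x = v x"
      and L: "\<And>P K c m. form_bdd s P K \<Longrightarrow>
      (\<forall>w\<in>Cc_infty. m * energy s w \<le> c * energy s w - (LINT x|lborel. P x * (w x)\<^sup>2)) \<Longrightarrow>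
      integrable lborel (\<lambda>x. P x * (v x)\<^sup>2) \<and> m * energy s v \<le> c * energy s v - (LINT x|lborel. P x * (v x)\<^sup>2)"
      by (elim exE conjE) blast
    have n: "(Ds2_norm s u)\<^sup>2 = ?c * energy s v" by (rule Ds2_norm_sq[OF s v uv])
    have i: "(LINT x|lebesgue. V x * (u x)\<^sup>2) = (LINT x|lborel. P x * (v x)\<^sup>2)"
      by (rule integral_lebesgue_AE_borel, measurable, rule AE_mp[OF VP], rule AE_mp[OF uv]) auto
    have q: "m * energy s v \<le> ?c * energy s v - (LINT x|lborel. P x * (v x)\<^sup>2)" using L[OF P m(2)] by simp
    have h: "integrable lborel (\<lambda>x. ?h x * (v x)\<^sup>2)" "(LINT x|lborel. ?h x * (v x)\<^sup>2) \<le> ?H * energy s v"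
    proof -
      have "\<forall>w\<in>Cc_infty. 0 * energy s w \<le> ?H * energy s w - (LINT x|lborel. ?h x * (w x)\<^sup>2)"
        using form_bdd_integral(2)[OF s hardy] by (auto dest: abs_le_D1)
      from L[OF hardy this] show "integrable lborel (\<lambda>x. ?h x * (v x)\<^sup>2)" "(LINT x|lborel. ?h x * (v x)\<^sup>2) \<le> ?H * energy s v" by auto
    qed
    \<comment> \<open>The Hardy inequality for \<open>v\<close> separates points: zero energy makes
      the weighted integral of \<open>v\<^sup>2\<close> vanish, hence \<open>v = 0\<close> and
      \<open>u = 0\<close> almost everywhere.\<close>
    have E: "0 < energy s v"
    proof (rule ccontr)
      assume "\<not> 0 < energy s v"
      then have "energy s v = 0" using energy_nonneg[of s v] by linarith
      then have "(LINT x|lborel. ?h x * (v x)\<^sup>2) \<le> 0" using h(2) by simp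
      moreover have "0 \<le> (LINT x|lborel. ?h x * (v x)\<^sup>2)" by (rule integral_nonneg_AE) simp
      ultimately have "(LINT x|lborel. ?h x * (v x)\<^sup>2) = 0" by (rule antisym)
      then have "AE x in lborel. ?h x * (v x)\<^sup>2 = 0"
        using integral_nonneg_eq_0_iff_AE[OF h(1)] by simp
      with AE_lborel_singleton[of "0::'a"] uv have "AE x in lborel. u x = 0"
        by eventually_elim auto
      then show False using u(2) by (simp add: AE_completion)
    qed
    have "m / ?c \<le> (?c * energy s v - (LINT x|lborel. P x * (v x)\<^sup>2)) / (?c * energy s v)"
    proof -
      have "m / ?c = m * energy s v / (?c * energy s v)" using E c0 by simp
      also have "\<dots> \<le> (?c * energy s v - (LINT x|lborel. P x * (v x)\<^sup>2)) / (?c * energy s v)"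
        using q E c0 by (intro divide_right_mono) auto
      finally show ?thesis .
    qed
    then show ?thesis by (simp add: n i)
  qed
  then have "ereal (m / ?c) \<le> mu s V" unfolding mu_def by (intro INF_greatest) auto
  moreover have "0 < ereal (m / ?c)" using m(1) c0 by simp
  ultimately show ?thesis by (rule order_less_le_trans[rotated])
qed

text \<open>Each pole and the correction inside \<open>ball 0 R\<close> have bounded support, and
  the \<open>L\<^sup>p\<close> part has small tails, so all of them go into \<open>T\<close>.
  Equality holds only almost everywhere because \<open>W\<close> is replaced by a Borel
  representative.\<close>

lemma form_tail_Theta_potential:
  fixes W :: "'a::euclidean_space \<Rightarrow> real"
  assumes s: "0 < s" "s < 1" and N: "2 * s < real DIM('a)" and Th: "Theta_params s k lam a r lam_inf R W"
  shows "\<exists>P T. form_tail s T \<and> (\<forall>x. P x = lam_inf * (1 / norm x powr (2 * s)) + T x) \<and>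
    (AE x in lborel. Theta_potential s k lam a r lam_inf R W x = P x)"
proof -
  let ?p = "real DIM('a) / (2 * s)"
  define h where "h x = 1 / norm x powr (2 * s)" for x :: 'a
  define H where "H = C_const DIM('a) s / 2 / gamma_H DIM('a) s"
  have hardy: "form_bdd s h H" unfolding h_def[abs_def] H_def by (rule form_bdd_hardy[OF s N])
  have hm[measurable]: "h \<in> borel_measurable borel" by (rule form_bdd_measurable[OF hardy])
  have ball[measurable]: "ball z t \<in> sets borel" for z :: 'a and t by simp
  have loc: "form_tail s (\<lambda>x. l * (indicator (ball z t) x * h (x - z)))" for l t :: real and z :: 'a
  proof (rule form_tail_compact_support)
    show "form_bdd s (\<lambda>x. l * (indicator (ball z t) x * h (x - z))) (\<bar>l\<bar> * H)"
      by (rule form_bdd_cmult, rule form_bdd_mono[OF form_bdd_shift[OF hardy, of z]]) (measurable, auto simp: indicator_def)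
    fix x :: 'a assume "norm z + t \<le> norm x"
    moreover have "norm x \<le> norm z + norm (x - z)" by (metis add.commute norm_triangle_sub)
    ultimately have "x \<notin> ball z t" by (auto simp: dist_norm norm_minus_commute)
    then show "l * (indicator (ball z t) x * h (x - z)) = 0" by simp
  qed
  have W: "W \<in> borel_measurable lebesgue" "integrable lebesgue (\<lambda>x. \<bar>W x\<bar> powr ?p)"
    using Th by (auto simp: Theta_params_def Lp_fun_def)
  then obtain W' where W'[measurable]: "W' \<in> borel_measurable borel" and WW': "AE x in lborel. W x = W' x"
    using completion_ex_borel_measurable_real[of W lborel] by auto
  have "(\<integral>\<^sup>+x. ennreal (\<bar>W' x\<bar> powr ?p) \<partial>lborel) < \<infinity>"
  proof -
    have "(\<integral>\<^sup>+x. ennreal (\<bar>W' x\<bar> powr ?p) \<partial>lborel) = (\<integral>\<^sup>+x. ennreal (\<bar>W x\<bar> powr ?p) \<partial>lborel)"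
      by (rule nn_integral_cong_AE, rule AE_mp[OF WW']) auto
    also have "\<dots> = (\<integral>\<^sup>+x. ennreal (norm (\<bar>W x\<bar> powr ?p)) \<partial>lebesgue)" by (simp add: nn_integral_completion)
    also have "\<dots> < \<infinity>" using W(2) by (simp add: integrable_iff_bounded)
    finally show ?thesis .
  qed
  then have tW: "form_tail s W'" by (rule form_tail_Lp[OF s(1) N W'])
  \<comment> \<open>The exterior Hardy term is the full one minus its restriction to
    \<open>ball 0 R\<close>; writing \<open>h (x - 0)\<close> makes that correction another instance
    of \<open>loc\<close>.\<close>
  define T where "T x = ((\<Sum>i<k. lam i * (indicator (ball (a i) (r i)) x * h (x - a i))) + (- lam_inf) * (indicator (ball 0 R) x * h (x - 0))) + W' x" for x
  have "form_tail s T"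
    unfolding T_def[abs_def] by (intro form_tail_add form_tail_sum loc tW) auto
  moreover have "AE x in lborel. Theta_potential s k lam a r lam_inf R W x = lam_inf * h x + T x"
  proof (rule AE_mp[OF WW'], rule AE_I2, rule impI)
    fix x assume "W x = W' x"
    then show "Theta_potential s k lam a r lam_inf R W x = lam_inf * h x + T x"
      by (simp add: Theta_potential_def T_def h_def indicator_def)
  qed
  ultimately show ?thesis by (intro exI[of _ "\<lambda>x. lam_inf * h x + T x"] exI[of _ T]) (simp add: h_def)
qed

theorem theorem1p3:
  fixes s :: real
    and k1 k2 :: nat
    and lam1 lam2 :: "nat \<Rightarrow> real"
    and a1 a2 :: "nat \<Rightarrow> 'a::euclidean_space"
    and r1 r2 :: "nat \<Rightarrow> real"
    and lam_inf1 lam_inf2 R1 R2 :: real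
    and W1 W2 V1 V2 :: "'a \<Rightarrow> real"
  assumes "0 < s" and "s < 1" and "2 * s < real DIM('a)"
    and "Theta_params s k1 lam1 a1 r1 lam_inf1 R1 W1"
    and "Theta_params s k2 lam2 a2 r2 lam_inf2 R2 W2"
    and "V1 = Theta_potential s k1 lam1 a1 r1 lam_inf1 R1 W1"
    and "V2 = Theta_potential s k2 lam2 a2 r2 lam_inf2 R2 W2"
    and "0 < mu s V1" and "0 < mu s V2"
    and "lam_inf1 + lam_inf2 < gamma_H DIM('a) s"
  shows "\<exists>R>0. \<forall>y. y \<in> UNIV - closure (ball 0 R) \<longrightarrow> 0 < mu s (\<lambda>x. V1 x + V2 (x - y))"
proof -
  note s = assms(1,2) and N = assms(3)
  let ?c = "C_const DIM('a) s / 2" and ?H = "C_const DIM('a) s / 2 / gamma_H DIM('a) s"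
  have hardy: "form_bdd s (\<lambda>x::'a. 1 / norm x powr (2 * s)) ?H" by (rule form_bdd_hardy[OF s N])
  from form_tail_Theta_potential[OF s N assms(4)] obtain P1 T1 where
    T1: "form_tail s T1" and P1: "\<And>x. P1 x = lam_inf1 * (1 / norm x powr (2 * s)) + T1 x" and VP1: "AE x in lborel. V1 x = P1 x"
    unfolding assms(6) by blast
  from form_tail_Theta_potential[OF s N assms(5)] obtain P2 T2 where
    T2: "form_tail s T2" and P2: "\<And>x. P2 x = lam_inf2 * (1 / norm x powr (2 * s)) + T2 x" and VP2: "AE x in lborel. V2 x = P2 x"
    unfolding assms(7) by blast
  obtain K1 K2 where K: "form_bdd s T1 K1" "form_bdd s T2 K2" using T1 T2 by (auto simp: form_tail_def)
  have b1: "form_bdd s P1 (\<bar>lam_inf1\<bar> * ?H + K1)" unfolding P1[abs_def] by (intro form_bdd_plus form_bdd_cmult hardy K)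
  have b2: "form_bdd s P2 (\<bar>lam_inf2\<bar> * ?H + K2)" unfolding P2[abs_def] by (intro form_bdd_plus form_bdd_cmult hardy K)
  obtain m1 where m1: "0 < m1" "\<And>u. u \<in> Cc_infty \<Longrightarrow> m1 * energy s u \<le> ?c * energy s u - (LINT x|lborel. P1 x * (u x)\<^sup>2)"
    using mu_pos_imp_coercive[OF s VP1 b1 assms(8)] by blast
  obtain m2 where m2: "0 < m2" "\<And>u. u \<in> Cc_infty \<Longrightarrow> m2 * energy s u \<le> ?c * energy s u - (LINT x|lborel. P2 x * (u x)\<^sup>2)"
    using mu_pos_imp_coercive[OF s VP2 b2 assms(9)] by blast
  have l: "lam_inf1 < gamma_H DIM('a) s" "lam_inf2 < gamma_H DIM('a) s"
    using assms(4,5) by (auto simp: Theta_params_def)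
  obtain Y m where Y: "0 < Y" "0 < m" and co: "\<And>y. Y \<le> norm y \<Longrightarrow> \<forall>u\<in>Cc_infty.
     m * energy s u \<le> ?c * energy s u - (LINT x|lborel. (P1 x + P2 (x - y)) * (u x)\<^sup>2)"
    using form_coercive_sum[OF s N T1 T2 P1 P2 l assms(10) refl m1 m2] by blast
  have "0 < mu s (\<lambda>x. V1 x + V2 (x - y))" if y: "y \<in> UNIV - closure (ball 0 Y)" for y
  proof -
    have "Y \<le> norm y" using y Y(1) by (auto simp: closure_ball dist_norm)
    moreover have "AE x in lborel. V2 (x - y) = P2 (x - y)"
    proof -
      \<comment> \<open>The exceptional set is translated by \<open>y\<close>; translation
        invariance of \<open>lborel\<close> keeps it null.\<close>
      have "AE x in distr lborel borel ((+) (- y)). V2 x = P2 x" unfolding lborel_distr_plus by (rule VP2)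
      from AE_distrD[OF _ this] show ?thesis by simp
    qed
    with VP1 have "AE x in lborel. V1 x + V2 (x - y) = P1 x + P2 (x - y)"
      by eventually_elim simp
    ultimately show ?thesis
      by (intro coercive_imp_mu_pos[OF s N _ form_bdd_plus[OF b1 form_bdd_shift[OF b2]] Y(2) co])
  qed
  then show ?thesis using Y(1) by blast
qed

end
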